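(* Let $E=(e_n:n\in\mathbb{N})$ be a Leja sequence for the closed unit disk $D$ with $e_0=1$. For every $f\in C^\infty(D)$, the series $$\sum_{d=0}^\infty \int_{[e_0,\dots,e_d]} \mathrm{D}^df(\cdot)(x-e_0,\dots,x-e_{d-1})$$ converges to $f(x)$ uniformly for $x\in D$. Moreover, the convergence extends to all derivatives: for every multi-index $\beta\in\mathbb{N}^2$, the partial derivatives $\mathrm{D}^\beta$ (with respect to $x$) of the partial sums converge to $\mathrm{D}^\beta f$ uniformly on $D$.
   Context: $\mathbb{C}$ is identified with $\mathbb{R}^2$ via $x=(x^1,x^2)\leftrightarrow x^1+ix^2$, and $D$ is the closed unit disk. $C^\infty(D)$ is the space of (real-valued) functions that are infinitely differentiable on a neighbourhood of $D$. $\mathrm{D}^df(a)$ is the $d$-th total derivative of $f$ at $a$, a symmetric $d$-linear form on $\mathbb{R}^2$; for $d=0$ the term is $\int_{[e_0]}f=f(e_0)$. A sequence $E=(e_n:n\in\mathbb{N})$ of points of $D$ is a Leja sequence for $D$ if $\big|\prod_{j=0}^{d-1}(e_d-e_j)\big|=\max_{z\in D}\big|\prod_{j=0}^{d-1}(z-e_j)\big|$ for all $d\ge1$. Simplex functional: for $g$ continuous, $\int_{[a_0,\dots,a_d]}g:=\int_{\Delta_d}g\big(a_0+\sum_{j=1}^d t_j(a_j-a_0)\big)\,dt$ for $d\ge1$, where $\Delta_d=\{t\in[0,1]^d:\sum_{j=1}^d t_j\le1\}$ and $dt$ is Lebesgue measure; $\int_{[a_0]}g:=g(a_0)$. In the series,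 the functional acts on the variable denoted by the dot, with $x$ fixed. *)

theory Defs
  imports "HOL-Analysis.Analysis"
begin

text \<open>The plane \<open>\<real>\<^sup>2\<close> is the type \<^typ>\<open>complex\<close>, viewed as a real normed space; every derivative
  below is a real derivative.\<close>

abbreviation unit_disk :: "complex set" where
  "unit_disk \<equiv> cball 0 1"

definition Leja_sequence :: "(nat \<Rightarrow> complex) \<Rightarrow> bool" where
  "Leja_sequence e \<longleftrightarrow>
     (\<forall>n. e n \<in> unit_disk) \<and>
     (\<forall>d\<ge>1. cmod (\<Prod>j<d. e d - e j) = (SUP z\<in>unit_disk. cmod (\<Prod>j<d. z - e j)))"

text \<open>\<open>total_deriv f [v\<^sub>1, \<dots>, v\<^sub>d] a\<close> is the value \<open>D\<^sup>d f(a)(v\<^sub>1, \<dots>, v\<^sub>d)\<close> of the \<open>d\<close>-th total derivative.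
  The recursion is \<open>D\<^sup>d f = D (D\<^sup>d\<^sup>-\<^sup>1 f)\<close>, where the outer Frechet derivative is taken after evaluating
  the multilinear form \<open>D\<^sup>d\<^sup>-\<^sup>1 f\<close> at fixed vectors; evaluation is linear and commutes with \<open>D\<close>.\<close>

fun total_deriv :: "(complex \<Rightarrow> real) \<Rightarrow> complex list \<Rightarrow> complex \<Rightarrow> real" where
  "total_deriv f [] = f"
| "total_deriv f (v # vs) = (\<lambda>a. frechet_derivative (total_deriv f vs) (at a) v)"

text \<open>Infinitely differentiable on a neighbourhood of the disk. As the space of \<open>d\<close>-linear forms on the
  plane is finite-dimensional, \<open>D\<^sup>d f\<close> is differentiable iff all its evaluations are.\<close>

definition smooth_near_disk :: "(complex \<Rightarrow> real) \<Rightarrow> bool" where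
  "smooth_near_disk f \<longleftrightarrow>
     (\<exists>U. open U \<and> unit_disk \<subseteq> U \<and>
          (\<forall>vs. \<forall>a\<in>U. total_deriv f vs differentiable (at a)))"

text \<open>Points of \<open>\<real>\<^sup>d\<close> are extensional functions on \<open>{1..d}\<close>, and Lebesgue measure on \<open>\<real>\<^sup>d\<close> is the
  \<open>d\<close>-fold product of \<^const>\<open>lborel\<close>.\<close>

definition std_simplex :: "nat \<Rightarrow> (nat \<Rightarrow> real) set" where
  "std_simplex d = {t \<in> {1..d} \<rightarrow>\<^sub>E {0..1}. (\<Sum>j=1..d. t j) \<le> 1}"

definition simplex_functional :: "(nat \<Rightarrow> complex) \<Rightarrow> nat \<Rightarrow> (complex \<Rightarrow> real) \<Rightarrow> real" where
  "simplex_functional a d g =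
     (if d = 0 then g (a 0)
      else (LINT t : std_simplex d | Pi\<^sub>M {1..d} (\<lambda>_. lborel).
              g (a 0 + (\<Sum>j=1..d. t j *\<^sub>R (a j - a 0)))))"

definition series_term :: "(nat \<Rightarrow> complex) \<Rightarrow> (complex \<Rightarrow> real) \<Rightarrow> nat \<Rightarrow> complex \<Rightarrow> real" where
  "series_term e f d x =
     simplex_functional e d (\<lambda>a. total_deriv f (map (\<lambda>j. x - e j) [0..<d]) a)"

definition partial1 :: "(complex \<Rightarrow> real) \<Rightarrow> complex \<Rightarrow> real" where
  "partial1 h x = deriv (\<lambda>s::real. h (Complex s (Im x))) (Re x)"

definition partial2 :: "(complex \<Rightarrow> real) \<Rightarrow> complex \<Rightarrow> real" where
  "partial2 h x = deriv (\<lambda>s::real. h (Complex (Re x) s)) (Im x)"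

definition partial_multi :: "nat \<times> nat \<Rightarrow> (complex \<Rightarrow> real) \<Rightarrow> complex \<Rightarrow> real" where
  "partial_multi \<beta> h = (partial1 ^^ fst \<beta>) ((partial2 ^^ snd \<beta>) h)"

end

theory Submission
  imports Defs "HOL-Complex_Analysis.Complex_Analysis"
begin

text \<open>Everything is reduced to ridge polynomials \<open>U\<^sub>k(\<langle>u, x\<rangle>)\<close>, with \<open>u\<close> a unit vector and \<open>U\<^sub>k\<close> the Chebyshev
  polynomial of the second kind. A smooth \<open>f\<close> has a Logan-Shepp expansion into such polynomials whose
  coefficients decay faster than every power of \<open>k\<close>. On a ridge polynomial the terms of the series
  are, by the Hermite-Genocchi formula, the terms of the Newton interpolation of \<open>U\<^sub>k\<close> at the
  projected points \<open>x\<^sub>j = \<langle>u, e\<^sub>j\<rangle>\<close>, and they stop at degree \<open>k\<close>. So it suffices that they are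
  polynomially bounded in \<open>k\<close>.

  By the binary structure of Leja sequences, \<open>\<Prod>\<^sub>j\<^sub><\<^sub>d (t - x\<^sub>j)\<close> is a product of at most \<open>log\<^sub>2(d + 1)\<close> factors
  \<open>2\<^sup>1\<^sup>-\<^sup>m (T\<^sub>m(t) - c)\<close> with \<open>|c| \<le> 1\<close>, hence at most \<open>(d + 1)\<^sup>2 / 2\<^sup>d\<close>. The divided difference
  \<open>U\<^sub>k[x\<^sub>0, \<dots>, x\<^sub>d]\<close> is the coefficient of \<open>r\<^sup>k\<close> in \<open>(2 r)\<^sup>d / \<Prod>\<^sub>j\<^sub>\<le>\<^sub>d (1 - 2 x\<^sub>j r + r\<^sup>2)\<close>, and Cauchy's
  inequality on \<open>|r| = 1 - 1 / (k + 2)\<close> bounds it by \<open>2\<^sup>d\<close> times a power of \<open>k\<close>.\<close>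

section \<open>Chebyshev polynomials\<close>

text \<open>For g(<u, x>) the form D^d in the directions x - e_j is the product of the numbers <u, x
  - e_j> times g^(d)(<u, .>). The product does not depend on the variable of the simplex functional
  and is a Newton polynomial in <u, x>; the functional turns the derivative into a divided
  difference. As f is merely smooth, its coefficients need not beat any exponential in k. So the
  factors 2^-d of the Newton polynomials and 2^d of the divided differences must cancel exactly,
  uniformly in u, although the projected nodes may coincide. Both bounds come from the points on the
  circle: a product over projections splits into two conjugate products over the points. The circle
  needs care for derivatives. The expansion of f is controlled on the closed disk, so identities
  between derivatives are proved inside and extended by continuity. The terms of the series are
  expanded, for each fixed d, on a disk of radius 2, so that their partial derivatives can be taken
  at points of the circle.\<close>

fun chebT :: "nat \<Rightarrow> real poly" where
  "chebT 0 = 1"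
| "chebT (Suc 0) = [:0, 1:]"
| "chebT (Suc (Suc n)) = [:0, 2:] * chebT (Suc n) - chebT n"

fun chebU :: "nat \<Rightarrow> real poly" where
  "chebU 0 = 1"
| "chebU (Suc 0) = [:0, 2:]"
| "chebU (Suc (Suc n)) = [:0, 2:] * chebU (Suc n) - chebU n"

lemma poly_chebT_cos: "poly (chebT n) (cos \<theta>) = cos (real n * \<theta>)"
proof (induction n rule: chebT.induct)
  case (3 n)
  have "cos (real (Suc (Suc n)) * \<theta>) + cos (real n * \<theta>) = 2 * cos \<theta> * cos (real (Suc n) * \<theta>)"
    using cos_add[of "real (Suc n) * \<theta>" \<theta>] cos_diff[of "real (Suc n) * \<theta>" \<theta>]
    by (simp add: algebra_simps)
  with 3 show ?case by (simp add: algebra_simps)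
qed simp_all

lemma sin_poly_chebU: "sin \<theta> * poly (chebU n) (cos \<theta>) = sin (real (Suc n) * \<theta>)"
proof (induction n rule: chebU.induct)
  case 2
  show ?case using sin_double[of \<theta>] by (simp add: mult.commute)
next
  case (3 n)
  have "sin (real (Suc (Suc (Suc n))) * \<theta>) + sin (real (Suc n) * \<theta>) = 2 * cos \<theta> * sin (real (Suc (Suc n)) * \<theta>)"
    using sin_add[of "real (Suc (Suc n)) * \<theta>" \<theta>] sin_diff[of "real (Suc (Suc n)) * \<theta>" \<theta>]
    by (simp add: algebra_simps)
  moreover have "sin \<theta> * poly (chebU (Suc (Suc n))) (cos \<theta>)
      = 2 * cos \<theta> * (sin \<theta> * poly (chebU (Suc n)) (cos \<theta>)) - sin \<theta> * poly (chebU n) (cos \<theta>)"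
    by (simp add: algebra_simps)
  ultimately show ?case using 3 by simp
qed simp

text \<open>Even without the zeros of sin, the values cos \<theta> fill (-1, 1), which is infinite.
  The excluded angles are those where an identity for \<open>chebU\<close> could not be divided by
  sin \<theta>.\<close>

lemma poly_eqI_cos:
  fixes p q :: "real poly"
  assumes "\<And>\<theta>. sin \<theta> \<noteq> 0 \<Longrightarrow> poly p (cos \<theta>) = poly q (cos \<theta>)"
  shows "p = q"
proof (rule ccontr)
  assume "p \<noteq> q"
  then have "finite {x. poly (p - q) x = 0}" by (intro poly_roots_finite) simp
  moreover have "{-1<..<1} \<subseteq> {x. poly (p - q) x = 0}"
  proof
    fix x :: real assume x: "x \<in> {-1<..<1}"
    then have "x\<^sup>2 < 1" by (auto simp: abs_square_less_1)
    then have "sin (arccos x) \<noteq> 0" using x by (simp add: sin_arccos)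
    with assms[of "arccos x"] x show "x \<in> {x. poly (p - q) x = 0}" by simp
  qed
  ultimately have "finite {-1<..<1::real}" by (rule rev_finite_subset)
  then show False by (simp add: infinite_Ioo)
qed

lemma chebT_mult:
  assumes "n \<le> m"
  shows "chebT m * chebT n = smult (1/2) (chebT (m + n) + chebT (m - n))"
proof (rule poly_eqI_cos)
  fix \<theta> :: real
  have "real (m - n) = real m - real n" using assms by simp
  then show "poly (chebT m * chebT n) (cos \<theta>) = poly (smult (1/2) (chebT (m + n) + chebT (m - n))) (cos \<theta>)"
    using cos_add[of "real m * \<theta>" "real n * \<theta>"] cos_diff[of "real m * \<theta>" "real n * \<theta>"]
    by (simp add: poly_chebT_cos algebra_simps)
qed

lemma pderiv_chebT_Suc: "pderiv (chebT (Suc n)) = smult (real (Suc n)) (chebU n)"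
proof (rule poly_eqI_cos)
  fix \<theta> :: real assume s: "sin \<theta> \<noteq> 0"
  have "((\<lambda>\<theta>. poly (chebT (Suc n)) (cos \<theta>)) has_field_derivative
      poly (pderiv (chebT (Suc n))) (cos \<theta>) * - sin \<theta>) (at \<theta>)"
    by (rule DERIV_chain2[OF poly_DERIV DERIV_cos])
  moreover have "((\<lambda>\<theta>. cos (real (Suc n) * \<theta>)) has_field_derivative
      - sin (real (Suc n) * \<theta>) * real (Suc n)) (at \<theta>)"
    by (auto intro!: derivative_eq_intros)
  ultimately have "poly (pderiv (chebT (Suc n))) (cos \<theta>) * - sin \<theta> = - sin (real (Suc n) * \<theta>) * real (Suc n)"
    unfolding poly_chebT_cos by (rule DERIV_unique)
  then have "sin \<theta> * poly (pderiv (chebT (Suc n))) (cos \<theta>) = sin \<theta> * poly (smult (real (Suc n)) (chebU n)) (cos \<theta>)"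
    unfolding sin_poly_chebU[symmetric] by (simp add: algebra_simps)
  then show "poly (pderiv (chebT (Suc n))) (cos \<theta>) = poly (smult (real (Suc n)) (chebU n)) (cos \<theta>)"
    using s by simp
qed

text \<open>Iteration writes U_n as a combination of T_n, T_{n-2}, ... whose coefficients add up to
  n + 1, the constant in \<open>cheb_bounded_chebU\<close>.\<close>

lemma chebU_Suc_Suc: "chebU (Suc (Suc n)) = chebU n + smult 2 (chebT (Suc (Suc n)))"
proof (rule poly_eqI_cos)
  fix \<theta> :: real assume s: "sin \<theta> \<noteq> 0"
  have "sin (real (Suc (Suc (Suc n))) * \<theta>) - sin (real (Suc n) * \<theta>) = 2 * sin \<theta> * cos (real (Suc (Suc n)) * \<theta>)"
    using sin_add[of "real (Suc (Suc n)) * \<theta>" \<theta>] sin_diff[of "real (Suc (Suc n)) * \<theta>" \<theta>]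
    by (simp add: algebra_simps)
  then have "sin \<theta> * poly (chebU (Suc (Suc n))) (cos \<theta>) = sin \<theta> * poly (chebU n + smult 2 (chebT (Suc (Suc n)))) (cos \<theta>)"
    unfolding poly_add poly_smult poly_chebT_cos distrib_left sin_poly_chebU by simp
  then show "poly (chebU (Suc (Suc n))) (cos \<theta>) = poly (chebU n + smult 2 (chebT (Suc (Suc n)))) (cos \<theta>)"
    using s by simp
qed

lemma poly_chebU_1: "poly (chebU n) 1 = real n + 1"
  by (induction n rule: chebU.induct) auto

lemma poly_chebU_minus: "poly (chebU n) (- t) = (-1) ^ n * poly (chebU n) t"
  by (induction n rule: chebU.induct) (auto simp: algebra_simps)

lemma abs_poly_chebT_le_1: "\<bar>t\<bar> \<le> 1 \<Longrightarrow> \<bar>poly (chebT n) t\<bar> \<le> 1"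
  using poly_chebT_cos[of n "arccos t"] by (auto simp: abs_le_iff)

text \<open>The base 5 satisfies 4 * 5 + 1 \<le> 5^2, where 4 bounds |2 t|. Exponential growth is
  acceptable, since the bound outside [-1, 1] only serves expansions of fixed degree.\<close>

lemma abs_poly_chebT_le_power:
  assumes "\<bar>t\<bar> \<le> 2"
  shows "\<bar>poly (chebT n) t\<bar> \<le> 5 ^ n"
proof (induction n rule: chebT.induct)
  case (3 n)
  have "\<bar>poly (chebT (Suc (Suc n))) t\<bar> \<le> \<bar>2 * t\<bar> * \<bar>poly (chebT (Suc n)) t\<bar> + \<bar>poly (chebT n) t\<bar>"
    by (simp flip: abs_mult)
  also have "\<dots> \<le> 4 * 5 ^ Suc n + 5 ^ n"
    using 3 assms by (intro add_mono mult_mono) auto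
  finally show ?case by simp
qed (use assms in auto)

text \<open>\<open>cheb_bounded d B p\<close>: \<open>p\<close> has degree at most \<open>d\<close>, and the absolute values of its coefficients in
  the basis \<^const>\<open>chebT\<close> add up to at most \<open>B\<close>. This norm, unlike the supremum over \<open>[-1, 1]\<close>, makes
  Markov's inequality trivial.\<close>

inductive cheb_bounded :: "nat \<Rightarrow> real \<Rightarrow> real poly \<Rightarrow> bool" where
  cheb_bounded_chebT: "m \<le> d \<Longrightarrow> \<bar>c\<bar> \<le> B \<Longrightarrow> cheb_bounded d B (smult c (chebT m))"
| cheb_bounded_add: "cheb_bounded d A p \<Longrightarrow> cheb_bounded d B q \<Longrightarrow> cheb_bounded d (A + B) (p + q)"

lemma cheb_bounded_nonneg: "cheb_bounded d B p \<Longrightarrow> 0 \<le> B"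
  by (induction rule: cheb_bounded.induct) auto

lemma cheb_bounded_mono: "cheb_bounded d B p \<Longrightarrow> d \<le> d' \<Longrightarrow> B \<le> B' \<Longrightarrow> cheb_bounded d' B' p"
proof (induction arbitrary: B' rule: cheb_bounded.induct)
  case (cheb_bounded_add d A p B q)
  then have "cheb_bounded d' (A + (B' - A)) (p + q)"
    by (intro cheb_bounded.cheb_bounded_add) auto
  then show ?case by simp
qed (auto intro: cheb_bounded.intros)

lemma cheb_bounded_smult: "cheb_bounded d B p \<Longrightarrow> cheb_bounded d (\<bar>c\<bar> * B) (smult c p)"
proof (induction rule: cheb_bounded.induct)
  case (cheb_bounded_chebT m d a B)
  then show ?case by (auto intro!: cheb_bounded.cheb_bounded_chebT simp: abs_mult mult_left_mono)
next
  case (cheb_bounded_add d A p B q)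
  then show ?case using cheb_bounded.cheb_bounded_add by (simp add: smult_add_right distrib_left)
qed

text \<open>A product T_m T_n is the mean of two Chebyshev polynomials, so multiplication by T_m
  does not increase the coefficient sum. This makes the norm submultiplicative, as products over
  blocks require.\<close>

lemma cheb_bounded_chebT_mult:
  "cheb_bounded d B p \<Longrightarrow> cheb_bounded (m + d) B (chebT m * p)"
proof (induction rule: cheb_bounded.induct)
  case (cheb_bounded_chebT n d c B)
  have eq: "\<exists>l. l \<le> m + n \<and> chebT m * chebT n = smult (1/2) (chebT (m + n) + chebT l)"
  proof (cases "n \<le> m")
    case True
    then show ?thesis using chebT_mult[OF True] by (intro exI[of _ "m - n"]) auto
  next
    case False
    then show ?thesis using chebT_mult[of m n]
      by (intro exI[of _ "n - m"]) (auto simp: mult.commute add.commute)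
  qed
  then obtain l where l: "l \<le> m + n" "chebT m * chebT n = smult (1/2) (chebT (m + n) + chebT l)" by blast
  have "chebT m * smult c (chebT n) = smult (c/2) (chebT (m + n)) + smult (c/2) (chebT l)"
    using l by (simp add: smult_add_right mult.commute)
  moreover have "cheb_bounded (m + d) (B/2 + B/2) \<dots>"
    using l cheb_bounded_chebT by (intro cheb_bounded.intros) auto
  ultimately show ?case by simp
next
  case (cheb_bounded_add d A p B q)
  then show ?case using cheb_bounded.cheb_bounded_add by (simp add: distrib_left)
qed

lemma cheb_bounded_mult:
  "cheb_bounded d A p \<Longrightarrow> cheb_bounded d' B q \<Longrightarrow> cheb_bounded (d + d') (A * B) (p * q)"
proof (induction rule: cheb_bounded.induct)
  case (cheb_bounded_chebT m d c A)
  then have "cheb_bounded (m + d') (\<bar>c\<bar> * B) (smult c (chebT m * q))"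
    by (intro cheb_bounded_smult cheb_bounded_chebT_mult)
  moreover have "\<bar>c\<bar> * B \<le> A * B"
    using cheb_bounded_chebT cheb_bounded_nonneg by (intro mult_right_mono) auto
  ultimately show ?case using cheb_bounded_chebT by (auto intro: cheb_bounded_mono)
next
  case (cheb_bounded_add d A p B' q)
  then show ?case using cheb_bounded.cheb_bounded_add by (simp add: distrib_right)
qed

lemma cheb_bounded_chebU: "cheb_bounded n (real n + 1) (chebU n)"
proof (induction n rule: chebU.induct)
  case 1
  show ?case using cheb_bounded_chebT[of 0 0 1 1] by (simp add: one_pCons)
next
  case 2
  show ?case using cheb_bounded_chebT[of 1 1 2 2] by simp
next
  case (3 n)
  have "cheb_bounded (Suc (Suc n)) ((real n + 1) + 2) (chebU n + smult 2 (chebT (Suc (Suc n))))"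
    using 3(2) by (intro cheb_bounded.intros cheb_bounded_mono[OF 3(2)]) auto
  then show ?case by (metis chebU_Suc_Suc add.assoc add.commute of_nat_Suc one_add_one)
qed

text \<open>T_m' = m U_{m-1}, and U_{m-1} has coefficient sum at most m, so differentiation costs
  m^2 on each basis element.\<close>

lemma cheb_bounded_pderiv: "cheb_bounded d B p \<Longrightarrow> cheb_bounded d (B * (real d)\<^sup>2) (pderiv p)"
proof (induction rule: cheb_bounded.induct)
  case (cheb_bounded_chebT m d c B)
  show ?case
  proof (cases m)
    case 0
    then have "pderiv (smult c (chebT m)) = smult 0 (chebT m)" by (simp add: pderiv_smult)
    moreover have "0 \<le> B * (real d)\<^sup>2" using cheb_bounded_chebT by (intro mult_nonneg_nonneg) auto
    ultimately show ?thesis using cheb_bounded_chebT cheb_bounded.cheb_bounded_chebT[of m d 0 "B * (real d)\<^sup>2"] by simp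
  next
    case (Suc n)
    have "pderiv (smult c (chebT m)) = smult (c * real (Suc n)) (chebU n)"
      using Suc by (simp add: pderiv_smult pderiv_chebT_Suc del: chebT.simps)
    moreover have "cheb_bounded n (\<bar>c * real (Suc n)\<bar> * (real n + 1)) (smult (c * real (Suc n)) (chebU n))"
      by (intro cheb_bounded_smult cheb_bounded_chebU)
    moreover have "\<bar>c * real (Suc n)\<bar> * (real n + 1) \<le> B * (real d)\<^sup>2"
    proof -
      have "\<bar>c * real (Suc n)\<bar> * (real n + 1) = \<bar>c\<bar> * (real (Suc n))\<^sup>2"
        unfolding abs_mult by (simp add: power2_eq_square)
      also have "\<dots> \<le> B * (real d)\<^sup>2"
        using cheb_bounded_chebT Suc by (intro mult_mono power_mono) auto
      finally show ?thesis .
    qed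
    ultimately show ?thesis using Suc cheb_bounded_chebT by (auto intro: cheb_bounded_mono)
  qed
next
  case (cheb_bounded_add d A p B q)
  then show ?case using cheb_bounded.cheb_bounded_add by (simp add: pderiv_add distrib_right)
qed

lemma cheb_bounded_pderiv_funpow:
  "cheb_bounded d B p \<Longrightarrow> cheb_bounded d (B * real d ^ (2 * n)) ((pderiv ^^ n) p)"
proof (induction n)
  case (Suc n)
  from cheb_bounded_pderiv[OF Suc.IH[OF Suc.prems]]
  show ?case by (simp add: power2_eq_square algebra_simps)
qed simp

lemma abs_poly_le_cheb_bounded: "cheb_bounded d B p \<Longrightarrow> \<bar>t\<bar> \<le> 1 \<Longrightarrow> \<bar>poly p t\<bar> \<le> B"
proof (induction rule: cheb_bounded.induct)
  case (cheb_bounded_chebT m d c B)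
  have "\<bar>c\<bar> * \<bar>poly (chebT m) t\<bar> \<le> B * 1"
    using cheb_bounded_chebT abs_poly_chebT_le_1 by (intro mult_mono) auto
  then show ?case by (simp add: abs_mult)
qed (auto intro: order_trans[OF abs_triangle_ineq])

lemma abs_poly_le_cheb_bounded_power: "cheb_bounded d B p \<Longrightarrow> \<bar>t\<bar> \<le> 2 \<Longrightarrow> \<bar>poly p t\<bar> \<le> B * 5 ^ d"
proof (induction rule: cheb_bounded.induct)
  case (cheb_bounded_chebT m d c B)
  have "(5::real) ^ m \<le> 5 ^ d" using cheb_bounded_chebT by (intro power_increasing) auto
  then have "\<bar>poly (chebT m) t\<bar> \<le> 5 ^ d"
    using abs_poly_chebT_le_power[of t m] cheb_bounded_chebT by linarith
  then have "\<bar>c\<bar> * \<bar>poly (chebT m) t\<bar> \<le> B * 5 ^ d"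
    using cheb_bounded_chebT by (intro mult_mono) auto
  then show ?case by (simp add: abs_mult)
next
  case (cheb_bounded_add d A p B q)
  then show ?case by (auto simp: distrib_right intro: order_trans[OF abs_triangle_ineq])
qed

section \<open>Newton expansion of \<open>U\<^sub>k\<close>\<close>

text \<open>\<open>newton_coeff a k d\<close> is the divided difference \<open>U\<^sub>k[a\<^sub>0, \<dots>, a\<^sub>d]\<close>, also for coinciding points. The
  recursion comes from \<open>U\<^sub>k\<^sub>+\<^sub>2 = 2 t U\<^sub>k\<^sub>+\<^sub>1 - U\<^sub>k\<close> and the Leibniz rule for divided differences.\<close>

fun newton_coeff :: "(nat \<Rightarrow> real) \<Rightarrow> nat \<Rightarrow> nat \<Rightarrow> real" where
  "newton_coeff a 0 d = (if d = 0 then 1 else 0)"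
| "newton_coeff a (Suc 0) d =
     2 * a d * newton_coeff a 0 d + 2 * (if d = 0 then 0 else newton_coeff a 0 (d - 1))"
| "newton_coeff a (Suc (Suc k)) d =
     2 * a d * newton_coeff a (Suc k) d + 2 * (if d = 0 then 0 else newton_coeff a (Suc k) (d - 1))
       - newton_coeff a k d"

definition newton_poly :: "(nat \<Rightarrow> real) \<Rightarrow> nat \<Rightarrow> real poly" where
  "newton_poly a d = (\<Prod>j<d. [:- a j, 1:])"

lemma poly_newton_poly: "poly (newton_poly a d) t = (\<Prod>j<d. t - a j)"
  by (simp add: newton_poly_def poly_prod)

lemma newton_coeff_eq_0: "k < d \<Longrightarrow> newton_coeff a k d = 0"
proof (induction a k d rule: newton_coeff.induct)
  case (3 a k d)
  then show ?case by auto
qed auto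

text \<open>Coefficient form of t N_d = a_d N_d + N_{d+1} in the Newton basis. The hypothesis on c
  removes the term with a_{k+1} c_{k+1} at the top index.\<close>

lemma newton_shift:
  "(\<Sum>d\<le>Suc k. smult (2 * a d * c d + 2 * (if d = 0 then 0 else c (d - 1))) (newton_poly a d))
     = [:0, 2:] * (\<Sum>d\<le>k. smult (c d) (newton_poly a d))" if "c (Suc k) = 0"
proof -
  have "(\<Sum>d\<le>Suc k. smult (2 * a d * c d + 2 * (if d = 0 then 0 else c (d - 1))) (newton_poly a d))
      = (\<Sum>d\<le>Suc k. smult (2 * a d * c d) (newton_poly a d))
        + (\<Sum>d\<le>Suc k. smult (2 * (if d = 0 then 0 else c (d - 1))) (newton_poly a d))"
    by (simp only: smult_add_left sum.distrib)
  also have "(\<Sum>d\<le>Suc k. smult (2 * a d * c d) (newton_poly a d)) = (\<Sum>d\<le>k. smult (2 * a d * c d) (newton_poly a d))"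
    using that by simp
  also have "(\<Sum>d\<le>Suc k. smult (2 * (if d = 0 then 0 else c (d - 1))) (newton_poly a d))
      = (\<Sum>d\<le>k. smult (2 * c d) (newton_poly a (Suc d)))"
    unfolding sum.atMost_Suc_shift by simp
  also have "(\<Sum>d\<le>k. smult (2 * a d * c d) (newton_poly a d)) + \<dots>
      = (\<Sum>d\<le>k. [:0, 2:] * smult (c d) (newton_poly a d))"
    unfolding sum.distrib[symmetric]
  proof (intro sum.cong refl)
    fix d
    have *: "poly (newton_poly a (Suc d)) t = poly (newton_poly a d) t * (t - a d)" for t
      by (simp add: poly_newton_poly)
    show "smult (2 * a d * c d) (newton_poly a d) + smult (2 * c d) (newton_poly a (Suc d))
        = [:0, 2:] * smult (c d) (newton_poly a d)"
      by (intro poly_eqI_cos) (simp add: * algebra_simps)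
  qed
  finally show ?thesis by (simp add: sum_distrib_left)
qed

lemma chebU_eq_newton: "chebU k = (\<Sum>d\<le>k. smult (newton_coeff a k d) (newton_poly a d))"
proof (induction k rule: chebU.induct)
  case 1
  show ?case by (simp add: newton_poly_def one_pCons)
next
  case 2
  have "(\<Sum>d\<le>Suc 0. smult (newton_coeff a (Suc 0) d) (newton_poly a d))
      = [:0, 2:] * (\<Sum>d\<le>0. smult (newton_coeff a 0 d) (newton_poly a d))"
    using newton_shift[of "newton_coeff a 0" 0 a] by simp
  then show ?case by (simp add: newton_poly_def del: newton_coeff.simps(2))
next
  case (3 k)
  have "(\<Sum>d\<le>Suc (Suc k). smult (newton_coeff a (Suc (Suc k)) d) (newton_poly a d))
      = (\<Sum>d\<le>Suc (Suc k). smult (2 * a d * newton_coeff a (Suc k) d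
          + 2 * (if d = 0 then 0 else newton_coeff a (Suc k) (d - 1))) (newton_poly a d))
        - (\<Sum>d\<le>Suc (Suc k). smult (newton_coeff a k d) (newton_poly a d))"
    by (simp only: newton_coeff.simps smult_diff_left sum_subtractf)
  also have "(\<Sum>d\<le>Suc (Suc k). smult (newton_coeff a k d) (newton_poly a d)) = chebU k"
    using 3(2) by (simp add: newton_coeff_eq_0)
  finally show ?case
    using newton_shift[of "newton_coeff a (Suc k)" "Suc k" a] 3(1) by (simp add: newton_coeff_eq_0)
qed

text \<open>For fixed d the recursion in k has constant coefficients, so summing it against r^k
  yields the factor 1 - 2 a_d r + r^2, with 2 r times the series of d - 1 as inhomogeneous part.
  Coefficients are complex in view of Cauchy's inequality.\<close>

lemma newton_coeff_gf_step:
  fixes a :: "nat \<Rightarrow> real"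
  defines "C \<equiv> \<lambda>d. Abs_fps (\<lambda>k. complex_of_real (newton_coeff a k d))"
  shows "C 0 * (1 - fps_const (of_real (2 * a 0)) * fps_X + fps_X\<^sup>2) = 1"
    and "C (Suc d) * (1 - fps_const (of_real (2 * a (Suc d))) * fps_X + fps_X\<^sup>2) = 2 * fps_X * C d"
proof -
  have *: "(C d * (1 - fps_const (of_real (2 * a d)) * fps_X + fps_X\<^sup>2)) $ k =
      (if k = 0 then newton_coeff a 0 d else if k = 1 then newton_coeff a 1 d - 2 * a d * newton_coeff a 0 d
       else newton_coeff a k d - 2 * a d * newton_coeff a (k - 1) d + newton_coeff a (k - 2) d)" for d k
  proof -
    have "C d * (1 - fps_const (of_real (2 * a d)) * fps_X + fps_X\<^sup>2)
        = C d - fps_const (of_real (2 * a d)) * (fps_X * C d) + fps_X * (fps_X * C d)"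
      by (simp add: algebra_simps power2_eq_square)
    then show ?thesis
      by (cases k; cases "k - 1") (auto simp: C_def numeral_2_eq_2)
  qed
  show "C 0 * (1 - fps_const (of_real (2 * a 0)) * fps_X + fps_X\<^sup>2) = 1"
  proof (rule fps_ext)
    fix k show "(C 0 * (1 - fps_const (of_real (2 * a 0)) * fps_X + fps_X\<^sup>2)) $ k = 1 $ k"
      unfolding * by (cases "(a, k, 0::nat)" rule: newton_coeff.cases) auto
  qed
  show "C (Suc d) * (1 - fps_const (of_real (2 * a (Suc d))) * fps_X + fps_X\<^sup>2) = 2 * fps_X * C d"
  proof (rule fps_ext)
    fix k
    have eq: "(2 * fps_X * C d) $ k = 2 * (fps_X * C d) $ k"
      unfolding mult.assoc numeral_fps_const by (rule fps_mult_left_const_nth)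
    show "(C (Suc d) * (1 - fps_const (of_real (2 * a (Suc d))) * fps_X + fps_X\<^sup>2)) $ k = (2 * fps_X * C d) $ k"
      unfolding * eq by (cases "(a, k, d)" rule: newton_coeff.cases) (auto simp: C_def)
  qed
qed

lemma newton_coeff_gf:
  "Abs_fps (\<lambda>k. complex_of_real (newton_coeff a k d)) *
     (\<Prod>j\<le>d. 1 - fps_const (of_real (2 * a j)) * fps_X + fps_X\<^sup>2) = (2 * fps_X) ^ d"
proof (induction d)
  case 0
  show ?case using newton_coeff_gf_step(1)[of a] by simp
next
  case (Suc d)
  let ?C = "\<lambda>d. Abs_fps (\<lambda>k. complex_of_real (newton_coeff a k d))"
  let ?P = "\<lambda>j. 1 - fps_const (of_real (2 * a j)) * fps_X + fps_X\<^sup>2 :: complex fps"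
  have "?C (Suc d) * (\<Prod>j\<le>Suc d. ?P j) = (?C (Suc d) * ?P (Suc d)) * (\<Prod>j\<le>d. ?P j)"
    by (simp add: algebra_simps)
  also have "\<dots> = 2 * fps_X * (?C d * (\<Prod>j\<le>d. ?P j))"
    unfolding newton_coeff_gf_step(2) by (simp add: algebra_simps)
  finally show ?case unfolding Suc.IH by simp
qed

text \<open>The denominator has constant term 1, so the formal quotient from
  \<open>newton_coeff_gf\<close> is the Taylor series of the actual quotient. Nonvanishing is asked
  on the open unit disk to have holomorphy beyond the circle of radius \<rho>; the lower bound B is
  asked on that circle.\<close>

lemma norm_newton_coeff_le:
  fixes a :: "nat \<Rightarrow> real"
  assumes \<rho>: "0 < \<rho>" "\<rho> < 1" and nz: "\<And>r j. cmod r < 1 \<Longrightarrow> j \<le> d \<Longrightarrow> 1 - 2 * of_real (a j) * r + r\<^sup>2 \<noteq> 0"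
    and B: "\<And>r. cmod r = \<rho> \<Longrightarrow> B \<le> cmod (\<Prod>j\<le>d. 1 - 2 * of_real (a j) * r + r\<^sup>2)" "0 < B"
  shows "\<bar>newton_coeff a k d\<bar> \<le> (2 * \<rho>) ^ d / B / \<rho> ^ k"
proof -
  define P where "P = (\<lambda>r. \<Prod>j\<le>d. 1 - 2 * of_real (a j) * r + r\<^sup>2 :: complex)"
  define G where "G = (\<lambda>r. (2 * r) ^ d / P r)"
  define PF :: "complex fps" where "PF = (\<Prod>j\<le>d. 1 - fps_const (of_real (2 * a j)) * fps_X + fps_X\<^sup>2)"
  define CF where "CF = Abs_fps (\<lambda>k. complex_of_real (newton_coeff a k d))"
  have PF0: "fps_nth PF 0 \<noteq> 0" unfolding PF_def by (induction d) (simp_all add: fps_mult_nth_0)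
  have P: "P has_fps_expansion PF" unfolding P_def PF_def
  proof (intro has_fps_expansion_prod)
    fix j
    have "(\<lambda>r. 1 - of_real (2 * a j) * r + r ^ 2) has_fps_expansion
        (1 - fps_const (complex_of_real (2 * a j)) * fps_X + fps_X ^ 2)"
      by (intro fps_expansion_intros)
    then show "(\<lambda>r. 1 - 2 * of_real (a j) * r + r\<^sup>2) has_fps_expansion
        (1 - fps_const (complex_of_real (2 * a j)) * fps_X + fps_X\<^sup>2)" by simp
  qed
  have "(\<lambda>r. (2 * r) ^ d / P r) has_fps_expansion ((2 * fps_X) ^ d / PF)"
    by (intro fps_expansion_intros P PF0)
  moreover have "(2 * fps_X) ^ d / PF = CF"
  proof -
    have "CF * PF = (2 * fps_X) ^ d" unfolding CF_def PF_def by (rule newton_coeff_gf)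
    moreover have "PF \<noteq> 0" using PF0 by auto
    ultimately show ?thesis by (metis nonzero_mult_div_cancel_right)
  qed
  ultimately have "G has_fps_expansion CF" by (simp add: G_def)
  then have "fps_nth CF k = (deriv ^^ k) G 0 / fact k"
    by (rule fps_nth_fps_expansion)
  then have "(deriv ^^ k) G 0 = of_real (fact k * newton_coeff a k d)"
    by (simp add: CF_def field_simps)
  then have "norm ((deriv ^^ k) G 0) = fact k * \<bar>newton_coeff a k d\<bar>"
    by (simp only: norm_of_real abs_mult abs_of_nonneg[OF fact_ge_zero])
  moreover have "norm ((deriv ^^ k) G 0) \<le> fact k * ((2 * \<rho>) ^ d / B) / \<rho> ^ k"
  proof (rule Cauchy_inequality)
    have nz': "P r \<noteq> 0" if "cmod r < 1" for r
      using nz that by (simp add: P_def)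
    have hol: "G holomorphic_on ball 0 1" unfolding G_def P_def
      using nz by (intro holomorphic_intros) auto
    then show "G holomorphic_on ball 0 \<rho>" using \<rho> by (auto elim: holomorphic_on_subset)
    show "continuous_on (cball 0 \<rho>) G"
      using hol \<rho> by (intro holomorphic_on_imp_continuous_on) (auto elim: holomorphic_on_subset)
    show "norm (G x) \<le> (2 * \<rho>) ^ d / B" if "norm (0 - x) = \<rho>" for x
    proof -
      have "B \<le> cmod (P x)" using B(1)[of x] that by (simp add: P_def)
      moreover have "norm (G x) = (2 * \<rho>) ^ d / cmod (P x)"
        using that by (simp add: G_def norm_divide norm_mult norm_power)
      ultimately show ?thesis using B(2) \<rho> by (simp add: frac_le)
    qed
  qed (use \<rho> in auto)
  ultimately have "fact k * \<bar>newton_coeff a k d\<bar> \<le> fact k * ((2 * \<rho>) ^ d / B / \<rho> ^ k)" by simp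
  then show ?thesis by (rule mult_left_le_imp_le) simp
qed

section \<open>Leja sequences of the disk\<close>

text \<open>A pair \<open>(n, c)\<close> encodes the block of the \<open>2 ^ n\<close> solutions of \<open>z ^ 2 ^ n = c\<close>. An initial segment
  of a Leja sequence splits into blocks according to the binary expansion of its length, and adding
  a point amounts to a binary increment, in which blocks of equal size merge through
  \<open>(z\<^sup>m - c) (z\<^sup>m + c) = z\<^sup>2\<^sup>m - c\<^sup>2\<close>.\<close>

fun leja_blocks :: "(nat \<times> complex) list \<Rightarrow> bool" where
  "leja_blocks [] \<longleftrightarrow> True"
| "leja_blocks ((n, c) # L) \<longleftrightarrow>
     cmod c = 1 \<and> (\<forall>(n', c') \<in> set L. n < n' \<and> c ^ 2 ^ (n' - n) = - c') \<and> leja_blocks L"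

definition block_prod :: "(nat \<times> complex) list \<Rightarrow> complex \<Rightarrow> complex" where
  "block_prod L z = (\<Prod>(n, c)\<leftarrow>L. z ^ 2 ^ n - c)"

definition block_size :: "(nat \<times> complex) list \<Rightarrow> nat" where
  "block_size L = (\<Sum>(n, c)\<leftarrow>L. 2 ^ n)"

lemma block_simps [simp]:
  "block_prod [] z = 1" "block_prod ((n, c) # L) z = (z ^ 2 ^ n - c) * block_prod L z"
  "block_size [] = 0" "block_size ((n, c) # L) = 2 ^ n + block_size L"
  by (simp_all add: block_prod_def block_size_def)

text \<open>The induction is the carry of a binary increment. If the incoming block has the size of
  the head, its relation to the head reads \<open>c1 = - c\<close>; the two merge, and the square of
  c stands in the same relation to the remaining blocks. Hence the hypothesis allows n = n'.\<close>

lemma leja_blocks_insert: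
  assumes "leja_blocks L" "cmod c = 1" "\<And>n' c'. (n', c') \<in> set L \<Longrightarrow> n \<le> n' \<and> c ^ 2 ^ (n' - n) = - c'"
  shows "\<exists>L'. leja_blocks L' \<and> block_size L' = 2 ^ n + block_size L \<and>
           (\<forall>z. block_prod L' z = (z ^ 2 ^ n - c) * block_prod L z)"
  using assms
proof (induction L arbitrary: n c)
  case Nil
  then show ?case by (intro exI[of _ "[(n, c)]"]) auto
next
  case (Cons b L)
  obtain n1 c1 where b: "b = (n1, c1)" by force
  show ?case
  proof (cases "n < n1")
    case True
    have "leja_blocks ((n, c) # b # L)"
      using Cons.prems True b by (fastforce simp: less_le_trans)
    then show ?thesis by (intro exI[of _ "(n, c) # b # L"]) auto
  next
    case False
    then have n1: "n1 = n" using Cons.prems(3)[of n1 c1] b by simp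
    then have c1: "c1 = - c" using Cons.prems(3)[of n1 c1] b by simp
    have "\<exists>L'. leja_blocks L' \<and> block_size L' = 2 ^ Suc n + block_size L \<and>
           (\<forall>z. block_prod L' z = (z ^ 2 ^ Suc n - c\<^sup>2) * block_prod L z)"
    proof (rule Cons.IH)
      show "leja_blocks L" using Cons.prems b by simp
      show "cmod (c\<^sup>2) = 1" using Cons.prems by (simp add: norm_power)
      fix n' c' assume *: "(n', c') \<in> set L"
      then have "n < n'" using Cons.prems(1) b n1 by auto
      moreover have "c ^ 2 ^ (n' - n) = - c'" using Cons.prems(3)[of n' c'] * by auto
      moreover have "2 * 2 ^ (n' - Suc n) = (2::nat) ^ (n' - n)"
        using \<open>n < n'\<close> by (metis Suc_diff_Suc power_Suc)
      ultimately show "Suc n \<le> n' \<and> (c\<^sup>2) ^ 2 ^ (n' - Suc n) = - c'"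
        by (metis Suc_leI power_mult)
    qed
    then obtain L' where "leja_blocks L'" "block_size L' = 2 ^ Suc n + block_size L"
      "\<And>z. block_prod L' z = (z ^ 2 ^ Suc n - c\<^sup>2) * block_prod L z" by blast
    moreover have "z ^ 2 ^ Suc n - c\<^sup>2 = (z ^ 2 ^ n - c) * (z ^ 2 ^ n - c1)" for z
      unfolding power_Suc2 power_mult by (simp add: c1 power2_eq_square algebra_simps)
    ultimately show ?thesis using b n1 by (intro exI[of _ L']) (simp add: mult.assoc)
  qed
qed

text \<open>Parallelogram law: |a + c|^2 \<le> 2 + 2 - 4.\<close>

lemma diff_norm_ge_2_imp_antipodal:
  assumes "cmod a \<le> 1" "cmod c = 1" "2 \<le> cmod (a - c)"
  shows "a = - c"
proof -
  have "(cmod (a + c))\<^sup>2 + (cmod (a - c))\<^sup>2 = 2 * (cmod a)\<^sup>2 + 2 * (cmod c)\<^sup>2"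
    unfolding cmod_power2 by (simp add: power2_eq_square algebra_simps)
  moreover have "4 \<le> (cmod (a - c))\<^sup>2" using power_mono[OF assms(3), of 2] by simp
  moreover have "(cmod a)\<^sup>2 \<le> 1" using assms by (simp add: power_le_one)
  moreover have "(cmod c)\<^sup>2 = 1" using assms by simp
  ultimately have "(cmod (a + c))\<^sup>2 \<le> 0" by linarith
  then have "a + c = 0" by simp
  then show ?thesis by (simp only: eq_neg_iff_add_eq_0)
qed

lemma exists_unit_root:
  assumes "cmod w = 1" "n > 0"
  shows "\<exists>z. cmod z = 1 \<and> z ^ n = w"
proof -
  have "w = cis (Arg w)" using assms by (metis cis_Arg_unique norm_eq_zero rcis_cmod_Arg rcis_def of_real_1 mult_1)
  moreover have "cis (Arg w / n) ^ n = cis (Arg w)" unfolding Complex.DeMoivre using assms(2) by simp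
  ultimately have "cis (Arg w / n) ^ n = w" by simp
  then show ?thesis by (intro exI[of _ "cis (Arg w / n)"]) simp
qed

lemma norm_block_prod_le:
  assumes "leja_blocks L" "cmod z \<le> 1"
  shows "cmod (block_prod L z) \<le> 2 ^ length L"
  using assms
proof (induction L)
  case (Cons b L)
  obtain n c where b: "b = (n, c)" by force
  have "cmod (z ^ 2 ^ n - c) \<le> cmod (z ^ 2 ^ n) + cmod c" by (rule norm_triangle_ineq4)
  also have "\<dots> \<le> 2" using Cons.prems b by (simp add: norm_power power_le_one)
  finally show ?case using Cons b by (auto simp: norm_mult intro!: mult_mono)
qed simp

text \<open>It suffices to solve z^(2^n) = -c for the head, the smallest block. For a larger block
  (n', c') the power 2^(n' - n) is even, so the sign disappears and the relation between c and c'
  makes that factor equal to -2 c'.\<close>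

lemma norm_block_prod_attained:
  assumes "leja_blocks L"
  shows "\<exists>z. cmod z = 1 \<and> cmod (block_prod L z) = 2 ^ length L"
proof (cases L)
  case (Cons b L')
  obtain n c where b: "b = (n, c)" by force
  obtain z where z: "cmod z = 1" "z ^ 2 ^ n = - c"
    using exists_unit_root[of "- c" "2 ^ n"] assms Cons b by auto
  have "z ^ 2 ^ n' = - c'" if "(n', c') \<in> set L" for n' c'
  proof (cases "(n', c') = b")
    case False
    then have "n < n'" "c ^ 2 ^ (n' - n) = - c'" using assms Cons b that by auto
    moreover have "(2::nat) ^ n' = 2 ^ n * 2 ^ (n' - n)" using \<open>n < n'\<close> by (simp flip: power_add)
    ultimately have "z ^ 2 ^ n' = (- c) ^ 2 ^ (n' - n)" by (simp add: power_mult z)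
    also have "\<dots> = c ^ 2 ^ (n' - n)" using \<open>n < n'\<close> by (simp add: power_minus_even)
    finally show ?thesis using \<open>c ^ 2 ^ (n' - n) = - c'\<close> by simp
  qed (use z b in simp)
  moreover have "cmod c' = 1" if "(n', c') \<in> set L" for n' c'
    using that assms by (induction L) auto
  ultimately have "\<forall>(n', c') \<in> set L. cmod (z ^ 2 ^ n' - c') = 2"
    by (auto simp: norm_minus_cancel simp flip: mult_2 minus_add_distrib add_uminus_conv_diff simp: norm_mult)
  then have "cmod (block_prod L z) = 2 ^ length L"
    by (induction L) (auto simp: norm_mult)
  with z show ?thesis by blast
qed (auto intro: exI[of _ 1])

text \<open>Every factor has modulus at most 2, so reaching 2^length forces modulus 2 in each of
  them, and there z^(2^n) and c are antipodal.\<close>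

lemma block_prod_extremal:
  assumes "leja_blocks L" "cmod z \<le> 1" "2 ^ length L \<le> cmod (block_prod L z)" "(n, c) \<in> set L"
  shows "z ^ 2 ^ n = - c"
  using assms
proof (induction L)
  case (Cons b L)
  obtain n1 c1 where b: "b = (n1, c1)" by force
  have le: "cmod (block_prod L z) \<le> 2 ^ length L"
    using Cons.prems b by (intro norm_block_prod_le) auto
  have c1: "cmod (z ^ 2 ^ n1) \<le> 1" "cmod c1 = 1"
    using Cons.prems b by (auto simp: norm_power power_le_one)
  then have le2: "cmod (z ^ 2 ^ n1 - c1) \<le> 2"
    using norm_triangle_ineq4[of "z ^ 2 ^ n1" c1] by simp
  have ge: "2 * 2 ^ length L \<le> cmod (z ^ 2 ^ n1 - c1) * cmod (block_prod L z)"
    using Cons.prems(3) b by (simp add: norm_mult)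
  also have "\<dots> \<le> cmod (z ^ 2 ^ n1 - c1) * 2 ^ length L"
    by (intro mult_left_mono le) simp
  finally have "2 \<le> cmod (z ^ 2 ^ n1 - c1)" by simp
  then have z: "z ^ 2 ^ n1 = - c1" using c1 by (rule diff_norm_ge_2_imp_antipodal[rotated 2])
  have "2 * 2 ^ length L \<le> 2 * cmod (block_prod L z)"
    using ge mult_right_mono[OF le2 norm_ge_zero[of "block_prod L z"]] by linarith
  then show ?case using Cons b z by auto
qed simp

text \<open>Block structure and unit modulus are proved together. The Leja condition makes the next
  point maximize the block product, hence antipodal to every block, which is exactly what is
  required to insert it as a block of size 1. The induction starts from the block (0, 1) given by
  \<open>e 0 = 1\<close>.\<close>

lemma leja_sequence_blocks:
  assumes "Leja_sequence e" "e 0 = 1"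
  shows "\<exists>L. leja_blocks L \<and> block_size L = d \<and> (\<forall>z. (\<Prod>j<d. z - e j) = block_prod L z)"
    and "cmod (e d) = 1"
proof -
  have ex: "cmod (e d) = 1 \<and> (\<exists>L. leja_blocks L \<and> block_size L = Suc d \<and> (\<forall>z. (\<Prod>j<Suc d. z - e j) = block_prod L z))" for d
  proof (induction d)
    case 0
    show ?case using assms by (auto intro!: exI[of _ "[(0, 1)]"])
  next
    case (Suc d)
    then obtain L where L: "leja_blocks L" "block_size L = Suc d"
      "\<And>z. (\<Prod>j<Suc d. z - e j) = block_prod L z" by blast
    have e: "cmod (e (Suc d)) \<le> 1" using assms by (simp add: Leja_sequence_def)
    obtain z where z: "cmod z = 1" "cmod (block_prod L z) = 2 ^ length L"
      using norm_block_prod_attained[OF L(1)] by blast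
    have "cmod (\<Prod>j<Suc d. e (Suc d) - e j) = (SUP z\<in>unit_disk. cmod (\<Prod>j<Suc d. z - e j))"
      using assms by (simp add: Leja_sequence_def del: prod.lessThan_Suc)
    then have "cmod (block_prod L (e (Suc d))) = (SUP z\<in>unit_disk. cmod (block_prod L z))"
      unfolding L(3) .
    moreover have "cmod (block_prod L z) \<le> (SUP z\<in>unit_disk. cmod (block_prod L z))"
      using z(1) norm_block_prod_le[OF L(1)]
      by (intro cSUP_upper bdd_aboveI2[where M = "2 ^ length L"]) auto
    ultimately have "2 ^ length L \<le> cmod (block_prod L (e (Suc d)))" using z(2) by simp
    then have *: "\<And>n c. (n, c) \<in> set L \<Longrightarrow> e (Suc d) ^ 2 ^ n = - c"
      using block_prod_extremal[OF L(1) e] by blast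
    have "cmod (e (Suc d)) = 1"
    proof (cases L)
      case (Cons b L')
      obtain n c where "b = (n, c)" by force
      then have "cmod (e (Suc d)) ^ 2 ^ n = 1 ^ 2 ^ n"
        using *[of n c] L(1) Cons by (simp flip: norm_power)
      then show ?thesis by (rule power_eq_imp_eq_base) auto
    qed (use L(2) in simp)
    moreover have "\<exists>L'. leja_blocks L' \<and> block_size L' = 2 ^ 0 + block_size L \<and>
        (\<forall>z. block_prod L' z = (z ^ 2 ^ 0 - e (Suc d)) * block_prod L z)"
      using * calculation by (intro leja_blocks_insert L(1)) auto
    ultimately show ?case using L(2) unfolding prod.lessThan_Suc[of _ "Suc d"] L(3)
      by (metis mult.commute power_0 power_one_right add.commute plus_1_eq_Suc)
  qed
  show "\<exists>L. leja_blocks L \<and> block_size L = d \<and> (\<forall>z. (\<Prod>j<d. z - e j) = block_prod L z)"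
  proof (cases d)
    case 0
    then show ?thesis by (intro exI[of _ "[]"]) auto
  qed (use ex in blast)
  show "cmod (e d) = 1" using ex by blast
qed

text \<open>Block sizes are distinct powers of 2, so they add up to at least 1 + 2 + ... + 2^(length
  - 1). The induction scales this by 2^k, with k a lower bound of the exponents.\<close>

lemma two_power_length_le:
  assumes "leja_blocks L"
  shows "2 ^ length L \<le> block_size L + 1"
proof -
  have "2 ^ k * (2 ^ length L - 1) \<le> real (block_size L)" if "\<forall>(n, c) \<in> set L. k \<le> n" for k
    using assms that
  proof (induction L arbitrary: k)
    case (Cons b L)
    obtain n c where b: "b = (n, c)" by force
    have "2 ^ Suc n * (2 ^ length L - 1) \<le> real (block_size L)"
      using Cons.prems b by (intro Cons.IH) (auto simp: Suc_le_eq)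
    then have "2 ^ n * (2 * 2 ^ length L - 1) \<le> real (block_size (b # L))"
      using b by (simp add: algebra_simps)
    moreover have "2 ^ k * (2 * 2 ^ length L - 1) \<le> 2 ^ n * (2 * 2 ^ length L - 1 :: real)"
    proof (intro mult_right_mono power_increasing)
      have "(1::real) \<le> 2 ^ length L" by simp
      then show "0 \<le> (2 * 2 ^ length L - 1 :: real)" by linarith
    qed (use Cons.prems b in auto)
    ultimately show ?case by simp
  qed simp
  from this[of 0] have "real (2 ^ length L) \<le> real (block_size L + 1)" by simp
  then show ?thesis by (simp only: of_nat_le_iff)
qed

lemma block_le_block_size: "(n, c) \<in> set L \<Longrightarrow> 2 ^ n \<le> block_size L"
  by (induction L) auto

text \<open>A small factor forces the factors of all larger blocks to be close to 2, so the small factors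
  telescope.\<close>

lemma norm_block_factors_ge:
  assumes L: "leja_blocks L" and s: "cmod s \<le> 1 - 1 / K" and K: "1 \<le> K" and M: "1 \<le> M"
    and le: "\<And>n c. (n, c) \<in> set L \<Longrightarrow> 2 ^ n \<le> M"
  shows "1 / (M * K) \<le> cmod (\<Prod>(n, c)\<leftarrow>L. 1 - c * s ^ 2 ^ n)"
proof -
  define a where "a = (\<lambda>(n, c). cmod (1 - c * s ^ 2 ^ n))"
  have s1: "cmod s \<le> 1" using s K by (smt (verit) divide_nonneg_nonneg)
  \<comment> \<open>The invariant is stronger than the claim: unless the product is at least 1, some
    block has a factor below 1 and its size enters the bound. A further small factor at a smaller
    block then loses only the ratio of the two sizes.\<close>
  have "1 \<le> prod_list (map a L) \<or> (\<exists>n c. (n, c) \<in> set L \<and> a (n, c) < 1 \<and> 2 ^ n / (M * K) \<le> prod_list (map a L))"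
    using L le
  proof (induction L)
    case (Cons b L)
    obtain n c where b: "b = (n, c)" by force
    have IH: "1 \<le> prod_list (map a L) \<or> (\<exists>n c. (n, c) \<in> set L \<and> a (n, c) < 1 \<and> 2 ^ n / (M * K) \<le> prod_list (map a L))"
      using Cons b by auto
    have pos: "0 \<le> prod_list (map a L)" by (intro prod_list_nonneg) (auto simp: a_def)
    have c: "cmod c = 1" using Cons.prems b by simp
    show ?case
    proof (cases "1 \<le> a b")
      case True
      then have "prod_list (map a L) \<le> prod_list (map a (b # L))"
        using mult_right_mono[OF True pos] by simp
      with IH show ?thesis by (meson list.set_intros(2) order_trans)
    next
      case False
      have "2 ^ n / (M * K) \<le> prod_list (map a (b # L))"
        using IH
      proof
        assume 1: "1 \<le> prod_list (map a L)"
        have "cmod (s ^ 2 ^ n) \<le> cmod s"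
          using power_decreasing[of 1 "2 ^ n" "cmod s"] s1 by (simp add: norm_power)
        then have "1 / K \<le> 1 - cmod (c * s ^ 2 ^ n)" using s c by (simp add: norm_mult)
        also have "\<dots> \<le> a b"
          using norm_triangle_ineq2[of 1 "c * s ^ 2 ^ n"] by (simp add: a_def b)
        finally have "1 / K \<le> a b" .
        moreover have "2 ^ n / (M * K) \<le> 1 / K"
          using Cons.prems(2)[of n c] b K M by (simp add: field_simps)
        moreover have "a b * 1 \<le> a b * prod_list (map a L)"
          using 1 by (intro mult_left_mono) (auto simp: a_def b)
        ultimately show ?thesis by simp
      next
        assume "\<exists>n c. (n, c) \<in> set L \<and> a (n, c) < 1 \<and> 2 ^ n / (M * K) \<le> prod_list (map a L)"
        then obtain n' c' where n': "(n', c') \<in> set L" "a (n', c') < 1" "2 ^ n' / (M * K) \<le> prod_list (map a L)"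
          by blast
        define q where "q = (2::nat) ^ (n' - n)"
        have nn: "n < n'" "c ^ q = - c'" using Cons.prems b n' by (auto simp: q_def)
        have q: "2 ^ n' = 2 ^ n * q" using nn by (simp add: q_def flip: power_add)
        \<comment> \<open>Since c^q = -c', the q-th power of c s^(2^n) is -c' s^(2^n'). The factor
          of c' is below 1, so |1 + c' s^(2^n')| exceeds 1, and the present factor is at least 1 /
          q.\<close>
        have "cmod (1 ^ q - (c * s ^ 2 ^ n) ^ q) \<le> real q * cmod (1 - c * s ^ 2 ^ n)"
          using c s1 by (intro norm_power_diff) (auto simp: norm_mult norm_power power_le_one)
        moreover have "(c * s ^ 2 ^ n) ^ q = - (c' * s ^ 2 ^ n')"
          using nn q by (simp add: power_mult_distrib power_mult)
        ultimately have "cmod (1 + c' * s ^ 2 ^ n') \<le> real q * a b" by (simp add: a_def b)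
        moreover have "2 \<le> cmod (1 - c' * s ^ 2 ^ n') + cmod (1 + c' * s ^ 2 ^ n')"
          using norm_triangle_ineq[of "1 - c' * s ^ 2 ^ n'" "1 + c' * s ^ 2 ^ n'"] by simp
        ultimately have "1 \<le> real q * a b" using n'(2) by (simp add: a_def)
        then have "2 ^ n / (M * K) \<le> real q * a b * (2 ^ n / (M * K))"
          using mult_right_mono[of 1 "real q * a b" "2 ^ n / (M * K)"] K M by simp
        also have "\<dots> = a b * (2 ^ n' / (M * K))"
        proof -
          have "(2::real) ^ n' = 2 ^ n * real q" by (simp add: q_def nn flip: power_add) (use nn in simp)
          then show ?thesis by simp
        qed
        also have "\<dots> \<le> a b * prod_list (map a L)"
          using n'(3) by (intro mult_left_mono) (auto simp: a_def b)
        finally show ?thesis by simp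
      qed
      moreover have "(n, c) \<in> set (b # L)" "a (n, c) < 1" using False b by auto
      ultimately show ?thesis by blast
    qed
  qed simp
  moreover have "cmod (\<Prod>(n, c)\<leftarrow>L. 1 - c * s ^ 2 ^ n) = prod_list (map a L)"
    by (induction L) (auto simp: a_def norm_mult)
  moreover have "1 / (M * K) \<le> 1" using mult_mono[of 1 M 1 K] K M by simp
  moreover have "1 / (M * K) \<le> 2 ^ n / (M * K)" for n using K M by (intro divide_right_mono) auto
  ultimately show ?thesis by (auto intro: order_trans)
qed

text \<open>Reversal of polynomials: s^d P(1 / s) turns z - e_j into 1 - e_j s and z^m - c into 1 -
  c s^m.\<close>

lemma prod_one_minus_eq_blocks:
  assumes "\<And>z. (\<Prod>j<d. z - e j) = block_prod L z" "block_size L = d" "s \<noteq> 0"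
  shows "(\<Prod>j<d. 1 - e j * s) = (\<Prod>(n, c)\<leftarrow>L. 1 - c * s ^ 2 ^ n)"
proof -
  have "(\<Prod>j<d. 1 - e j * s) = (\<Prod>j<d. s * (inverse s - e j))"
    using assms(3) by (intro prod.cong) (auto simp: field_simps)
  also have "\<dots> = s ^ block_size L * block_prod L (inverse s)"
    by (simp add: prod.distrib assms)
  also have "\<dots> = (\<Prod>(n, c)\<leftarrow>L. 1 - c * s ^ 2 ^ n)"
  proof (induction L)
    case (Cons b L)
    obtain n c where b: "b = (n, c)" by force
    have "s ^ 2 ^ n * (inverse s ^ 2 ^ n - c) = 1 - c * s ^ 2 ^ n"
      using assms(3) by (simp add: right_diff_distrib power_inverse)
    moreover have "s ^ block_size (b # L) * block_prod (b # L) (inverse s)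
        = (s ^ 2 ^ n * (inverse s ^ 2 ^ n - c)) * (s ^ block_size L * block_prod L (inverse s))"
      by (simp only: b block_simps power_add ac_simps)
    ultimately show ?case using Cons b by simp
  qed simp
  finally show ?thesis .
qed

section \<open>Projections of Leja points\<close>

lemma inner_eq_Re_cnj_mult: "u \<bullet> x = Re (cnj u * x)" for u x :: complex
  by (simp add: inner_complex_def)

lemma unit_mult_cnj: "cmod u = 1 \<Longrightarrow> u * cnj u = 1" "cmod u = 1 \<Longrightarrow> cnj u * u = 1"
  using complex_norm_square[of u] by (simp_all add: mult.commute)

lemma quadratic_factor:
  assumes "cmod \<epsilon> = 1"
  shows "1 - 2 * complex_of_real (Re \<epsilon>) * r + r\<^sup>2 = (1 - \<epsilon> * r) * (1 - cnj \<epsilon> * r)"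
proof -
  have "(1 - \<epsilon> * r) * (1 - cnj \<epsilon> * r) = 1 - (\<epsilon> + cnj \<epsilon>) * r + (\<epsilon> * cnj \<epsilon>) * r\<^sup>2"
    by (simp add: algebra_simps power2_eq_square)
  then show ?thesis using assms by (simp add: unit_mult_cnj complex_add_cnj)
qed

text \<open>The value is (1 + 1 / (k + 1))^k, which is below e. The shift to k + 2 keeps the radius
  positive at k = 0.\<close>

lemma power_ratio_le_3: "1 / (1 - 1 / real (k + 2)) ^ k \<le> 3"
proof -
  have "1 / (1 - 1 / real (k + 2)) = 1 + 1 / real (k + 1)" by (simp add: field_simps)
  then have "1 / (1 - 1 / real (k + 2)) ^ k = (1 + 1 / real (k + 1)) ^ k"
    by (metis power_one_over)
  also have "\<dots> \<le> exp (1 / real (k + 1)) ^ k"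
    by (intro power_mono exp_ge_add_one_self) auto
  also have "\<dots> = exp (real k / real (k + 1))" by (simp flip: exp_of_nat_mult)
  also have "\<dots> \<le> exp 1" by simp
  also have "\<dots> \<le> 3" by (rule exp_le)
  finally show ?thesis .
qed

text \<open>With \<epsilon> = e_j cnj u the quadratic factor is (1 - \<epsilon> r)(1 - cnj
  \<epsilon> r), so the denominator is a product over the points at cnj u r times the conjugate of
  one at cnj u cnj r. \<open>norm_block_factors_ge\<close> with M = K = k + 2 bounds each below by 1
  / K^2, hence the fourth power; 3 bounds \<rho>^-k.\<close>

lemma leja_newton_coeff_le:
  assumes e: "Leja_sequence e" "e 0 = 1" and u: "cmod u = 1" and d: "d \<le> k"
  shows "\<bar>newton_coeff (\<lambda>j. u \<bullet> e j) k d\<bar> \<le> 3 * 2 ^ d * (real k + 2) ^ 4"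
proof -
  define K where "K = real (k + 2)"
  define \<rho> where "\<rho> = 1 - 1 / K"
  have \<rho>: "0 < \<rho>" "\<rho> < 1" "1 \<le> K" by (auto simp: \<rho>_def K_def field_simps)
  obtain L where L: "leja_blocks L" "block_size L = Suc d" "\<And>z. (\<Prod>j<Suc d. z - e j) = block_prod L z"
    using leja_sequence_blocks(1)[OF e, of "Suc d"] by blast
  have e1: "cmod (cnj u * e j) = 1" for j
    using leja_sequence_blocks(2)[OF e] u by (simp add: norm_mult)
  have factor: "1 - 2 * complex_of_real (u \<bullet> e j) * r + r\<^sup>2
      = (1 - e j * (cnj u * r)) * cnj (1 - e j * (cnj u * cnj r))" for j r
    using quadratic_factor[OF e1, of j r] unfolding inner_eq_Re_cnj_mult by (simp add: algebra_simps)
  have lower: "1 / (K * K) \<le> cmod (\<Prod>j\<le>d. 1 - e j * s)" if "cmod s = \<rho>" for s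
  proof -
    have "1 / (K * K) \<le> cmod (\<Prod>(n, c)\<leftarrow>L. 1 - c * s ^ 2 ^ n)"
    proof (rule norm_block_factors_ge[OF L(1)])
      fix n c assume "(n, c) \<in> set L"
      then have "2 ^ n \<le> Suc d" using block_le_block_size L(2) by metis
      then have "real (2 ^ n) \<le> real (k + 2)" using d by (simp only: of_nat_le_iff)
      then show "2 ^ n \<le> K" by (simp add: K_def)
    qed (use that \<rho> in \<open>auto simp: \<rho>_def\<close>)
    also have "(\<Prod>(n, c)\<leftarrow>L. 1 - c * s ^ 2 ^ n) = (\<Prod>j<Suc d. 1 - e j * s)"
      using that \<rho> by (intro prod_one_minus_eq_blocks[symmetric] L) auto
    finally show ?thesis by (simp add: lessThan_Suc_atMost)
  qed
  have "\<bar>newton_coeff (\<lambda>j. u \<bullet> e j) k d\<bar> \<le> (2 * \<rho>) ^ d / (1 / (K * K) * (1 / (K * K))) / \<rho> ^ k"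
  proof (rule norm_newton_coeff_le)
    fix r :: complex and j assume "cmod r < 1" "j \<le> d"
    then have "cmod (e j * (cnj u * r)) < 1" "cmod (e j * (cnj u * cnj r)) < 1"
      using e1[of j] by (auto simp: norm_mult mult.assoc[symmetric] mult.commute[of "cmod (e j)"])
    then have "1 - e j * (cnj u * r) \<noteq> 0" "1 - e j * (cnj u * cnj r) \<noteq> 0"
      by (metis eq_iff_diff_eq_0 norm_one order_less_irrefl)+
    then show "1 - 2 * complex_of_real (u \<bullet> e j) * r + r\<^sup>2 \<noteq> 0"
      unfolding factor mult_eq_0_iff complex_cnj_zero_iff by blast
  next
    fix r assume "cmod r = \<rho>"
    then have "1 / (K * K) \<le> cmod (\<Prod>j\<le>d. 1 - e j * (cnj u * r))"
      "1 / (K * K) \<le> cmod (\<Prod>j\<le>d. 1 - e j * (cnj u * cnj r))"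
      using u by (auto intro!: lower simp: norm_mult)
    then have "1 / (K * K) * (1 / (K * K)) \<le>
       cmod (\<Prod>j\<le>d. 1 - e j * (cnj u * r)) * cmod (\<Prod>j\<le>d. 1 - e j * (cnj u * cnj r))"
      using \<rho> by (intro mult_mono) auto
    also have "\<dots> = cmod (\<Prod>j\<le>d. 1 - 2 * complex_of_real (u \<bullet> e j) * r + r\<^sup>2)"
      unfolding factor prod.distrib norm_mult cnj_prod[symmetric] complex_mod_cnj ..
    finally show "1 / (K * K) * (1 / (K * K)) \<le> cmod (\<Prod>j\<le>d. 1 - 2 * complex_of_real (u \<bullet> e j) * r + r\<^sup>2)" .
  qed (use \<rho> in auto)
  also have "\<dots> = (2 ^ d * \<rho> ^ d) * K ^ 4 * (1 / \<rho> ^ k)"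
    using \<rho> by (simp add: field_simps power_mult_distrib power4_eq_xxxx)
  also have "\<dots> \<le> (2 ^ d * 1) * K ^ 4 * 3"
    using \<rho> power_ratio_le_3[of k]
    by (intro mult_mono mult_nonneg_nonneg) (auto simp: power_le_one \<rho>_def K_def)
  finally show ?thesis by (simp add: K_def algebra_simps)
qed

text \<open>For t = cos \<theta>, w = cis \<theta>, m = 2^n and \<gamma> = c (cnj u)^m one has (w^m
  - \<gamma>)(w^m - cnj \<gamma>) = 2 w^m (T_m(t) - Re \<gamma>). Division by (2 w)^m gives this
  monic polynomial, whose roots are the projections onto u of the block z^m = c.\<close>

definition block_poly :: "complex \<Rightarrow> nat \<times> complex \<Rightarrow> real poly" where
  "block_poly u = (\<lambda>(n, c). smult (2 / 2 ^ 2 ^ n) (chebT (2 ^ n) - [:Re (c * cnj u ^ 2 ^ n):]))"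

lemma cheb_bounded_block_polys:
  assumes "leja_blocks L" "cmod u = 1"
  shows "cheb_bounded (block_size L) (4 ^ length L / 2 ^ block_size L) (\<Prod>b\<leftarrow>L. block_poly u b)"
  using assms(1)
proof (induction L)
  case Nil
  show ?case using cheb_bounded_chebT[of 0 0 1 1] by (simp add: one_pCons)
next
  case (Cons b L)
  obtain n c where b: "b = (n, c)" by force
  define m where "m = (2::nat) ^ n"
  have "\<bar>Re (c * cnj u ^ m)\<bar> \<le> cmod (c * cnj u ^ m)" by (rule abs_Re_le_cmod)
  also have "\<dots> = 1" using Cons.prems b assms by (simp add: norm_mult norm_power)
  finally have "cheb_bounded m (1 + 1) (smult 1 (chebT m) + smult (- Re (c * cnj u ^ m)) (chebT 0))"
    by (intro cheb_bounded.intros) auto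
  moreover have eq: "smult 1 (chebT m) + smult (- Re (c * cnj u ^ m)) (chebT 0) = chebT m - [:Re (c * cnj u ^ m):]"
    by (rule poly_eqI_cos) simp
  ultimately have "cheb_bounded m (\<bar>2 / 2 ^ m\<bar> * (1 + 1)) (smult (2 / 2 ^ m) (chebT m - [:Re (c * cnj u ^ m):]))"
    by (metis cheb_bounded_smult)
  then
  have "cheb_bounded m (4 / 2 ^ m) (block_poly u b)"
    by (simp add: block_poly_def b m_def)
  from cheb_bounded_mult[OF this Cons.IH] show ?case
    using Cons.prems b by (simp add: m_def power_add)
qed

lemma cis_mult_self_plus_1: "cis x * cis x + 1 = 2 * cis x * of_real (cos x)"
  using sin_cos_squared_add[of x]
  by (auto simp: complex_eq_iff cis.code power2_eq_square algebra_simps)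

text \<open>For w = cis \<theta> and \<epsilon> = e_j cnj u, the identity 2 w (cos \<theta> - Re
  \<epsilon>) = (w - \<epsilon>)(w - cnj \<epsilon>) lifts the product over projections to two
  products over the points, at u w and u cnj w. There the block factorization applies, and the same
  identity for w^m brings each block back to the real line.\<close>

lemma newton_poly_eq_blocks:
  assumes L: "block_size L = d" "\<And>z. (\<Prod>j<d. z - e j) = block_prod L z" "leja_blocks L"
    and e: "\<And>j. j < d \<Longrightarrow> cmod (e j) = 1" and u: "cmod u = 1"
  shows "newton_poly (\<lambda>j. u \<bullet> e j) d = (\<Prod>b\<leftarrow>L. block_poly u b)"
proof (rule poly_eqI_cos)
  fix \<theta> :: real
  define w where "w = cis \<theta>"
  have ww: "w * cnj w = 1" by (simp add: w_def cis_cnj cis_mult)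
  have ww1: "w * w + 1 = 2 * w * cos \<theta>" unfolding w_def by (rule cis_mult_self_plus_1)
  have rot: "w - e j * cnj u = cnj u * (u * w - e j)" for w j
    using unit_mult_cnj[OF u] by (simp add: algebra_simps)
  have rotb: "cnj u ^ m * ((u * w) ^ m - c) = w ^ m - c * cnj u ^ m" for w c m
  proof -
    have "cnj u ^ m * (u * w) ^ m = (cnj u * u * w) ^ m" by (simp add: mult.assoc flip: power_mult_distrib)
    then have "cnj u ^ m * (u * w) ^ m = w ^ m" using unit_mult_cnj[OF u] by simp
    then show ?thesis by (simp add: right_diff_distrib mult.commute)
  qed
  have "of_real (poly (newton_poly (\<lambda>j. u \<bullet> e j) d) (cos \<theta>)) * (2 * w) ^ d
      = (\<Prod>j<d. (2 * w) * (complex_of_real (cos \<theta>) - of_real (u \<bullet> e j)))"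
    by (simp add: poly_newton_poly prod.distrib mult.commute)
  also have "\<dots> = (\<Prod>j<d. (w - e j * cnj u) * cnj (cnj w - e j * cnj u))"
  proof (intro prod.cong refl)
    fix j assume "j \<in> {..<d}"
    then have "cmod (e j * cnj u) = 1" using e u by (simp add: norm_mult)
    then have *: "e j * cnj u * cnj (e j * cnj u) = 1" by (rule unit_mult_cnj)
    have "(w - e j * cnj u) * cnj (cnj w - e j * cnj u)
        = w * w - w * (e j * cnj u + cnj (e j * cnj u)) + e j * cnj u * cnj (e j * cnj u)"
      by (simp add: algebra_simps)
    also have "\<dots> = (w * w + 1) - w * (2 * of_real (u \<bullet> e j))"
      unfolding * complex_add_cnj inner_eq_Re_cnj_mult by (simp add: mult.commute)
    finally show "(2 * w) * (complex_of_real (cos \<theta>) - of_real (u \<bullet> e j))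
        = (w - e j * cnj u) * cnj (cnj w - e j * cnj u)"
      unfolding ww1 by (simp add: algebra_simps)
  qed
  also have "\<dots> = (cnj u ^ d * block_prod L (u * w)) * cnj (cnj u ^ d * block_prod L (u * cnj w))"
    unfolding rot prod.distrib cnj_prod[symmetric] L(2) by simp
  also have "\<dots> = (cnj u ^ block_size L * block_prod L (u * w)) * cnj (cnj u ^ block_size L * block_prod L (u * cnj w))"
    by (simp add: L)
  also have "\<dots> = (2 * w) ^ block_size L * of_real (poly (\<Prod>b\<leftarrow>L. block_poly u b) (cos \<theta>))"
    using L(3)
  proof (induction L)
    case (Cons b L)
    obtain n c where b: "b = (n, c)" by force
    define m where "m = (2::nat) ^ n"
    define \<gamma> where "\<gamma> = c * cnj u ^ m"
    have "cmod \<gamma> = 1" using Cons.prems b u by (simp add: \<gamma>_def norm_mult norm_power)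
    have wm: "w ^ m * w ^ m + 1 = 2 * w ^ m * cos (real m * \<theta>)"
    proof -
      have "w ^ m = cis (real m * \<theta>)" by (simp add: w_def Complex.DeMoivre)
      then show ?thesis by (simp only: cis_mult_self_plus_1)
    qed
    have "(cnj u ^ m * ((u * w) ^ m - c)) * cnj (cnj u ^ m * ((u * cnj w) ^ m - c)) = (w ^ m - \<gamma>) * cnj (cnj w ^ m - \<gamma>)"
      unfolding rotb \<gamma>_def ..
    also have "\<dots> = w ^ m * w ^ m - w ^ m * (\<gamma> + cnj \<gamma>) + \<gamma> * cnj \<gamma>"
      by (simp add: algebra_simps)
    also have "\<dots> = (w ^ m * w ^ m + 1) - w ^ m * (2 * of_real (Re \<gamma>))"
      unfolding unit_mult_cnj[OF \<open>cmod \<gamma> = 1\<close>] complex_add_cnj by simp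
    also have "\<dots> = (2 * w) ^ m * of_real (poly (block_poly u b) (cos \<theta>))"
      unfolding wm by (simp add: block_poly_def b poly_chebT_cos \<gamma>_def m_def power_mult_distrib field_simps)
    finally have *: "(cnj u ^ m * ((u * w) ^ m - c)) * cnj (cnj u ^ m * ((u * cnj w) ^ m - c))
        = (2 * w) ^ m * of_real (poly (block_poly u b) (cos \<theta>))" .
    have "(cnj u ^ block_size (b # L) * block_prod (b # L) (u * w)) *
        cnj (cnj u ^ block_size (b # L) * block_prod (b # L) (u * cnj w))
       = (cnj u ^ m * ((u * w) ^ m - c)) * cnj (cnj u ^ m * ((u * cnj w) ^ m - c)) *
         ((cnj u ^ block_size L * block_prod L (u * w)) * cnj (cnj u ^ block_size L * block_prod L (u * cnj w)))"
      unfolding b block_simps power_add m_def complex_cnj_mult by (simp only: ac_simps)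
    also have "\<dots> = (2 * w) ^ block_size (b # L) * of_real (poly (\<Prod>b\<leftarrow>b # L. block_poly u b) (cos \<theta>))"
      unfolding * using Cons b by (simp add: power_add m_def)
    finally show ?case .
  qed simp
  finally have "of_real (poly (newton_poly (\<lambda>j. u \<bullet> e j) d) (cos \<theta>)) * (2 * w) ^ d
      = complex_of_real (poly (\<Prod>b\<leftarrow>L. block_poly u b) (cos \<theta>)) * (2 * w) ^ d"
    by (simp add: L mult.commute)
  moreover have "(2 * w) ^ d \<noteq> 0" by (simp add: w_def)
  ultimately show "poly (newton_poly (\<lambda>j. u \<bullet> e j) d) (cos \<theta>) = poly (\<Prod>b\<leftarrow>L. block_poly u b) (cos \<theta>)"
    by (metis mult_right_cancel of_real_eq_iff)
qed

text \<open>A block of size m contributes 2 / 2^m times a polynomial of coefficient sum at most 2.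
  The total is 4^length / 2^d, and 2^length \<le> d + 1.\<close>

lemma cheb_bounded_leja_newton:
  assumes e: "Leja_sequence e" "e 0 = 1" and u: "cmod u = 1"
  shows "cheb_bounded d ((real d + 1)\<^sup>2 / 2 ^ d) (newton_poly (\<lambda>j. u \<bullet> e j) d)"
proof -
  obtain L where L: "leja_blocks L" "block_size L = d" "\<And>z. (\<Prod>j<d. z - e j) = block_prod L z"
    using leja_sequence_blocks(1)[OF e, of d] by blast
  have "newton_poly (\<lambda>j. u \<bullet> e j) d = (\<Prod>b\<leftarrow>L. block_poly u b)"
    using L u leja_sequence_blocks(2)[OF e] by (intro newton_poly_eq_blocks)
  moreover have "cheb_bounded d (4 ^ length L / 2 ^ d) (\<Prod>b\<leftarrow>L. block_poly u b)"
    using cheb_bounded_block_polys[OF L(1) u] L(2) by simp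
  moreover have "real (2 ^ length L) \<le> real (block_size L + 1)"
    using two_power_length_le[OF L(1)] by (simp only: of_nat_le_iff)
  then have "real (2 ^ length L) ^ 2 \<le> (real d + 1) ^ 2" using L(2) by (intro power_mono) auto
  then have "(4::real) ^ length L / 2 ^ d \<le> (real d + 1)\<^sup>2 / 2 ^ d"
    by (intro divide_right_mono) (simp_all add: power2_eq_square flip: power_mult_distrib)
  ultimately show ?thesis by (auto intro: cheb_bounded_mono)
qed

section \<open>The Hermite-Genocchi formula\<close>

lemma newton_coeff_cong: "(\<And>j. j \<le> d \<Longrightarrow> a j = b j) \<Longrightarrow> newton_coeff a k d = newton_coeff b k d"
proof (induction a k d rule: newton_coeff.induct)
  case (3 a k d)
  then show ?case by (cases d) auto
qed auto

text \<open>The second tuple lists the nodes as a_{d+1}, a_1, ..., a_d. For d > 0, replacing the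
  node at index 0 keeps the last node, which the recursion in k reads; it is also the form that
  integration over the simplex produces.\<close>

lemma newton_coeff_divided_difference:
  "(a (Suc d) - a 0) * newton_coeff a k (Suc d) = newton_coeff (a(0 := a (Suc d))) k d - newton_coeff a k d"
proof (induction k arbitrary: a d rule: induct_nat_012)
  case 0
  then show ?case by simp
next
  case 1
  then show ?case by (cases d) (simp_all add: algebra_simps)
next
  case (ge2 k)
  define b where "b = a(0 := a (Suc d))"
  have b: "b 0 = a (Suc d)" "\<And>j. j \<noteq> 0 \<Longrightarrow> b j = a j" by (auto simp: b_def)
  note IH = ge2[of a d, folded b_def]
  have *: "(a (Suc d) - a 0) * newton_coeff a (Suc (Suc k)) (Suc d)
      = 2 * a (Suc d) * (newton_coeff b (Suc k) d - newton_coeff a (Suc k) d)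
        + 2 * (a (Suc d) - a 0) * newton_coeff a (Suc k) d - (newton_coeff b k d - newton_coeff a k d)"
    unfolding IH[symmetric] by (simp add: algebra_simps)
  also have "\<dots> = newton_coeff b (Suc (Suc k)) d - newton_coeff a (Suc (Suc k)) d"
  proof (cases d)
    case 0
    then show ?thesis by (simp add: b algebra_simps)
  next
    case (Suc d')
    \<comment> \<open>Up to index d', both modified sequences carry a_d at index 0 and agree
      elsewhere; this common term is eliminated between 1 and 2.\<close>
    have cong: "newton_coeff (b(0 := b (Suc d'))) (Suc k) d' = newton_coeff (a(0 := a (Suc d'))) (Suc k) d'"
      by (rule newton_coeff_cong) (auto simp: b)
    have 1: "(a (Suc d') - a (Suc d)) * newton_coeff b (Suc k) d
        = newton_coeff (a(0 := a (Suc d'))) (Suc k) d' - newton_coeff b (Suc k) d'"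
      using ge2(2)[of b d'] unfolding cong by (simp add: Suc b)
    have 2: "(a (Suc d') - a 0) * newton_coeff a (Suc k) d
        = newton_coeff (a(0 := a (Suc d'))) (Suc k) d' - newton_coeff a (Suc k) d'"
      using ge2(2)[of a d'] unfolding Suc .
    show ?thesis using 1 2 by (simp add: Suc b algebra_simps)
  qed
  finally show ?case unfolding b_def .
qed

lemma tendsto_newton_coeff:
  assumes "\<And>j. j \<le> d \<Longrightarrow> (\<lambda>n. a n j) \<longlonglongrightarrow> b j"
  shows "(\<lambda>n. newton_coeff (a n) k d) \<longlonglongrightarrow> newton_coeff b k d"
  using assms
proof (induction k arbitrary: d rule: induct_nat_012)
  case 1
  then show ?case by (auto intro!: tendsto_intros)
next
  case (ge2 k)
  then show ?case by (cases d) (auto intro!: tendsto_intros)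
qed simp

section \<open>Integration over the standard simplex\<close>

abbreviation box_measure :: "nat \<Rightarrow> (nat \<Rightarrow> real) measure" where
  "box_measure d \<equiv> Pi\<^sub>M {1..d} (\<lambda>_. lborel)"

interpretation lborel_product: product_sigma_finite "\<lambda>_::nat. lborel :: real measure"
  by standard

lemma sets_std_simplex [measurable]: "std_simplex d \<in> sets (box_measure d)"
proof -
  have "std_simplex d = {t \<in> space (box_measure d). (\<forall>j\<in>{1..d}. t j \<in> {0..1}) \<and> (\<Sum>j=1..d. t j) \<le> 1}"
    by (auto simp: std_simplex_def space_PiM PiE_iff)
  also have "\<dots> \<in> sets (box_measure d)" by measurable
  finally show ?thesis .
qed

lemma emeasure_std_simplex: "emeasure (box_measure d) (std_simplex d) \<le> 1"
proof -
  have "emeasure (box_measure d) (std_simplex d) \<le> emeasure (box_measure d) (Pi\<^sub>E {1..d} (\<lambda>_. {0..1}))"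
    by (intro emeasure_mono sets_PiM_I_finite) (auto simp: std_simplex_def)
  also have "\<dots> = 1" by (subst lborel_product.emeasure_PiM) auto
  finally show ?thesis .
qed

lemma std_simplex_nonneg: "t \<in> std_simplex d \<Longrightarrow> j \<in> {1..d} \<Longrightarrow> 0 \<le> t j"
  and std_simplex_sum: "t \<in> std_simplex d \<Longrightarrow> (\<Sum>j=1..d. t j) \<le> 1"
  by (auto simp: std_simplex_def PiE_iff)

lemma set_integrable_std_simplex:
  fixes h :: "(nat \<Rightarrow> real) \<Rightarrow> real"
  assumes "h \<in> borel_measurable (box_measure d)" "\<And>t. t \<in> std_simplex d \<Longrightarrow> \<bar>h t\<bar> \<le> C"
  shows "set_integrable (box_measure d) (std_simplex d) h"
  unfolding set_integrable_def using assms emeasure_std_simplex[of d] sets_std_simplex[of d]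
  by (intro integrableI_bounded_set_indicator[where B = C])
     (auto intro: le_less_trans[of _ "1::ennreal"])

lemma simplex_integral_tendsto:
  fixes h :: "nat \<Rightarrow> (nat \<Rightarrow> real) \<Rightarrow> real"
  assumes h: "\<And>n. h n \<in> borel_measurable (box_measure d)"
    and C: "\<And>n t. t \<in> std_simplex d \<Longrightarrow> \<bar>h n t\<bar> \<le> C"
    and lim: "\<And>t. t \<in> std_simplex d \<Longrightarrow> (\<lambda>n. h n t) \<longlonglongrightarrow> l t"
  shows "(\<lambda>n. LINT t:std_simplex d|box_measure d. h n t) \<longlonglongrightarrow> (LINT t:std_simplex d|box_measure d. l t)"
  unfolding set_lebesgue_integral_def
proof (rule integral_dominated_convergence)
  have lim': "(\<lambda>n. indicator (std_simplex d) t *\<^sub>R h n t) \<longlonglongrightarrow> indicator (std_simplex d) t *\<^sub>R l t" for t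
    using lim by (auto split: split_indicator)
  show meas: "(\<lambda>t. indicator (std_simplex d) t *\<^sub>R h n t) \<in> borel_measurable (box_measure d)" for n
    using h by measurable
  show "(\<lambda>t. indicator (std_simplex d) t *\<^sub>R l t) \<in> borel_measurable (box_measure d)"
    by (rule borel_measurable_LIMSEQ_real[OF lim' meas])
  show "integrable (box_measure d) (\<lambda>t. indicator (std_simplex d) t *\<^sub>R C)"
    using set_integrable_std_simplex[of "\<lambda>_. C" d "\<bar>C\<bar>"] by (simp add: set_integrable_def)
qed (use assms in \<open>auto split: split_indicator\<close>)

text \<open>One-dimensional counterpart of \<open>simplex_functional\<close>. The convention for d =
  0 comes out of the integral itself, the empty product measure being a point mass.\<close>

definition simplex_int :: "(nat \<Rightarrow> real) \<Rightarrow> nat \<Rightarrow> (real \<Rightarrow> real) \<Rightarrow> real" where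
  "simplex_int a d g = (LINT t:std_simplex d|box_measure d. g (a 0 + (\<Sum>j=1..d. t j * (a j - a 0))))"

lemma simplex_int_0: "simplex_int a 0 g = g (a 0)"
proof -
  have "std_simplex 0 = {\<lambda>_. undefined}" by (auto simp: std_simplex_def)
  then show ?thesis
    by (simp add: simplex_int_def set_lebesgue_integral_def PiM_empty lebesgue_integral_count_space_finite)
qed

lemma simplex_point_bound:
  assumes t: "t \<in> std_simplex d" and a: "\<And>j. j \<le> d \<Longrightarrow> \<bar>a j\<bar> \<le> R"
  shows "\<bar>a 0 + (\<Sum>j=1..d. t j * (a j - a 0))\<bar> \<le> R"
proof -
  have "a 0 + (\<Sum>j=1..d. t j * (a j - a 0)) = (1 - (\<Sum>j=1..d. t j)) * a 0 + (\<Sum>j=1..d. t j * a j)"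
    by (simp add: algebra_simps sum_subtractf sum_distrib_left)
  also have "\<bar>\<dots>\<bar> \<le> (1 - (\<Sum>j=1..d. t j)) * \<bar>a 0\<bar> + (\<Sum>j=1..d. t j * \<bar>a j\<bar>)"
    using std_simplex_nonneg[OF t] std_simplex_sum[OF t]
    by (intro order_trans[OF abs_triangle_ineq] add_mono order_trans[OF sum_abs] sum_mono) (auto simp: abs_mult)
  also have "\<dots> \<le> (1 - (\<Sum>j=1..d. t j)) * R + (\<Sum>j=1..d. t j * R)"
    using std_simplex_nonneg[OF t] std_simplex_sum[OF t] a
    by (intro add_mono mult_left_mono sum_mono) auto
  also have "\<dots> = R" by (simp add: algebra_simps flip: sum_distrib_left)
  finally show ?thesis .
qed

lemma continuous_bounded_on_interval:
  fixes g :: "real \<Rightarrow> real"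
  assumes "continuous_on UNIV g"
  obtains C where "\<And>x. \<bar>x\<bar> \<le> R \<Longrightarrow> \<bar>g x\<bar> \<le> C"
proof -
  have "compact (g ` {-R..R})"
    by (intro compact_continuous_image continuous_on_subset[OF assms]) auto
  then have "bounded (g ` {-R..R})" by (rule compact_imp_bounded)
  then obtain C where "\<forall>x\<in>g ` {-R..R}. norm x \<le> C" unfolding bounded_iff by blast
  then show ?thesis by (intro that[of C]) (auto simp: abs_le_iff)
qed

lemma measurable_simplex_point [measurable]:
  fixes g :: "real \<Rightarrow> real"
  assumes "continuous_on UNIV g"
  shows "(\<lambda>t. g (a 0 + (\<Sum>j=1..d. t j * (a j - a 0)))) \<in> borel_measurable (box_measure d)"
proof -
  have [measurable]: "g \<in> borel_measurable borel" by (rule borel_measurable_continuous_onI[OF assms])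
  show ?thesis by measurable
qed

lemma simplex_int_integrable:
  fixes g :: "real \<Rightarrow> real"
  assumes "continuous_on UNIV g"
  shows "set_integrable (box_measure d) (std_simplex d) (\<lambda>t. g (a 0 + (\<Sum>j=1..d. t j * (a j - a 0))))"
proof -
  define R where "R = (\<Sum>j\<le>d. \<bar>a j\<bar>)"
  have R: "\<bar>a j\<bar> \<le> R" if "j \<le> d" for j
    unfolding R_def using that by (intro member_le_sum) auto
  obtain C where C: "\<And>x. \<bar>x\<bar> \<le> R \<Longrightarrow> \<bar>g x\<bar> \<le> C" using continuous_bounded_on_interval[OF assms] by blast
  show ?thesis
    using assms simplex_point_bound[OF _ R]
    by (intro set_integrable_std_simplex[where C = C] C measurable_simplex_point) auto
qed

text \<open>Fubini: for fixed t_1, ..., t_d with sum s the last variable runs over [0, 1 - s]. The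
  end 0 gives the point with the old nodes; the end 1 - s moves the weight of a_0 to a_{d+1}, the
  replacement of \<open>newton_coeff_divided_difference\<close>.\<close>

lemma simplex_int_recursion:
  fixes g G :: "real \<Rightarrow> real"
  assumes g: "continuous_on UNIV g" and G: "\<And>x. (G has_field_derivative g x) (at x)"
  shows "(a (Suc d) - a 0) * simplex_int a (Suc d) g = simplex_int (a(0 := a (Suc d))) d G - simplex_int a d G"
proof -
  let ?b = "a(0 := a (Suc d))"
  define \<delta> where "\<delta> = a (Suc d) - a 0"
  define f where "f = (\<lambda>t. indicator (std_simplex (Suc d)) t *\<^sub>R g (a 0 + (\<Sum>j=1..Suc d. t j * (a j - a 0))))"
  define pt where "pt = (\<lambda>t. a 0 + (\<Sum>j=1..d. t j * (a j - a 0)))"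
  have G': "continuous_on UNIV G" using G by (meson DERIV_isCont continuous_at_imp_continuous_on)
  have ins: "{1..Suc d} = insert (Suc d) {1..d}" by auto
  have "integrable (box_measure (Suc d)) f"
    using simplex_int_integrable[OF g, of "Suc d" a] by (simp only: set_integrable_def f_def)
  moreover have "simplex_int a (Suc d) g = integral\<^sup>L (box_measure (Suc d)) f"
    by (simp only: simplex_int_def set_lebesgue_integral_def f_def)
  ultimately have "simplex_int a (Suc d) g = (\<integral>x. (\<integral>y. f (x(Suc d := y)) \<partial>lborel) \<partial>box_measure d)"
    unfolding ins by (simp add: lborel_product.product_integral_insert)
  moreover have "\<delta> * (\<integral>y. f (x(Suc d := y)) \<partial>lborel) =
      indicator (std_simplex d) x *\<^sub>R (G (?b 0 + (\<Sum>j=1..d. x j * (?b j - ?b 0))) - G (pt x))"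
    if x: "x \<in> space (box_measure d)" for x
  proof -
    define s where "s = (\<Sum>j=1..d. x j)"
    have ext: "x \<in> extensional {1..d}" using x by (simp add: space_PiM PiE_def)
    have upd: "x(Suc d := y) \<in> std_simplex (Suc d) \<longleftrightarrow> x \<in> std_simplex d \<and> y \<in> {0..1 - s}" for y
    proof -
      have "(\<Sum>j=1..d. (x(Suc d := y)) j) = s" unfolding s_def by (intro sum.cong) auto
      then have "x(Suc d := y) \<in> std_simplex (Suc d) \<longleftrightarrow>
          (\<forall>j\<in>{1..d}. x j \<in> {0..1}) \<and> y \<in> {0..1} \<and> s + y \<le> 1"
        using ext by (auto simp: std_simplex_def PiE_iff extensional_def)
      moreover have "x \<in> std_simplex d \<longleftrightarrow> (\<forall>j\<in>{1..d}. x j \<in> {0..1}) \<and> s \<le> 1"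
        using ext by (auto simp: std_simplex_def PiE_iff s_def)
      moreover have "0 \<le> s" if "\<forall>j\<in>{1..d}. x j \<in> {0..1}"
        unfolding s_def using that by (intro sum_nonneg) auto
      ultimately show ?thesis by auto
    qed
    have val: "a 0 + (\<Sum>j=1..Suc d. (x(Suc d := y)) j * (a j - a 0)) = pt x + y * \<delta>" for y
    proof -
      have "(\<Sum>j=1..d. (x(Suc d := y)) j * (a j - a 0)) = (\<Sum>j=1..d. x j * (a j - a 0))"
        by (intro sum.cong) auto
      then show ?thesis by (simp add: pt_def \<delta>_def)
    qed
    have f: "f (x(Suc d := y)) = indicator (std_simplex d) x * (indicator {0..1 - s} y * g (pt x + y * \<delta>))" for y
      unfolding f_def val by (auto simp: upd split: split_indicator)
    show ?thesis
    proof (cases "x \<in> std_simplex d")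
      case True
      then have s: "0 \<le> 1 - s" using std_simplex_sum by (simp add: s_def)
      have "\<delta> * (\<integral>y. f (x(Suc d := y)) \<partial>lborel) = (\<integral>y. \<delta> * f (x(Suc d := y)) \<partial>lborel)"
        by simp
      also have "\<dots> = (\<integral>y. indicator {0..1 - s} y *\<^sub>R (g (pt x + y * \<delta>) * \<delta>) \<partial>lborel)"
        using True unfolding f by (intro Bochner_Integration.integral_cong) auto
      also have "\<dots> = G (pt x + (1 - s) * \<delta>) - G (pt x + 0 * \<delta>)"
      proof (rule integral_FTC_Icc[OF s])
        fix y
        have "((\<lambda>y. G (pt x + y * \<delta>)) has_field_derivative g (pt x + y * \<delta>) * \<delta>) (at y)"
          by (rule DERIV_chain2[OF G]) (auto intro!: derivative_eq_intros)
        then show "((\<lambda>y. G (pt x + y * \<delta>)) has_vector_derivative g (pt x + y * \<delta>) * \<delta>) (at y within {0..1 - s})"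
          unfolding has_real_derivative_iff_has_vector_derivative[symmetric] by (rule DERIV_subset) simp
      next
        show "continuous_on {0..1 - s} (\<lambda>y. g (pt x + y * \<delta>) * \<delta>)"
          by (intro continuous_intros continuous_on_compose2[OF g]) auto
      qed
      also have "pt x + (1 - s) * \<delta> = ?b 0 + (\<Sum>j=1..d. x j * (?b j - ?b 0))"
      proof -
        have "(\<Sum>j=1..d. x j * (?b j - ?b 0)) = (\<Sum>j=1..d. x j * (a j - a 0) - x j * \<delta>)"
          by (intro sum.cong) (auto simp: \<delta>_def algebra_simps)
        then show ?thesis
          by (simp add: pt_def s_def sum_subtractf sum_distrib_right[symmetric] \<delta>_def algebra_simps)
      qed
      also have "G (?b 0 + (\<Sum>j=1..d. x j * (?b j - ?b 0))) - G (pt x + 0 * \<delta>)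
          = indicator (std_simplex d) x *\<^sub>R (G (?b 0 + (\<Sum>j=1..d. x j * (?b j - ?b 0))) - G (pt x))"
        using True by simp
      finally show ?thesis .
    qed (simp add: f)
  qed
  ultimately have "\<delta> * simplex_int a (Suc d) g = (\<integral>x. indicator (std_simplex d) x *\<^sub>R
      (G (?b 0 + (\<Sum>j=1..d. x j * (?b j - ?b 0))) - G (pt x)) \<partial>box_measure d)"
    by (simp only: integral_mult_right_zero[symmetric] cong: Bochner_Integration.integral_cong)
  also have "\<dots> = simplex_int ?b d G - simplex_int a d G"
    using set_integral_diff(2)[OF simplex_int_integrable[OF G', of d ?b] simplex_int_integrable[OF G', of d a]]
    unfolding simplex_int_def set_lebesgue_integral_def pt_def by simp
  finally show ?thesis by (simp add: \<delta>_def)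
qed

text \<open>Both sides satisfy the same recursion in d; distinct nodes allow the division by a_{d+1}
  - a_0.\<close>

lemma simplex_int_chebU_distinct:
  assumes "inj_on a {..d}"
  shows "simplex_int a d (poly ((pderiv ^^ d) (chebU k))) = newton_coeff a k d"
  using assms
proof (induction d arbitrary: a)
  case 0
  have "poly (chebU k) (a 0) = newton_coeff a k 0"
  proof -
    have "poly (chebU k) (a 0) = (\<Sum>d\<le>k. newton_coeff a k d * (\<Prod>j<d. a 0 - a j))"
      by (subst chebU_eq_newton[of k a]) (simp add: poly_sum poly_newton_poly)
    also have "\<dots> = (\<Sum>d\<le>k. if d = 0 then newton_coeff a k 0 else 0)"
      by (intro sum.cong) auto
    finally show ?thesis by simp
  qed
  then show ?case by (simp add: simplex_int_0)
next
  case (Suc d)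
  let ?b = "a(0 := a (Suc d))"
  have ne: "a (Suc d) - a 0 \<noteq> 0" using Suc.prems by (auto dest: inj_onD)
  have inj: "inj_on a {..d}" using Suc.prems by (rule inj_on_subset) auto
  have inj': "inj_on ?b {..d}"
  proof -
    have "?b = a \<circ> (\<lambda>j. if j = 0 then Suc d else j)" by (auto simp: fun_eq_iff)
    moreover have "inj_on (\<lambda>j. if j = 0 then Suc d else j) {..d}" by (auto simp: inj_on_def)
    ultimately show ?thesis using Suc.prems by (auto intro!: comp_inj_on elim!: inj_on_subset)
  qed
  have "(a (Suc d) - a 0) * simplex_int a (Suc d) (poly ((pderiv ^^ Suc d) (chebU k)))
      = simplex_int ?b d (poly ((pderiv ^^ d) (chebU k))) - simplex_int a d (poly ((pderiv ^^ d) (chebU k)))"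
    by (rule simplex_int_recursion) (auto intro!: continuous_intros poly_DERIV)
  also have "\<dots> = (a (Suc d) - a 0) * newton_coeff a k (Suc d)"
    unfolding Suc.IH[OF inj] Suc.IH[OF inj'] newton_coeff_divided_difference ..
  finally show ?case using ne by simp
qed

text \<open>Projected points may coincide; they are separated by the perturbation \<open>a\<^sub>j + \<epsilon> j\<close>.\<close>

lemma simplex_int_chebU: "simplex_int a d (poly ((pderiv ^^ d) (chebU k))) = newton_coeff a k d"
proof -
  let ?g = "poly ((pderiv ^^ d) (chebU k))"
  have cont: "continuous_on UNIV ?g" by (intro continuous_intros)
  define \<epsilon> where "\<epsilon> = (\<lambda>n. inverse (real (Suc n)))"
  define b where "b = (\<lambda>n j. a j + \<epsilon> n * real j)"
  have \<epsilon>: "\<epsilon> \<longlonglongrightarrow> 0" "\<And>n. 0 < \<epsilon> n" "\<And>n. \<epsilon> n \<le> 1"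
    using LIMSEQ_inverse_real_of_nat by (auto simp: \<epsilon>_def inverse_le_1_iff)
  have b: "(\<lambda>n. b n j) \<longlonglongrightarrow> a j" for j
    unfolding b_def using \<epsilon>(1) by (auto intro!: tendsto_eq_intros)
  define R where "R = (\<Sum>j\<le>d. \<bar>a j\<bar> + real j)"
  have R: "\<bar>b n j\<bar> \<le> R" if "j \<le> d" for n j
  proof -
    have "\<epsilon> n * real j \<le> 1 * real j" using \<epsilon>(3) by (intro mult_right_mono) auto
    then have "\<bar>b n j\<bar> \<le> \<bar>a j\<bar> + real j"
      using \<epsilon>(2)[of n] by (auto simp: b_def abs_mult intro!: order_trans[OF abs_triangle_ineq])
    also have "\<dots> \<le> R" unfolding R_def using that by (intro member_le_sum) auto
    finally show ?thesis .
  qed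
  obtain C where C: "\<And>x. \<bar>x\<bar> \<le> R \<Longrightarrow> \<bar>?g x\<bar> \<le> C"
    using continuous_bounded_on_interval[OF cont] by blast
  have "(\<lambda>n. simplex_int (b n) d ?g) \<longlonglongrightarrow> simplex_int a d ?g"
    unfolding simplex_int_def
  proof (rule simplex_integral_tendsto)
    fix t assume t: "t \<in> std_simplex d"
    show "\<bar>?g (b n 0 + (\<Sum>j=1..d. t j * (b n j - b n 0)))\<bar> \<le> C" for n
      by (rule C[OF simplex_point_bound[OF t R]])
    show "(\<lambda>n. ?g (b n 0 + (\<Sum>j=1..d. t j * (b n j - b n 0)))) \<longlonglongrightarrow> ?g (a 0 + (\<Sum>j=1..d. t j * (a j - a 0)))"
      by (intro tendsto_intros b)
  qed (rule measurable_simplex_point[OF cont])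
  moreover have "\<forall>\<^sub>F n in sequentially. inj_on (b n) {..d}"
  proof -
    have "\<forall>\<^sub>F n in sequentially. \<forall>(i, j) \<in> {(i, j). i < j \<and> j \<le> d}. b n i \<noteq> b n j"
    proof (rule eventually_ball_finite)
      show "finite {(i, j). i < j \<and> j \<le> d}"
        by (rule finite_subset[of _ "{..d} \<times> {..d}"]) auto
      have "\<forall>\<^sub>F n in sequentially. b n i \<noteq> b n j" if "i < j" for i j
      proof (cases "a i = a j")
        case True
        then show ?thesis using that mult_strict_left_mono[OF _ \<epsilon>(2), of "real i" "real j"]
          by (intro always_eventually allI less_imp_neq) (simp add: b_def)
      next
        case False
        have "(\<lambda>n. b n i - b n j) \<longlonglongrightarrow> a i - a j" by (intro tendsto_intros b)
        then have "\<forall>\<^sub>F n in sequentially. b n i - b n j \<noteq> 0"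
          using False by (intro tendsto_imp_eventually_ne) auto
        then show ?thesis by eventually_elim auto
      qed
      then show "\<forall>p \<in> {(i, j). i < j \<and> j \<le> d}. \<forall>\<^sub>F n in sequentially. case p of (i, j) \<Rightarrow> b n i \<noteq> b n j"
        by auto
    qed
    then show ?thesis
    proof eventually_elim
      case (elim n)
      then show ?case by (intro linorder_inj_onI) (auto simp: eq_commute)
    qed
  qed
  then have "\<forall>\<^sub>F n in sequentially. simplex_int (b n) d ?g = newton_coeff (b n) k d"
    by eventually_elim (rule simplex_int_chebU_distinct)
  ultimately have "(\<lambda>n. newton_coeff (b n) k d) \<longlonglongrightarrow> simplex_int a d ?g"
    by (simp cong: filterlim_cong)
  moreover have "(\<lambda>n. newton_coeff (b n) k d) \<longlonglongrightarrow> newton_coeff a k d"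
    by (intro tendsto_newton_coeff b)
  ultimately show ?thesis by (rule LIMSEQ_unique)
qed

lemma simplex_point_in_disk:
  assumes t: "t \<in> std_simplex d" and e: "\<And>j. e j \<in> unit_disk"
  shows "e 0 + (\<Sum>j=1..d. t j *\<^sub>R (e j - e 0)) \<in> unit_disk"
proof -
  have "e 0 + (\<Sum>j=1..d. t j *\<^sub>R (e j - e 0)) = (1 - (\<Sum>j=1..d. t j)) *\<^sub>R e 0 + (\<Sum>j=1..d. t j *\<^sub>R e j)"
    by (simp add: algebra_simps sum_subtractf scaleR_sum_left)
  also have "norm \<dots> \<le> (1 - (\<Sum>j=1..d. t j)) * norm (e 0) + (\<Sum>j=1..d. t j * norm (e j))"
    using std_simplex_nonneg[OF t] std_simplex_sum[OF t]
    by (intro order_trans[OF norm_triangle_ineq] add_mono order_trans[OF norm_sum] sum_mono) auto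
  also have "\<dots> \<le> (1 - (\<Sum>j=1..d. t j)) * 1 + (\<Sum>j=1..d. t j * 1)"
    using std_simplex_nonneg[OF t] std_simplex_sum[OF t] e
    by (intro add_mono mult_left_mono sum_mono) auto
  finally show ?thesis by simp
qed

lemma simplex_functional_sums:
  assumes e: "\<And>j. e j \<in> unit_disk"
    and h: "\<And>k. continuous_on UNIV (h k)" and M: "\<And>k y. y \<in> unit_disk \<Longrightarrow> \<bar>h k y\<bar> \<le> M k" "summable M"
    and H: "\<And>y. y \<in> unit_disk \<Longrightarrow> (\<lambda>k. h k y) sums H y"
  shows "(\<lambda>k. simplex_functional e d (h k)) sums simplex_functional e d H"
proof (cases "d = 0")
  case True
  then show ?thesis using H e by (simp add: simplex_functional_def)
next
  case False
  let ?pt = "\<lambda>t. e 0 + (\<Sum>j=1..d. t j *\<^sub>R (e j - e 0))"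
  have meas: "(\<lambda>t. h k (?pt t)) \<in> borel_measurable (box_measure d)" for k
  proof -
    have [measurable]: "h k \<in> borel_measurable borel" by (rule borel_measurable_continuous_onI[OF h])
    show ?thesis by measurable
  qed
  have M0: "0 \<le> M k" for k using M(1)[of 0 k] by force
  have "(\<lambda>n. LINT t:std_simplex d|box_measure d. (\<Sum>k<n. h k (?pt t))) \<longlonglongrightarrow> (LINT t:std_simplex d|box_measure d. H (?pt t))"
  proof (rule simplex_integral_tendsto)
    fix t assume t: "t \<in> std_simplex d"
    then have pt: "?pt t \<in> unit_disk" by (rule simplex_point_in_disk[OF _ e])
    show "(\<lambda>n. \<Sum>k<n. h k (?pt t)) \<longlonglongrightarrow> H (?pt t)" using H[OF pt] by (simp add: sums_def)
    fix n
    have "\<bar>\<Sum>k<n. h k (?pt t)\<bar> \<le> (\<Sum>k<n. M k)"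
      using M(1) pt by (intro order_trans[OF sum_abs] sum_mono) auto
    also have "\<dots> \<le> suminf M" using M0 M(2) by (intro sum_le_suminf) auto
    finally show "\<bar>\<Sum>k<n. h k (?pt t)\<bar> \<le> suminf M" .
  qed (use meas in measurable)
  moreover have "(LINT t:std_simplex d|box_measure d. (\<Sum>k<n. h k (?pt t))) = (\<Sum>k<n. LINT t:std_simplex d|box_measure d. h k (?pt t))" for n
  proof -
    have "set_integrable (box_measure d) (std_simplex d) (\<lambda>t. h k (?pt t))" for k
      by (intro set_integrable_std_simplex[OF meas, where C = "M k"] M(1) simplex_point_in_disk e)
    then show ?thesis
      unfolding set_lebesgue_integral_def set_integrable_def scaleR_sum_right
      by (intro Bochner_Integration.integral_sum)
  qed
  ultimately show ?thesis using False by (simp add: simplex_functional_def sums_def)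
qed

lemma simplex_functional_ridge:
  "simplex_functional e d (\<lambda>y. g (u \<bullet> y)) = simplex_int (\<lambda>j. u \<bullet> e j) d g"
  by (cases "d = 0") (auto simp: simplex_functional_def simplex_int_0,
    simp add: simplex_int_def inner_add_right inner_sum_right inner_diff_right)

section \<open>Ridge polynomials on the disk\<close>

definition disk_point :: "complex \<Rightarrow> real \<times> real \<Rightarrow> complex" where
  "disk_point v p = v * Complex (cos (snd p)) (fst p * sin (snd p))"

abbreviation param_box :: "(real \<times> real) set" where
  "param_box \<equiv> cbox (- 1, - pi) (1, pi)"

text \<open>Up to the factor 2, this is the Lebesgue integral of \<open>g\<close> over the disk, in the coordinates
  \<open>v (cos \<theta> + \<i> s sin \<theta>)\<close> adapted to the direction \<open>v\<close>.\<close>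

definition disk_int :: "complex \<Rightarrow> (complex \<Rightarrow> real) \<Rightarrow> real" where
  "disk_int v g = integral param_box (\<lambda>p. g (disk_point v p) * (sin (snd p))\<^sup>2)"

lemma norm_disk_point_le:
  assumes "\<bar>s\<bar> \<le> 1" "cmod v = 1"
  shows "cmod (disk_point v (s, \<theta>)) \<le> 1"
proof -
  have "(cmod (Complex (cos \<theta>) (s * sin \<theta>)))\<^sup>2 = (cos \<theta>)\<^sup>2 + s\<^sup>2 * (sin \<theta>)\<^sup>2"
    by (simp add: cmod_power2 power_mult_distrib)
  also have "\<dots> \<le> (cos \<theta>)\<^sup>2 + 1 * (sin \<theta>)\<^sup>2"
    using assms by (intro add_left_mono mult_right_mono) (auto simp: abs_square_le_1)
  finally have "(cmod (Complex (cos \<theta>) (s * sin \<theta>)))\<^sup>2 \<le> 1\<^sup>2" by simp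
  then have "cmod (Complex (cos \<theta>) (s * sin \<theta>)) \<le> 1" by (rule power2_le_imp_le) simp
  then show ?thesis using assms by (simp add: disk_point_def norm_mult)
qed

lemma disk_point_in_disk: "p \<in> param_box \<Longrightarrow> cmod v = 1 \<Longrightarrow> disk_point v p \<in> unit_disk"
  using norm_disk_point_le[of "fst p" v "snd p"] by (cases p) (auto simp: cbox_Pair_eq abs_le_iff)

lemma continuous_on_disk_point: "continuous_on A (disk_point v)"
  unfolding disk_point_def Complex_eq by (intro continuous_intros)

lemma continuous_on_disk_integrand:
  assumes "continuous_on unit_disk g" "cmod v = 1"
  shows "continuous_on param_box (\<lambda>p. g (disk_point v p) * (sin (snd p))\<^sup>2)"
  using disk_point_in_disk assms(2)
  by (intro continuous_intros continuous_on_compose2[OF assms(1)] continuous_on_disk_point) auto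

lemma disk_int_add:
  assumes "continuous_on unit_disk g" "continuous_on unit_disk h" "cmod v = 1"
  shows "disk_int v (\<lambda>x. g x + h x) = disk_int v g + disk_int v h"
  unfolding disk_int_def using assms
  by (simp add: distrib_right integral_add integrable_continuous continuous_on_disk_integrand)

lemma disk_int_cmult: "disk_int v (\<lambda>x. c * g x) = c * disk_int v g"
  unfolding disk_int_def by (simp add: mult.assoc)

lemma disk_int_diff:
  assumes "continuous_on unit_disk g" "continuous_on unit_disk h" "cmod v = 1"
  shows "disk_int v (\<lambda>x. g x - h x) = disk_int v g - disk_int v h"
  using disk_int_add[OF assms(1) continuous_on_minus[OF assms(2)] assms(3)] disk_int_cmult[of v "-1" h]
  by simp

lemma disk_int_sum:
  assumes "\<And>i. i \<in> I \<Longrightarrow> continuous_on unit_disk (g i)" "cmod v = 1"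
  shows "disk_int v (\<lambda>x. \<Sum>i\<in>I. g i x) = (\<Sum>i\<in>I. disk_int v (g i))"
  using assms
proof (induction I rule: infinite_finite_induct)
  case (insert i I)
  then show ?case by (simp add: disk_int_add continuous_on_sum)
qed (simp_all add: disk_int_def)

lemma abs_disk_int_le:
  assumes "continuous_on unit_disk g" "cmod v = 1" "\<And>x. x \<in> unit_disk \<Longrightarrow> \<bar>g x\<bar> \<le> B" "0 \<le> B"
  shows "\<bar>disk_int v g\<bar> \<le> B * (4 * pi)"
proof -
  have "norm (disk_int v g) \<le> B * measure lborel param_box"
    unfolding disk_int_def
  proof (rule has_integral_bound[OF \<open>0 \<le> B\<close> integrable_integral])
    show "(\<lambda>p. g (disk_point v p) * (sin (snd p))\<^sup>2) integrable_on param_box"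
      using assms by (intro integrable_continuous continuous_on_disk_integrand)
    fix p :: "real \<times> real" assume "p \<in> param_box"
    then have "\<bar>g (disk_point v p)\<bar> \<le> B" using assms disk_point_in_disk by blast
    then have "\<bar>g (disk_point v p)\<bar> * (sin (snd p))\<^sup>2 \<le> B * 1"
      using assms(4) by (intro mult_mono) (auto simp: abs_square_le_1)
    then show "norm (g (disk_point v p) * (sin (snd p))\<^sup>2) \<le> B" by (simp add: abs_mult)
  qed
  also have "measure lborel param_box = 4 * pi" by (simp add: content_Pair)
  finally show ?thesis by simp
qed

lemma integral_cos_int:
  fixes a :: real
  assumes "a \<in> \<int>"
  shows "((\<lambda>\<theta>. cos (a * \<theta>)) has_integral (if a = 0 then 2 * pi else 0)) {- pi..pi}"
proof (cases "a = 0")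
  case True
  then show ?thesis using has_integral_const_real[of "1::real" "- pi" pi] by simp
next
  case False
  have "((\<lambda>\<theta>. cos (a * \<theta>)) has_integral (sin (a * pi) / a - sin (a * - pi) / a)) {- pi..pi}"
  proof (rule fundamental_theorem_of_calculus)
    fix x
    have "((\<lambda>\<theta>. sin (a * \<theta>) / a) has_field_derivative cos (a * x)) (at x within {- pi..pi})"
      using False by (auto intro!: derivative_eq_intros)
    then show "((\<lambda>\<theta>. sin (a * \<theta>) / a) has_vector_derivative cos (a * x)) (at x within {- pi..pi})"
      by (simp add: has_real_derivative_iff_has_vector_derivative)
  qed simp
  moreover have "sin (a * pi) = 0" using assms by (auto simp: mult.commute elim!: Ints_cases)
  ultimately show ?thesis using False by simp
qed

lemma integral_sin_sin:
  "integral {- pi..pi} (\<lambda>\<theta>. sin (real (Suc k) * \<theta>) * sin (real (Suc l) * \<theta>)) = (if k = l then pi else 0)"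
proof -
  have "((\<lambda>\<theta>. (cos ((real (Suc k) - real (Suc l)) * \<theta>) - cos ((real (Suc k) + real (Suc l)) * \<theta>)) / 2) has_integral
     ((if real (Suc k) - real (Suc l) = 0 then 2 * pi else 0) - (if real (Suc k) + real (Suc l) = 0 then 2 * pi else 0)) / 2) {- pi..pi}"
    by (intro has_integral_divide has_integral_diff integral_cos_int) auto
  also have "(\<lambda>\<theta>. (cos ((real (Suc k) - real (Suc l)) * \<theta>) - cos ((real (Suc k) + real (Suc l)) * \<theta>)) / 2)
      = (\<lambda>\<theta>. sin (real (Suc k) * \<theta>) * sin (real (Suc l) * \<theta>))"
    by (simp add: fun_eq_iff sin_times_sin left_diff_distrib distrib_right)
  finally show ?thesis by (auto simp: integral_unique)
qed

lemma direction_angle: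
  assumes "cmod v = 1" "cmod w = 1"
  obtains \<alpha> where "v \<bullet> w = cos \<alpha>" "\<And>s \<theta>. w \<bullet> disk_point v (s, \<theta>) = cos \<alpha> * cos \<theta> + s * (sin \<alpha> * sin \<theta>)"
proof -
  define z where "z = cnj w * v"
  have "(Re z)\<^sup>2 + (- Im z)\<^sup>2 = 1"
  proof -
    have "cmod z = 1" using assms by (simp add: z_def norm_mult)
    then show ?thesis using cmod_power2[of z] by simp
  qed
  then obtain \<alpha> where \<alpha>: "Re z = cos \<alpha>" "- Im z = sin \<alpha>"
    by (metis sincos_total_2pi)
  have "v \<bullet> w = cos \<alpha>" unfolding \<alpha>(1)[symmetric] z_def by (simp add: inner_complex_def)
  moreover have "w \<bullet> disk_point v (s, \<theta>) = Re z * cos \<theta> + s * (- Im z * sin \<theta>)" for s \<theta>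
    by (simp add: z_def inner_complex_def disk_point_def algebra_simps)
  ultimately show ?thesis using that \<alpha> by auto
qed

text \<open>The slice is the chord <v, x> = cos \<theta>. Along it U_l is the derivative of T_{l+1}
  / (l + 1) in an affine argument, up to the slope, and the end values are cos(\<alpha> - \<theta>)
  and cos(\<alpha> + \<theta>). If sin \<alpha> = 0, which means w = v or w = -v, the integrand is
  constant in s and the parity of U_l decides.\<close>

lemma slice_integral:
  "real (Suc l) * sin \<theta> * integral {- 1..1} (\<lambda>s. poly (chebU l) (cos \<alpha> * cos \<theta> + s * (sin \<alpha> * sin \<theta>)))
     = 2 * poly (chebU l) (cos \<alpha>) * sin (real (Suc l) * \<theta>)"
proof (cases "sin \<alpha> = 0")
  case True
  then have "\<bar>cos \<alpha>\<bar> = 1" using sin_zero_abs_cos_one by blast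
  then have "cos \<alpha> = 1 \<or> cos \<alpha> = -1" by auto
  then have "real (Suc l) * poly (chebU l) (cos \<alpha> * cos \<theta>) = poly (chebU l) (cos \<alpha>) * poly (chebU l) (cos \<theta>)"
    by (auto simp: poly_chebU_1 poly_chebU_minus)
  from arg_cong[OF this, of "\<lambda>x. 2 * sin \<theta> * x"]
  have "real (Suc l) * sin \<theta> * (2 * poly (chebU l) (cos \<alpha> * cos \<theta>))
      = 2 * poly (chebU l) (cos \<alpha>) * (sin \<theta> * poly (chebU l) (cos \<theta>))"
    by (simp only: ac_simps)
  then show ?thesis using True by (simp add: sin_poly_chebU)
next
  case False
  let ?x = "\<lambda>s. cos \<alpha> * cos \<theta> + s * (sin \<alpha> * sin \<theta>)"
  have "((\<lambda>s. sin \<alpha> * sin \<theta> * real (Suc l) * poly (chebU l) (?x s)) has_integral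
      poly (chebT (Suc l)) (?x 1) - poly (chebT (Suc l)) (?x (- 1))) {- 1..1}"
  proof (rule fundamental_theorem_of_calculus)
    fix s :: real
    have "((\<lambda>s. poly (chebT (Suc l)) (?x s)) has_field_derivative
        poly (pderiv (chebT (Suc l))) (?x s) * (sin \<alpha> * sin \<theta>)) (at s within {- 1..1})"
      by (rule DERIV_chain2[OF poly_DERIV]) (auto intro!: derivative_eq_intros)
    then show "((\<lambda>s. poly (chebT (Suc l)) (?x s)) has_vector_derivative
        sin \<alpha> * sin \<theta> * real (Suc l) * poly (chebU l) (?x s)) (at s within {- 1..1})"
      unfolding pderiv_chebT_Suc by (simp add: has_real_derivative_iff_has_vector_derivative mult_ac)
  qed simp
  then have "sin \<alpha> * sin \<theta> * real (Suc l) * integral {- 1..1} (\<lambda>s. poly (chebU l) (?x s))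
      = poly (chebT (Suc l)) (?x 1) - poly (chebT (Suc l)) (?x (- 1))"
    unfolding integral_mult_right[symmetric] by (rule integral_unique)
  also have "?x 1 = cos (\<alpha> - \<theta>)" by (simp add: cos_diff)
  also have "?x (- 1) = cos (\<alpha> + \<theta>)" by (simp add: cos_add)
  also have "poly (chebT (Suc l)) (cos (\<alpha> - \<theta>)) - poly (chebT (Suc l)) (cos (\<alpha> + \<theta>))
      = 2 * sin (real (Suc l) * \<alpha>) * sin (real (Suc l) * \<theta>)"
    unfolding poly_chebT_cos right_diff_distrib distrib_left by (simp add: cos_diff cos_add)
  also have "\<dots> = sin \<alpha> * (2 * poly (chebU l) (cos \<alpha>) * sin (real (Suc l) * \<theta>))"
    unfolding sin_poly_chebU[of \<alpha>, symmetric] by simp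
  finally show ?thesis using False by (simp add: mult.assoc mult.left_commute)
qed

lemma continuous_on_ridge: "continuous_on A (\<lambda>x::complex. poly p (w \<bullet> x))"
  by (intro continuous_intros)

text \<open>Integration over the chords orthogonal to v leaves a multiple of sin((l + 1) \<theta>)
  by \<open>slice_integral\<close>, and U_k with the rest of the weight supplies sin((k + 1)
  \<theta>). Orthogonality of sines then separates the degrees.\<close>

lemma disk_int_ridge_product:
  assumes v: "cmod v = 1" and w: "cmod w = 1"
  shows "disk_int v (\<lambda>x. poly (chebU l) (w \<bullet> x) * poly (chebU k) (v \<bullet> x))
    = (if k = l then 2 * pi * poly (chebU l) (v \<bullet> w) / real (Suc l) else 0)"
proof -
  obtain \<alpha> where \<alpha>: "v \<bullet> w = cos \<alpha>" "\<And>s \<theta>. w \<bullet> disk_point v (s, \<theta>) = cos \<alpha> * cos \<theta> + s * (sin \<alpha> * sin \<theta>)"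
    using direction_angle[OF v w] by blast
  have vv: "v \<bullet> disk_point v (s, \<theta>) = cos \<theta>" for s \<theta>
  proof -
    have "v \<bullet> (v * z) = Re z" for z
      using unit_mult_cnj(2)[OF v] unfolding inner_eq_Re_cnj_mult by (simp flip: mult.assoc)
    then show ?thesis by (simp add: disk_point_def)
  qed
  define F where "F = (\<lambda>s \<theta>. poly (chebU l) (cos \<alpha> * cos \<theta> + s * (sin \<alpha> * sin \<theta>)) * poly (chebU k) (cos \<theta>) * (sin \<theta>)\<^sup>2)"
  have cont: "continuous_on param_box (\<lambda>(s, \<theta>). F s \<theta>)"
    unfolding F_def split_beta by (intro continuous_intros)
  have "disk_int v (\<lambda>x. poly (chebU l) (w \<bullet> x) * poly (chebU k) (v \<bullet> x)) = integral param_box (\<lambda>(s, \<theta>). F s \<theta>)"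
    unfolding disk_int_def F_def by (intro integral_cong) (auto simp: \<alpha> vv)
  also have "\<dots> = integral (cbox (- 1) 1) (\<lambda>s. integral (cbox (- pi) pi) (F s))"
    using integral_prod_continuous[OF cont] by simp
  also have "\<dots> = integral (cbox (- pi) pi) (\<lambda>\<theta>. integral (cbox (- 1) 1) (\<lambda>s. F s \<theta>))"
    by (rule integral_swap_continuous[OF cont])
  also have "\<dots> = integral {- pi..pi} (\<lambda>\<theta>. (2 * poly (chebU l) (cos \<alpha>) / real (Suc l)) *
      (sin (real (Suc k) * \<theta>) * sin (real (Suc l) * \<theta>)))"
    unfolding cbox_interval
  proof (intro integral_cong)
    fix \<theta> :: real
    have "integral {- 1..1} (\<lambda>s. F s \<theta>) = (poly (chebU k) (cos \<theta>) * (sin \<theta>)\<^sup>2) *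
        integral {- 1..1} (\<lambda>s. poly (chebU l) (cos \<alpha> * cos \<theta> + s * (sin \<alpha> * sin \<theta>)))"
      unfolding F_def integral_mult_right[symmetric] by (simp add: mult_ac)
    also have "\<dots> = (sin \<theta> * poly (chebU k) (cos \<theta>)) / real (Suc l) *
       (real (Suc l) * sin \<theta> * integral {- 1..1} (\<lambda>s. poly (chebU l) (cos \<alpha> * cos \<theta> + s * (sin \<alpha> * sin \<theta>))))"
      by (simp add: power2_eq_square)
    also have "\<dots> = (2 * poly (chebU l) (cos \<alpha>) / real (Suc l)) *
      (sin (real (Suc k) * \<theta>) * sin (real (Suc l) * \<theta>))"
      unfolding slice_integral sin_poly_chebU by simp
    finally show "integral {- 1..1} (\<lambda>s. F s \<theta>) = (2 * poly (chebU l) (cos \<alpha>) / real (Suc l)) *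
      (sin (real (Suc k) * \<theta>) * sin (real (Suc l) * \<theta>))" .
  qed
  also have "\<dots> = (if k = l then 2 * pi * poly (chebU l) (v \<bullet> w) / real (Suc l) else 0)"
    unfolding integral_mult_right integral_sin_sin \<alpha>(1) by simp
  finally show ?thesis .
qed

text \<open>P stands for membership in a closed linear space. Stone-Weierstrass needs an algebra,
  and exponentials of linear forms supply one, since they multiply by adding the forms. They lie in
  the space as limits of combinations of powers <w, x>^n, which expand into U_0, ..., U_n in the
  direction of w.\<close>

lemma ridge_density:
  fixes P :: "(complex \<Rightarrow> real) \<Rightarrow> bool"
  assumes ridge: "\<And>c w l. cmod w = 1 \<Longrightarrow> P (\<lambda>x. c * poly (chebU l) (w \<bullet> x))"
    and add: "\<And>g h. P g \<Longrightarrow> P h \<Longrightarrow> P (\<lambda>x. g x + h x)"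
    and lim: "\<And>g. continuous_on unit_disk g \<Longrightarrow>
      (\<And>\<epsilon>. 0 < \<epsilon> \<Longrightarrow> \<exists>h. P h \<and> (\<forall>x\<in>unit_disk. \<bar>g x - h x\<bar> < \<epsilon>)) \<Longrightarrow> P g"
    and g: "continuous_on unit_disk g"
  shows "P g"
proof -
  have sum: "P (\<lambda>x. \<Sum>i\<in>I. h i x)" if "\<And>i. i \<in> I \<Longrightarrow> P (h i)" for I :: "nat set" and h
    using that
  proof (induction I rule: infinite_finite_induct)
    case (insert i I)
    then show ?case using add by simp
  qed (use ridge[of 1 0] in simp_all)
  have monom: "\<exists>c. \<forall>t. t ^ n = (\<Sum>i\<le>n. c i * poly (chebU i) t)" for n :: nat
  proof (induction n)
    case 0
    show ?case by (intro exI[of _ "\<lambda>_. 1"]) simp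
  next
    case (Suc n)
    then obtain c where c: "\<And>t. t ^ n = (\<Sum>i\<le>n. c i * poly (chebU i) t)" by blast
    define c' where "c' = (\<lambda>i. (if i = 0 then 0 else c (i - 1) / 2) + (if Suc i \<le> n then c (Suc i) / 2 else 0))"
    have shift: "t * poly (chebU i) t = poly (chebU (Suc i)) t / 2 + (if i = 0 then 0 else poly (chebU (i - 1)) t / 2)" for i t
      by (cases i) (auto simp: field_simps)
    have "t ^ Suc n = (\<Sum>i\<le>Suc n. c' i * poly (chebU i) t)" for t
    proof -
      have "t ^ Suc n = (\<Sum>i\<le>n. c i * (t * poly (chebU i) t))"
        by (simp add: c sum_distrib_left mult_ac)
      also have "\<dots> = (\<Sum>i\<le>n. c i * poly (chebU (Suc i)) t / 2) + (\<Sum>i\<le>n. if i = 0 then 0 else c i * poly (chebU (i - 1)) t / 2)"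
        unfolding shift sum.distrib[symmetric] by (intro sum.cong) (auto simp: algebra_simps)
      also have "(\<Sum>i\<le>n. c i * poly (chebU (Suc i)) t / 2) = (\<Sum>i\<le>Suc n. (if i = 0 then 0 else c (i - 1) / 2) * poly (chebU i) t)"
        unfolding sum.atMost_Suc_shift by simp
      also have "(\<Sum>i\<le>n. if i = 0 then 0 else c i * poly (chebU (i - 1)) t / 2)
          = (\<Sum>i\<le>Suc n. if Suc i \<le> n then c (Suc i) / 2 * poly (chebU i) t else 0)"
      proof -
        have "(\<Sum>i\<le>n. if i = 0 then 0 else c i * poly (chebU (i - 1)) t / 2)
            = (\<Sum>i\<in>{1..n}. c i * poly (chebU (i - 1)) t / 2)"
          by (intro sum.mono_neutral_cong_right) auto
        also have "\<dots> = (\<Sum>i<n. c (Suc i) * poly (chebU i) t / 2)"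
          by (intro sum.reindex_bij_witness[of _ Suc "\<lambda>i. i - 1"]) auto
        also have "\<dots> = (\<Sum>i\<le>Suc n. if Suc i \<le> n then c (Suc i) / 2 * poly (chebU i) t else 0)"
          by (intro sum.mono_neutral_cong_left) auto
        finally show ?thesis .
      qed
      also have "(\<Sum>i\<le>Suc n. (if i = 0 then 0 else c (i - 1) / 2) * poly (chebU i) t) + \<dots> = (\<Sum>i\<le>Suc n. c' i * poly (chebU i) t)"
        unfolding sum.distrib[symmetric] c'_def by (intro sum.cong) (auto simp: distrib_right)
      finally show ?thesis .
    qed
    then show ?case by blast
  qed
  have power: "P (\<lambda>x. c * (w \<bullet> x) ^ n)" for c w n
  proof -
    obtain v where v: "cmod v = 1" "w = cmod w *\<^sub>R v"
      by (cases "w = 0") (auto intro: that[of 1] that[of "sgn w"] simp: norm_sgn sgn_div_norm)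
    obtain a where a: "\<And>t. t ^ n = (\<Sum>i\<le>n. a i * poly (chebU i) t)" using monom by blast
    have "(\<lambda>x. c * (w \<bullet> x) ^ n) = (\<lambda>x. \<Sum>i\<le>n. (c * cmod w ^ n * a i) * poly (chebU i) (v \<bullet> x))"
    proof
      fix x
      have "c * (w \<bullet> x) ^ n = c * cmod w ^ n * (v \<bullet> x) ^ n"
        by (subst v(2)) (simp add: power_mult_distrib)
      also have "(v \<bullet> x) ^ n = (\<Sum>i\<le>n. a i * poly (chebU i) (v \<bullet> x))" by (rule a)
      finally show "c * (w \<bullet> x) ^ n = (\<Sum>i\<le>n. (c * cmod w ^ n * a i) * poly (chebU i) (v \<bullet> x))"
        by (simp add: sum_distrib_left mult.assoc)
    qed
    moreover have "P (\<lambda>x. \<Sum>i\<le>n. (c * cmod w ^ n * a i) * poly (chebU i) (v \<bullet> x))"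
      by (intro sum ridge v)
    ultimately show ?thesis by (simp only:)
  qed
  have exponential: "P (\<lambda>x. c * exp (w \<bullet> x))" for c w
  proof (rule lim)
    fix \<epsilon> :: real assume "0 < \<epsilon>"
    have "uniform_limit unit_disk (\<lambda>n x. \<Sum>i<n. c / fact i * (w \<bullet> x) ^ i) (\<lambda>x. suminf (\<lambda>i. c / fact i * (w \<bullet> x) ^ i)) sequentially"
    proof (rule Weierstrass_m_test)
      show "summable (\<lambda>i. \<bar>c\<bar> * (inverse (fact i) * cmod w ^ i))"
        by (intro summable_mult summable_exp)
      fix i and x :: complex assume "x \<in> unit_disk"
      then have "\<bar>w \<bullet> x\<bar> \<le> cmod w * 1"
        by (intro order_trans[OF Cauchy_Schwarz_ineq2] mult_left_mono) auto
      then have "\<bar>w \<bullet> x\<bar> ^ i \<le> cmod w ^ i" by (intro power_mono) auto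
      then have "\<bar>c\<bar> / fact i * \<bar>w \<bullet> x\<bar> ^ i \<le> \<bar>c\<bar> / fact i * cmod w ^ i" by (intro mult_left_mono) auto
      then show "norm (c / fact i * (w \<bullet> x) ^ i) \<le> \<bar>c\<bar> * (inverse (fact i) * cmod w ^ i)"
        by (simp add: abs_mult power_abs divide_inverse mult.assoc)
    qed
    moreover have "suminf (\<lambda>i. c / fact i * (w \<bullet> x) ^ i) = c * exp (w \<bullet> x)" for x
    proof -
      have "(\<lambda>i. c * ((w \<bullet> x) ^ i /\<^sub>R fact i)) sums (c * exp (w \<bullet> x))"
        by (intro sums_mult exp_converges)
      then show ?thesis by (simp add: sums_iff field_simps)
    qed
    ultimately have "\<forall>\<^sub>F n in sequentially. \<forall>x\<in>unit_disk. dist (\<Sum>i<n. c / fact i * (w \<bullet> x) ^ i) (c * exp (w \<bullet> x)) < \<epsilon>"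
      using \<open>0 < \<epsilon>\<close> by (simp add: uniform_limit_iff)
    then obtain n where "\<forall>x\<in>unit_disk. dist (\<Sum>i<n. c / fact i * (w \<bullet> x) ^ i) (c * exp (w \<bullet> x)) < \<epsilon>"
      using eventually_happens'[OF sequentially_bot] by blast
    moreover have "P (\<lambda>x. \<Sum>i<n. c / fact i * (w \<bullet> x) ^ i)" by (intro sum power)
    ultimately show "\<exists>h. P h \<and> (\<forall>x\<in>unit_disk. \<bar>c * exp (w \<bullet> x) - h x\<bar> < \<epsilon>)"
      by (auto simp: dist_real_def abs_minus_commute)
  qed (intro continuous_intros)
  define R where "R = {h. P h \<and> (\<exists>n c w. h = (\<lambda>x. \<Sum>i<n::nat. c i * exp (w i \<bullet> x)))}"
  have R: "(\<lambda>x. \<Sum>i\<in>I. c i * exp (w i \<bullet> x)) \<in> R" if fin: "finite I" for I :: "'i set" and c :: "'i \<Rightarrow> real" and w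
  proof -
    obtain b where "bij_betw b {..<card I} I"
      using ex_bij_betw_nat_finite[OF fin] by (auto simp: atLeast0LessThan)
    then have "(\<lambda>x. \<Sum>i\<in>I. c i * exp (w i \<bullet> x)) = (\<lambda>x. \<Sum>i<card I. c (b i) * exp (w (b i) \<bullet> x))"
      by (simp add: fun_eq_iff sum.reindex_bij_betw[of b "{..<card I}" I, symmetric])
    moreover have "P (\<lambda>x. \<Sum>i<card I. c (b i) * exp (w (b i) \<bullet> x))" by (intro sum exponential)
    ultimately show ?thesis
      unfolding R_def by (intro CollectI conjI exI[of _ "card I"] exI[of _ "c \<circ> b"] exI[of _ "w \<circ> b"]) auto
  qed
  interpret function_ring_on R unit_disk
  proof
    show "continuous_on unit_disk h" if "h \<in> R" for h
      using that by (auto simp: R_def intro!: continuous_intros)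
    show "(\<lambda>x. h x + h' x) \<in> R" if "h \<in> R" "h' \<in> R" for h h'
    proof -
      obtain n c w where h: "h = (\<lambda>x. \<Sum>i<n::nat. c i * exp (w i \<bullet> x))" using \<open>h \<in> R\<close> by (auto simp: R_def)
      obtain n' c' w' where h': "h' = (\<lambda>x. \<Sum>i<n'::nat. c' i * exp (w' i \<bullet> x))" using \<open>h' \<in> R\<close> by (auto simp: R_def)
      have "(\<lambda>x. h x + h' x) = (\<lambda>x. \<Sum>i\<in>{..<n} <+> {..<n'}. case_sum c c' i * exp (case_sum w w' i \<bullet> x))"
        by (simp add: h h' sum.Plus)
      then show ?thesis using R[of "{..<n} <+> {..<n'}"] by simp
    qed
    show "(\<lambda>x. h x * h' x) \<in> R" if "h \<in> R" "h' \<in> R" for h h'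
    proof -
      obtain n c w where h: "h = (\<lambda>x. \<Sum>i<n::nat. c i * exp (w i \<bullet> x))" using \<open>h \<in> R\<close> by (auto simp: R_def)
      obtain n' c' w' where h': "h' = (\<lambda>x. \<Sum>i<n'::nat. c' i * exp (w' i \<bullet> x))" using \<open>h' \<in> R\<close> by (auto simp: R_def)
      have "(\<lambda>x. h x * h' x) = (\<lambda>x. \<Sum>p\<in>{..<n} \<times> {..<n'}. (c (fst p) * c' (snd p)) * exp ((w (fst p) + w' (snd p)) \<bullet> x))"
        unfolding h h' sum_product sum.cartesian_product split_beta
        by (intro ext sum.cong) (auto simp: inner_add_left exp_add)
      then show ?thesis using R[of "{..<n} \<times> {..<n'}"] by simp
    qed
    show "(\<lambda>_. c) \<in> R" for c using R[of "{()}" "\<lambda>_. c" "\<lambda>_. 0"] by simp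
    show "\<exists>h\<in>R. h x \<noteq> h y" if "x \<noteq> y" for x y
    proof (intro bexI)
      have "(x - y) \<bullet> x - (x - y) \<bullet> y = (x - y) \<bullet> (x - y)" by (rule inner_diff_right[symmetric])
      moreover have "(x - y) \<bullet> (x - y) \<noteq> 0" using that by simp
      ultimately have "(x - y) \<bullet> x \<noteq> (x - y) \<bullet> y" by linarith
      then show "exp ((x - y) \<bullet> x) \<noteq> exp ((x - y) \<bullet> y)" by (simp only: exp_inj_iff simp_thms)
      show "(\<lambda>z. exp ((x - y) \<bullet> z)) \<in> R" using R[of "{()}" "\<lambda>_. 1" "\<lambda>_. x - y"] by simp
    qed
  qed simp
  show ?thesis
  proof (rule lim[OF g])
    fix \<epsilon> :: real assume "0 < \<epsilon>"
    then obtain h where "h \<in> R" "\<forall>x\<in>unit_disk. \<bar>g x - h x\<bar> < \<epsilon>" using Stone_Weierstrass_basic[OF g] by blast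
    then show "\<exists>h. P h \<and> (\<forall>x\<in>unit_disk. \<bar>g x - h x\<bar> < \<epsilon>)" by (auto simp: R_def)
  qed
qed

text \<open>Density takes the place of a change of variables: on ridge polynomials
  \<open>disk_int_ridge_product\<close> with k = 0 computes the integral, with the same value for
  every v.\<close>

lemma disk_int_rotate:
  assumes v: "cmod v = 1" and g: "continuous_on unit_disk g"
  shows "disk_int v g = disk_int 1 g"
proof -
  define P where "P = (\<lambda>h. continuous_on unit_disk h \<and> disk_int v h = disk_int 1 h)"
  have "P g"
  proof (rule ridge_density[OF _ _ _ g])
    fix c w l assume w: "cmod w = 1"
    have "disk_int u (\<lambda>x. c * poly (chebU l) (w \<bullet> x)) = c * (if 0 = l then 2 * pi else 0)" if "cmod u = 1" for u
      using disk_int_ridge_product[OF that w, of l 0] by (auto simp: disk_int_cmult)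
    then show "P (\<lambda>x. c * poly (chebU l) (w \<bullet> x))"
      using v by (simp add: P_def continuous_on_ridge continuous_intros)
  next
    fix g h assume "P g" "P h"
    then show "P (\<lambda>x. g x + h x)" using v by (auto simp: P_def disk_int_add intro!: continuous_intros)
  next
    fix g :: "complex \<Rightarrow> real" assume g: "continuous_on unit_disk g"
      and ex: "\<And>\<epsilon>. 0 < \<epsilon> \<Longrightarrow> \<exists>h. P h \<and> (\<forall>x\<in>unit_disk. \<bar>g x - h x\<bar> < \<epsilon>)"
    have "\<bar>disk_int v g - disk_int 1 g\<bar> \<le> \<epsilon>" if "0 < \<epsilon>" for \<epsilon>
    proof -
      define \<delta> where "\<delta> = \<epsilon> / (8 * pi)"
      have "0 < \<delta>" using that by (simp add: \<delta>_def)
      then obtain h where h: "P h" "\<forall>x\<in>unit_disk. \<bar>g x - h x\<bar> < \<delta>" using ex by blast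
      have "\<bar>disk_int u g - disk_int u h\<bar> \<le> \<delta> * (4 * pi)" if "cmod u = 1" for u
        unfolding disk_int_diff[OF g conjunct1[OF h(1)[unfolded P_def]] that, symmetric]
        using h g that \<open>0 < \<delta>\<close> by (intro abs_disk_int_le) (auto simp: P_def less_imp_le intro!: continuous_intros)
      from this[OF v] this[of 1] h(1) have "\<bar>disk_int v g - disk_int 1 g\<bar> \<le> 2 * (\<delta> * (4 * pi))"
        by (auto simp: P_def)
      then show ?thesis by (simp add: \<delta>_def)
    qed
    then have "\<bar>disk_int v g - disk_int 1 g\<bar> \<le> 0" by (rule field_le_epsilon) simp
    with g show "P g" by (simp add: P_def)
  qed
  then show ?thesis by (simp add: P_def)
qed

text \<open>The weight vanishes where sin \<theta> = 0, so the integral controls g only at points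
  with sin \<theta> \<noteq> 0. Every interior point has such coordinates, and continuity reaches
  the circle.\<close>

lemma disk_int_square_eq_0:
  assumes g: "continuous_on unit_disk g" and 0: "disk_int 1 (\<lambda>x. g x * g x) = 0" and x: "x \<in> unit_disk"
  shows "g x = 0"
proof -
  have zero: "g (disk_point 1 p) * g (disk_point 1 p) * (sin (snd p))\<^sup>2 = 0" if "p \<in> param_box" for p
  proof -
    have "box (- 1, - pi) (1::real, pi) \<noteq> {}" by (auto simp: box_ne_empty Basis_prod_def)
    moreover have "continuous_on param_box (\<lambda>p. g (disk_point 1 p) * g (disk_point 1 p) * (sin (snd p))\<^sup>2)"
      using continuous_on_disk_integrand[OF continuous_on_mult[OF g g], of 1] by simp
    ultimately show ?thesis
      using integral_cbox_eq_0_iff[of "(- 1, - pi)" "(1, pi)" "\<lambda>p. g (disk_point 1 p) * g (disk_point 1 p) * (sin (snd p))\<^sup>2"]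
        0 that by (auto simp: disk_int_def)
  qed
  have interior: "g x = 0" if "x \<in> ball 0 1" for x
  proof -
    have n: "(Re x)\<^sup>2 + (Im x)\<^sup>2 < 1"
      using that power_strict_mono[of "cmod x" 1 2] by (simp add: cmod_power2)
    then have "(Re x)\<^sup>2 < 1" by (smt (verit) zero_le_power2)
    then have re: "\<bar>Re x\<bar> < 1" by (simp add: abs_square_less_1)
    define \<theta> where "\<theta> = arccos (Re x)"
    have cos: "cos \<theta> = Re x" using re by (simp add: \<theta>_def cos_arccos_abs)
    have sin: "sin \<theta> = sqrt (1 - (Re x)\<^sup>2)" "0 < sin \<theta>"
      using re \<open>(Re x)\<^sup>2 < 1\<close> by (auto simp: \<theta>_def sin_arccos)
    have "(Im x)\<^sup>2 \<le> (sin \<theta>)\<^sup>2" using n \<open>(Re x)\<^sup>2 < 1\<close> by (simp add: sin)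
    then have "\<bar>Im x\<bar> \<le> sin \<theta>" using sin(2) by (metis abs_le_square_iff abs_of_pos)
    then have s: "- 1 \<le> Im x / sin \<theta>" "Im x / sin \<theta> \<le> 1" using sin(2) by (simp_all add: field_simps abs_le_iff)
    have "- pi \<le> \<theta>" "\<theta> \<le> pi"
      using re arccos_bounded[of "Re x"] by (auto simp: \<theta>_def intro: order_trans[of _ 0])
    then have "(Im x / sin \<theta>, \<theta>) \<in> param_box" using s by (auto simp: cbox_Pair_eq)
    moreover have "disk_point 1 (Im x / sin \<theta>, \<theta>) = x"
      using sin(2) by (simp add: disk_point_def cos complex_eq_iff)
    ultimately show ?thesis using zero[of "(Im x / sin \<theta>, \<theta>)"] sin(2) by simp
  qed
  have cl: "closure (ball 0 1) = (unit_disk :: complex set)" by simp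
  show ?thesis
  proof (rule continuous_constant_on_closure[of "ball 0 1" g 0 x])
    show "continuous_on (closure (ball 0 1)) g" unfolding cl by (rule g)
    show "x \<in> closure (ball 0 1)" unfolding cl by (rule x)
  qed (rule interior)
qed

text \<open>The continuous functions orthogonal to g form a closed linear space, so density puts g
  itself into it.\<close>

lemma ridge_complete:
  assumes g: "continuous_on unit_disk g"
    and 0: "\<And>w l. cmod w = 1 \<Longrightarrow> disk_int 1 (\<lambda>x. g x * poly (chebU l) (w \<bullet> x)) = 0"
    and x: "x \<in> unit_disk"
  shows "g x = 0"
proof -
  define P where "P = (\<lambda>h. continuous_on unit_disk h \<and> disk_int 1 (\<lambda>x. g x * h x) = 0)"
  have "P g"
  proof (rule ridge_density[OF _ _ _ g])
    fix c w l assume "cmod w = 1"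
    then show "P (\<lambda>x. c * poly (chebU l) (w \<bullet> x))"
      using 0[of w l] disk_int_cmult[of 1 c "\<lambda>x. g x * poly (chebU l) (w \<bullet> x)"]
      by (simp add: P_def mult.left_commute continuous_on_ridge continuous_intros)
  next
    fix h h' assume "P h" "P h'"
    then show "P (\<lambda>x. h x + h' x)"
      using g by (auto simp: P_def distrib_left disk_int_add continuous_on_add continuous_on_mult)
  next
    fix h :: "complex \<Rightarrow> real" assume h: "continuous_on unit_disk h"
      and ex: "\<And>\<epsilon>. 0 < \<epsilon> \<Longrightarrow> \<exists>h'. P h' \<and> (\<forall>x\<in>unit_disk. \<bar>h x - h' x\<bar> < \<epsilon>)"
    have "bounded (g ` unit_disk)"
      using g by (intro compact_imp_bounded compact_continuous_image) auto
    then obtain B where "\<forall>x\<in>unit_disk. \<bar>g x\<bar> \<le> B" by (auto simp: bounded_iff)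
    then have B: "\<bar>g x\<bar> \<le> \<bar>B\<bar> + 1" if "x \<in> unit_disk" for x using that by force
    have "\<bar>disk_int 1 (\<lambda>x. g x * h x)\<bar> \<le> \<epsilon>" if "0 < \<epsilon>" for \<epsilon>
    proof -
      define \<delta> where "\<delta> = \<epsilon> / ((\<bar>B\<bar> + 1) * (4 * pi))"
      have "0 < \<delta>" using that by (auto simp: \<delta>_def intro!: divide_pos_pos mult_pos_pos)
      then obtain h' where h': "P h'" "\<forall>x\<in>unit_disk. \<bar>h x - h' x\<bar> < \<delta>" using ex by blast
      have c: "continuous_on unit_disk (\<lambda>x. g x * h x)" "continuous_on unit_disk (\<lambda>x. g x * h' x)"
        using g h h' by (auto simp: P_def continuous_on_mult)
      have "\<bar>disk_int 1 (\<lambda>x. g x * h x - g x * h' x)\<bar> \<le> ((\<bar>B\<bar> + 1) * \<delta>) * (4 * pi)"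
      proof (rule abs_disk_int_le)
        fix x assume x: "x \<in> unit_disk"
        have "\<bar>g x\<bar> * \<bar>h x - h' x\<bar> \<le> (\<bar>B\<bar> + 1) * \<delta>"
          using B[OF x] h'(2) x by (intro mult_mono) (auto simp: less_imp_le)
        then show "\<bar>g x * h x - g x * h' x\<bar> \<le> (\<bar>B\<bar> + 1) * \<delta>"
          by (simp flip: abs_mult right_diff_distrib)
      qed (use c \<open>0 < \<delta>\<close> in \<open>auto intro: continuous_on_diff\<close>)
      moreover have "((\<bar>B\<bar> + 1) * \<delta>) * (4 * pi) = \<epsilon>"
      proof -
        have "\<bar>B\<bar> + 1 \<noteq> 0" by linarith
        then show ?thesis by (simp add: \<delta>_def)
      qed
      ultimately show ?thesis
        using c h'(1) disk_int_diff[OF c, of 1] by (simp add: P_def)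
    qed
    then have "\<bar>disk_int 1 (\<lambda>x. g x * h x)\<bar> \<le> 0" by (rule field_le_epsilon) simp
    with h show "P h" by (simp add: P_def)
  qed
  then show ?thesis using disk_int_square_eq_0[OF g _ x] by (simp add: P_def)
qed

text \<open>The frequencies are k, k - 2, ..., -k, all of one parity. This is why k + 1 samples at
  spacing pi / (k + 1), which cover only half of the circle, determine such a function.\<close>

inductive trig_poly :: "nat \<Rightarrow> (real \<Rightarrow> complex) \<Rightarrow> bool" where
  trig_poly_cis: "m \<le> k \<Longrightarrow> trig_poly k (\<lambda>\<phi>. c * cis ((real k - 2 * real m) * \<phi>))"
| trig_poly_add: "trig_poly k P \<Longrightarrow> trig_poly k Q \<Longrightarrow> trig_poly k (\<lambda>\<phi>. P \<phi> + Q \<phi>)"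

lemma trig_poly_cmult: "trig_poly k Q \<Longrightarrow> trig_poly k (\<lambda>\<phi>. a * Q \<phi>)"
proof (induction rule: trig_poly.induct)
  case (trig_poly_cis m k c)
  then show ?case using trig_poly.trig_poly_cis[of m k "a * c"] by (simp add: mult.assoc)
next
  case (trig_poly_add k P Q)
  then show ?case using trig_poly.trig_poly_add by (simp add: distrib_left)
qed

lemma trig_poly_shift:
  assumes "trig_poly k Q"
  shows "trig_poly (Suc k) (\<lambda>\<phi>. cis \<phi> * Q \<phi>)" "trig_poly (Suc k) (\<lambda>\<phi>. cis (- \<phi>) * Q \<phi>)"
    "trig_poly (Suc (Suc k)) Q"
  using assms
proof (induction rule: trig_poly.induct)
  case (trig_poly_cis m k c)
  {
    case 1
    show ?case using trig_poly.trig_poly_cis[of m "Suc k" c] trig_poly_cis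
      by (simp add: mult.left_commute[of "cis _"] cis_mult algebra_simps)
  next
    case 2
    show ?case using trig_poly.trig_poly_cis[of "Suc m" "Suc k" c] trig_poly_cis
      by (simp add: mult.left_commute[of "cis _"] cis_mult algebra_simps)
  next
    case 3
    show ?case using trig_poly.trig_poly_cis[of "Suc m" "Suc (Suc k)" c] trig_poly_cis
      by (simp add: algebra_simps)
  }
next
  case (trig_poly_add k P Q)
  {
    case 1
    show ?case using trig_poly.trig_poly_add[OF trig_poly_add(3,6)] by (simp add: distrib_left)
  next
    case 2
    show ?case using trig_poly.trig_poly_add[OF trig_poly_add(4,7)] by (simp add: distrib_left)
  next
    case 3
    show ?case using trig_poly.trig_poly_add[OF trig_poly_add(5,8)] by simp
  }
qed

lemma inner_cis: "complex_of_real (cis \<phi> \<bullet> x) = (x * cis (- \<phi>) + cnj x * cis \<phi>) / 2"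
  by (simp add: complex_eq_iff inner_complex_def algebra_simps)

lemma trig_poly_chebU: "trig_poly k (\<lambda>\<phi>. of_real (poly (chebU k) (cis \<phi> \<bullet> x)))"
proof (induction k rule: induct_nat_012)
  case 0
  show ?case using trig_poly_cis[of 0 0 1] by simp
next
  case 1
  have "(\<lambda>\<phi>. of_real (poly (chebU (Suc 0)) (cis \<phi> \<bullet> x))) =
      (\<lambda>\<phi>. x * cis ((real 1 - 2 * real 1) * \<phi>) + cnj x * cis ((real 1 - 2 * real 0) * \<phi>))"
    using inner_cis[of _ x] by (simp add: fun_eq_iff mult.commute[of _ 2])
  then show ?case using trig_poly_add[OF trig_poly_cis[of 1 1 x] trig_poly_cis[of 0 1 "cnj x"]] by simp
next
  case (ge2 k)
  let ?U = "\<lambda>k \<phi>. complex_of_real (poly (chebU k) (cis \<phi> \<bullet> x))"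
  have "?U (Suc (Suc k)) = (\<lambda>\<phi>. (x * (cis (- \<phi>) * ?U (Suc k) \<phi>) + cnj x * (cis \<phi> * ?U (Suc k) \<phi>)) + (- 1) * ?U k \<phi>)"
  proof
    fix \<phi>
    have "?U (Suc (Suc k)) \<phi> = (2 * complex_of_real (cis \<phi> \<bullet> x)) * ?U (Suc k) \<phi> - ?U k \<phi>" by simp
    also have "2 * complex_of_real (cis \<phi> \<bullet> x) = x * cis (- \<phi>) + cnj x * cis \<phi>" unfolding inner_cis by simp
    finally show "?U (Suc (Suc k)) \<phi> = (x * (cis (- \<phi>) * ?U (Suc k) \<phi>) + cnj x * (cis \<phi> * ?U (Suc k) \<phi>)) + (- 1) * ?U k \<phi>"
      by (simp only: distrib_right mult.assoc) simp
  qed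
  moreover have "trig_poly (Suc (Suc k)) \<dots>"
    by (intro trig_poly_add trig_poly_cmult trig_poly_shift ge2)
  ultimately show ?case by (simp only:)
qed

text \<open>A Dirichlet kernel for the frequencies of \<open>trig_poly\<close>, which makes U_k
  their reproducing kernel.\<close>

lemma chebU_cos_cis: "complex_of_real (poly (chebU k) (cos \<beta>)) = (\<Sum>p\<le>k. cis ((real k - 2 * real p) * \<beta>))"
proof (induction k rule: induct_nat_012)
  case (ge2 k)
  have "(\<Sum>p\<le>Suc (Suc k). cis ((real (Suc (Suc k)) - 2 * real p) * \<beta>))
      = cis (real (Suc (Suc k)) * \<beta>) + (\<Sum>p\<le>k. cis ((real k - 2 * real p) * \<beta>)) + cis (- (real (Suc (Suc k)) * \<beta>))"
    by (subst sum.atMost_Suc_shift) (simp add: algebra_simps)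
  also have "\<dots> = complex_of_real (poly (chebU k + smult 2 (chebT (Suc (Suc k)))) (cos \<beta>))"
    unfolding ge2(1)[symmetric] poly_add poly_smult poly_chebT_cos by (simp add: complex_eq_iff)
  finally show ?case unfolding chebU_Suc_Suc by simp
qed (auto simp: complex_eq_iff)

lemma sum_cis_roots:
  fixes r :: int
  assumes "\<bar>r\<bar> < int n"
  shows "(\<Sum>j<n. cis (2 * pi * real_of_int r * real j / real n)) = (if r = 0 then of_nat n else 0)"
proof (cases "r = 0")
  case False
  have n: "n > 0" using assms by auto
  define z where "z = cis (2 * pi * real_of_int r / real n)"
  have pow: "z ^ j = cis (2 * pi * real_of_int r * real j / real n)" for j
    by (simp add: z_def Complex.DeMoivre mult_ac)
  have "z \<noteq> 1"
  proof
    assume "z = 1"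
    then have "cos (2 * pi * real_of_int r / real n) = 1" by (simp add: z_def complex_eq_iff)
    then obtain i :: int where "2 * pi * real_of_int r / real n = real_of_int i * 2 * pi"
      using cos_one_2pi_int by blast
    then have "real_of_int r = real_of_int (i * int n)" using n by (simp add: field_simps)
    then have "r = i * int n" by (simp only: of_int_eq_iff)
    then show False using assms False by (simp add: abs_mult)
  qed
  moreover have "z ^ n = 1"
    unfolding pow using n cis_multiple_2pi[of "real_of_int r"] by simp
  ultimately show ?thesis using False geometric_sum[of z n] by (simp flip: pow)
qed simp

definition ridge_dir :: "nat \<Rightarrow> nat \<Rightarrow> complex" where
  "ridge_dir k j = cis (pi * real j / real (Suc k))"

lemma norm_ridge_dir [simp]: "cmod (ridge_dir k j) = 1"
  by (simp add: ridge_dir_def)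

text \<open>Discrete orthogonality: two frequencies differ by 2 (p - m) with |p - m| \<le> k, and on
  the samples this is a character of order dividing k + 1 that is trivial only for p = m.\<close>

lemma trig_poly_reproduce:
  "trig_poly k Q \<Longrightarrow> (\<Sum>j\<le>k. of_real (poly (chebU k) (cis \<phi> \<bullet> ridge_dir k j)) * Q (pi * real j / real (Suc k)))
     = of_nat (Suc k) * Q \<phi>"
proof (induction rule: trig_poly.induct)
  case (trig_poly_cis m k c)
  let ?\<phi> = "\<lambda>j. pi * real j / real (Suc k)"
  have "cis \<phi> \<bullet> ridge_dir k j = cos (\<phi> - ?\<phi> j)" for j
    by (simp add: ridge_dir_def inner_complex_def cos_diff)
  then have "(\<Sum>j\<le>k. of_real (poly (chebU k) (cis \<phi> \<bullet> ridge_dir k j)) * (c * cis ((real k - 2 * real m) * ?\<phi> j)))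
      = (\<Sum>j\<le>k. \<Sum>p\<le>k. cis ((real k - 2 * real p) * (\<phi> - ?\<phi> j)) * (c * cis ((real k - 2 * real m) * ?\<phi> j)))"
    by (simp add: chebU_cos_cis sum_distrib_right)
  also have "\<dots> = (\<Sum>p\<le>k. \<Sum>j\<le>k. cis ((real k - 2 * real p) * (\<phi> - ?\<phi> j)) * (c * cis ((real k - 2 * real m) * ?\<phi> j)))"
    by (rule sum.swap)
  also have "\<dots> = (\<Sum>p\<le>k. c * cis ((real k - 2 * real p) * \<phi>) *
      (\<Sum>j<Suc k. cis (2 * pi * real_of_int (int p - int m) * real j / real (Suc k))))"
  proof (intro sum.cong refl)
    fix p
    have "cis ((real k - 2 * real p) * (\<phi> - ?\<phi> j)) * (c * cis ((real k - 2 * real m) * ?\<phi> j))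
        = c * cis ((real k - 2 * real p) * \<phi>) * cis (2 * pi * real_of_int (int p - int m) * real j / real (Suc k))" for j
    proof -
      have "(real k - 2 * real p) * (\<phi> - ?\<phi> j) + (real k - 2 * real m) * ?\<phi> j
          = (real k - 2 * real p) * \<phi> + 2 * (real p - real m) * ?\<phi> j"
        by (simp only: right_diff_distrib left_diff_distrib)
      also have "2 * (real p - real m) * ?\<phi> j = 2 * pi * real_of_int (int p - int m) * real j / real (Suc k)"
        by simp
      finally show ?thesis by (simp only: mult.assoc mult.left_commute[of "cis _" c] cis_mult)
    qed
    then show "(\<Sum>j\<le>k. cis ((real k - 2 * real p) * (\<phi> - ?\<phi> j)) * (c * cis ((real k - 2 * real m) * ?\<phi> j)))
        = c * cis ((real k - 2 * real p) * \<phi>) * (\<Sum>j<Suc k. cis (2 * pi * real_of_int (int p - int m) * real j / real (Suc k)))"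
      by (simp only: sum_distrib_left lessThan_Suc_atMost)
  qed
  also have "\<dots> = (\<Sum>p\<le>k. if p = m then c * cis ((real k - 2 * real m) * \<phi>) * of_nat (Suc k) else 0)"
  proof (intro sum.cong refl)
    fix p assume "p \<in> {..k}"
    then have "\<bar>int p - int m\<bar> < int (Suc k)" using trig_poly_cis by auto
    then show "c * cis ((real k - 2 * real p) * \<phi>) * (\<Sum>j<Suc k. cis (2 * pi * real_of_int (int p - int m) * real j / real (Suc k)))
        = (if p = m then c * cis ((real k - 2 * real m) * \<phi>) * of_nat (Suc k) else 0)"
      unfolding sum_cis_roots[OF \<open>\<bar>int p - int m\<bar> < int (Suc k)\<close>] by auto
  qed
  also have "\<dots> = of_nat (Suc k) * (c * cis ((real k - 2 * real m) * \<phi>))"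
    using trig_poly_cis by simp
  finally show ?case .
next
  case (trig_poly_add k P Q)
  then show ?case by (simp add: distrib_left sum.distrib)
qed

lemma chebU_reproduce:
  assumes "cmod w = 1"
  shows "(\<Sum>j\<le>k. poly (chebU k) (w \<bullet> ridge_dir k j) * poly (chebU k) (ridge_dir k j \<bullet> x)) = real (Suc k) * poly (chebU k) (w \<bullet> x)"
proof -
  have "w = cis (Arg w)" using assms rcis_cmod_Arg[of w] by (simp add: rcis_def)
  then obtain \<phi> where w: "w = cis \<phi>" by blast
  have "complex_of_real (\<Sum>j\<le>k. poly (chebU k) (w \<bullet> ridge_dir k j) * poly (chebU k) (ridge_dir k j \<bullet> x))
      = of_nat (Suc k) * of_real (poly (chebU k) (cis \<phi> \<bullet> x))"
    using trig_poly_reproduce[OF trig_poly_chebU[of k x], of \<phi>] by (simp add: w ridge_dir_def)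
  also have "\<dots> = complex_of_real (real (Suc k) * poly (chebU k) (w \<bullet> x))" by (simp add: w)
  finally show ?thesis by (simp only: of_real_eq_iff)
qed

section \<open>The Logan-Shepp expansion of a smooth function\<close>

lemma disk_int_uniform_limit:
  assumes F: "\<And>n. continuous_on unit_disk (F n)" and lim: "uniform_limit unit_disk F g sequentially" and v: "cmod v = 1"
  shows "(\<lambda>n. disk_int v (F n)) \<longlonglongrightarrow> disk_int v g"
proof (rule LIMSEQ_I)
  fix r :: real assume "0 < r"
  have g: "continuous_on unit_disk g"
    using F by (intro uniform_limit_theorem[OF _ lim]) auto
  define \<delta> where "\<delta> = r / (8 * pi)"
  have "0 < \<delta>" using \<open>0 < r\<close> by (simp add: \<delta>_def)
  then obtain N where N: "\<And>n x. N \<le> n \<Longrightarrow> x \<in> unit_disk \<Longrightarrow> dist (F n x) (g x) < \<delta>"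
    using lim unfolding uniform_limit_iff eventually_sequentially by blast
  have "norm (disk_int v (F n) - disk_int v g) < r" if "N \<le> n" for n
  proof -
    have "\<bar>disk_int v (\<lambda>x. F n x - g x)\<bar> \<le> \<delta> * (4 * pi)"
      using N[OF that] F g v \<open>0 < \<delta>\<close>
      by (intro abs_disk_int_le continuous_on_diff) (auto simp: dist_real_def less_imp_le)
    then show ?thesis using disk_int_diff[OF F g v] \<open>0 < r\<close> by (simp add: \<delta>_def)
  qed
  then show "\<exists>no. \<forall>n\<ge>no. norm (disk_int v (F n) - disk_int v g) < r" by blast
qed

text \<open>The divisor is dictated by two identities: for f(x) = U_k(<w, x>),
  \<open>disk_int_ridge_product\<close> makes the coefficient U_k(<w, u>) / (k + 1) with u the j-th
  direction, and \<open>chebU_reproduce\<close> sums these ridges back to f.\<close>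

definition ridge_coeff :: "(complex \<Rightarrow> real) \<Rightarrow> nat \<Rightarrow> nat \<Rightarrow> real" where
  "ridge_coeff f k j = disk_int 1 (\<lambda>x. f x * poly (chebU k) (ridge_dir k j \<bullet> x)) / (2 * pi)"

lemma abs_inner_unit_le: "cmod u = 1 \<Longrightarrow> x \<in> unit_disk \<Longrightarrow> \<bar>u \<bullet> x\<bar> \<le> 1"
  using Cauchy_Schwarz_ineq2[of u x] by simp

lemma summable_inverse_Suc_square: "summable (\<lambda>k. C / (real (Suc k))\<^sup>2)"
proof -
  have "summable (\<lambda>k. C * (1 / (real (Suc k))\<^sup>2))"
    using inverse_squares_sums by (intro summable_mult) (auto simp: sums_iff)
  then show ?thesis by simp
qed

text \<open>The Logan-Shepp expansion: the ridge polynomials \<open>U\<^sub>k(\<langle>u\<^sub>k\<^sub>j, x\<rangle>)\<close> with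
  \<open>u\<^sub>k\<^sub>j = exp (\<i> \<pi> j / (k + 1))\<close>, \<open>j \<le> k\<close>, form an orthogonal basis on the disk.\<close>

lemma ridge_expansion_sums:
  assumes f: "continuous_on unit_disk f"
    and decay: "\<And>k j. \<bar>ridge_coeff f k j\<bar> \<le> C / real (Suc k) ^ 4"
    and x: "x \<in> unit_disk"
  shows "(\<lambda>k. \<Sum>j\<le>k. ridge_coeff f k j * poly (chebU k) (ridge_dir k j \<bullet> x)) sums f x"
proof -
  define b where "b = ridge_coeff f"
  define F where "F = (\<lambda>k x. \<Sum>j\<le>k. b k j * poly (chebU k) (ridge_dir k j \<bullet> x))"
  define S where "S = (\<lambda>x. \<Sum>k. F k x)"
  have C: "0 \<le> C" using decay[of 0 0] by (simp add: order_trans[OF abs_ge_zero])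
  \<comment> \<open>Layer k has k + 1 summands with |U_k| \<le> k + 1, so decay of order 4 leaves a
    summable inverse square.\<close>
  have F_bound: "norm (F k x) \<le> C / (real (Suc k))\<^sup>2" if "x \<in> unit_disk" for k x
  proof -
    have "norm (F k x) \<le> (\<Sum>j\<le>k. C / real (Suc k) ^ 4 * real (Suc k))"
      unfolding F_def
    proof (intro order_trans[OF norm_sum] sum_mono)
      fix j
      have "\<bar>poly (chebU k) (ridge_dir k j \<bullet> x)\<bar> \<le> real k + 1"
        using that by (intro abs_poly_le_cheb_bounded[OF cheb_bounded_chebU] abs_inner_unit_le) auto
      then have "\<bar>b k j\<bar> * \<bar>poly (chebU k) (ridge_dir k j \<bullet> x)\<bar> \<le> C / real (Suc k) ^ 4 * real (Suc k)"
        unfolding b_def using decay C by (intro mult_mono) auto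
      then show "norm (b k j * poly (chebU k) (ridge_dir k j \<bullet> x)) \<le> C / real (Suc k) ^ 4 * real (Suc k)"
        by (simp add: abs_mult)
    qed
    also have "\<dots> = C / (real (Suc k))\<^sup>2"
    proof -
      have "n * (C / n ^ 4 * n) = C / n\<^sup>2" if "0 < n" for n
        using that by (simp add: power2_eq_square power4_eq_xxxx)
      from this[of "real (Suc k)"] show ?thesis by (simp only: sum_constant card_atMost of_nat_0_less_iff zero_less_Suc)
    qed
    finally show ?thesis .
  qed
  have unif: "uniform_limit unit_disk (\<lambda>n x. \<Sum>k<n. F k x) S sequentially"
    unfolding S_def using F_bound summable_inverse_Suc_square by (rule Weierstrass_m_test)
  have F_cont: "continuous_on unit_disk (F k)" for k
    unfolding F_def by (intro continuous_intros)
  have S: "continuous_on unit_disk S"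
    by (rule uniform_limit_theorem[OF _ unif]) (auto intro!: always_eventually continuous_on_sum F_cont)
  have "f x - S x = 0"
  proof (rule ridge_complete[OF _ _ x])
    show "continuous_on unit_disk (\<lambda>x. f x - S x)" using f S by (rule continuous_on_diff)
    fix w l assume w: "cmod w = 1"
    let ?U = "\<lambda>x. poly (chebU l) (w \<bullet> x)"
    \<comment> \<open>The coefficients of U_l(<w, x>) in the ridges of degree l, by
      \<open>chebU_reproduce\<close>.\<close>
    define r where "r = (\<lambda>j. poly (chebU l) (w \<bullet> ridge_dir l j) / real (Suc l))"
    have "uniform_limit unit_disk (\<lambda>n x. (\<Sum>k<n. F k x) * ?U x) (\<lambda>x. S x * ?U x) sequentially"
    proof (rule uniform_lim_mult[OF unif])
      show "uniform_limit unit_disk (\<lambda>_. ?U) ?U sequentially" by (auto simp: uniform_limit_iff)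
      show "bounded (S ` unit_disk)"
        using S by (intro compact_imp_bounded compact_continuous_image) auto
      show "bounded (?U ` unit_disk)"
        by (intro compact_imp_bounded compact_continuous_image continuous_on_ridge) auto
    qed
    then have "(\<lambda>n. disk_int w (\<lambda>x. (\<Sum>k<n. F k x) * ?U x)) \<longlonglongrightarrow> disk_int w (\<lambda>x. S x * ?U x)"
      using w by (intro disk_int_uniform_limit continuous_on_mult continuous_on_sum F_cont continuous_on_ridge)
    \<comment> \<open>Orthogonality of degrees leaves only layer l, so the sequence is constant from
      n = l + 1 on.\<close>
    moreover have "disk_int w (\<lambda>x. (\<Sum>k<n. F k x) * ?U x) = disk_int 1 (\<lambda>x. f x * ?U x)" if "l < n" for n
    proof -
      have "disk_int w (\<lambda>x. (\<Sum>k<n. F k x) * ?U x)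
          = disk_int w (\<lambda>x. \<Sum>k<n. \<Sum>j\<le>k. b k j * (poly (chebU k) (ridge_dir k j \<bullet> x) * ?U x))"
        by (simp add: F_def sum_distrib_right mult.assoc)
      also have "\<dots> = (\<Sum>k<n. \<Sum>j\<le>k. b k j * disk_int w (\<lambda>x. poly (chebU k) (ridge_dir k j \<bullet> x) * ?U x))"
        using w by (simp add: disk_int_sum disk_int_cmult continuous_on_sum continuous_on_mult continuous_on_ridge)
      also have "\<dots> = (\<Sum>k<n. if k = l then \<Sum>j\<le>l. b l j * (2 * pi * poly (chebU l) (w \<bullet> ridge_dir l j) / real (Suc l)) else 0)"
        using w by (intro sum.cong) (auto simp: disk_int_ridge_product)
      also have "\<dots> = (\<Sum>j\<le>l. b l j * (2 * pi * poly (chebU l) (w \<bullet> ridge_dir l j) / real (Suc l)))"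
        using that by simp
      also have "\<dots> = (\<Sum>j\<le>l. disk_int 1 (\<lambda>x. r j * (f x * poly (chebU l) (ridge_dir l j \<bullet> x))))"
        unfolding disk_int_cmult by (intro sum.cong) (auto simp: b_def ridge_coeff_def r_def)
      also have "\<dots> = disk_int 1 (\<lambda>x. \<Sum>j\<le>l. r j * (f x * poly (chebU l) (ridge_dir l j \<bullet> x)))"
        using f by (intro disk_int_sum[symmetric]) (auto intro!: continuous_on_mult continuous_on_ridge)
      also have "(\<lambda>x. \<Sum>j\<le>l. r j * (f x * poly (chebU l) (ridge_dir l j \<bullet> x))) = (\<lambda>x. f x * ?U x)"
      proof
        fix x
        have "(\<Sum>j\<le>l. r j * (f x * poly (chebU l) (ridge_dir l j \<bullet> x)))
            = f x * ((\<Sum>j\<le>l. poly (chebU l) (w \<bullet> ridge_dir l j) * poly (chebU l) (ridge_dir l j \<bullet> x)) / real (Suc l))"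
          unfolding r_def sum_divide_distrib sum_distrib_left by (intro sum.cong) auto
        then show "(\<Sum>j\<le>l. r j * (f x * poly (chebU l) (ridge_dir l j \<bullet> x))) = f x * ?U x"
          unfolding chebU_reproduce[OF w] by simp
      qed
      finally show ?thesis .
    qed
    then have "\<forall>\<^sub>F n in sequentially. disk_int w (\<lambda>x. (\<Sum>k<n. F k x) * ?U x) = disk_int 1 (\<lambda>x. f x * ?U x)"
      by (intro eventually_sequentiallyI[of "Suc l"]) auto
    then have "(\<lambda>n. disk_int w (\<lambda>x. (\<Sum>k<n. F k x) * ?U x)) \<longlonglongrightarrow> disk_int 1 (\<lambda>x. f x * ?U x)"
      by (rule tendsto_eventually)
    ultimately have "disk_int w (\<lambda>x. S x * ?U x) = disk_int 1 (\<lambda>x. f x * ?U x)"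
      by (rule LIMSEQ_unique)
    then have "disk_int 1 (\<lambda>x. S x * ?U x) = disk_int 1 (\<lambda>x. f x * ?U x)"
      using disk_int_rotate[OF w, of "\<lambda>x. S x * ?U x"] S by (simp add: continuous_on_mult continuous_on_ridge)
    then show "disk_int 1 (\<lambda>x. (f x - S x) * ?U x) = 0"
      using disk_int_diff[of "\<lambda>x. f x * ?U x" "\<lambda>x. S x * ?U x" 1] f S
      by (simp add: left_diff_distrib continuous_on_mult continuous_on_ridge)
  qed
  moreover have "(\<lambda>k. F k x) sums S x"
    using tendsto_uniform_limitI[OF unif x] by (simp add: sums_def)
  ultimately show ?thesis by (simp add: F_def b_def)
qed

section \<open>Smooth functions and the decay of their ridge coefficients\<close>

definition smooth_on_disk :: "(complex \<Rightarrow> real) \<Rightarrow> bool" where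
  "smooth_on_disk f \<longleftrightarrow> (\<forall>vs. \<forall>a\<in>unit_disk. total_deriv f vs differentiable (at a))"

lemma smooth_near_disk_imp: "smooth_near_disk f \<Longrightarrow> smooth_on_disk f"
  by (auto simp: smooth_near_disk_def smooth_on_disk_def)

lemma has_derivative_total_deriv:
  assumes "smooth_on_disk f" "a \<in> unit_disk"
  shows "(total_deriv f vs has_derivative (\<lambda>h. Re h * total_deriv f (1 # vs) a + Im h * total_deriv f (\<i> # vs) a)) (at a)"
    and "total_deriv f (v # vs) a = Re v * total_deriv f (1 # vs) a + Im v * total_deriv f (\<i> # vs) a"
proof -
  have "total_deriv f vs differentiable (at a)" using assms by (simp add: smooth_on_disk_def)
  then have D: "(total_deriv f vs has_derivative frechet_derivative (total_deriv f vs) (at a)) (at a)"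
    by (simp add: frechet_derivative_works)
  have eq: "frechet_derivative (total_deriv f vs) (at a) h = Re h * total_deriv f (1 # vs) a + Im h * total_deriv f (\<i> # vs) a" for h
  proof -
    have "h = Re h *\<^sub>R 1 + Im h *\<^sub>R \<i>" by (simp add: complex_eq_iff)
    then have "frechet_derivative (total_deriv f vs) (at a) h = frechet_derivative (total_deriv f vs) (at a) (Re h *\<^sub>R 1 + Im h *\<^sub>R \<i>)"
      by simp
    also have "\<dots> = Re h * frechet_derivative (total_deriv f vs) (at a) 1 + Im h * frechet_derivative (total_deriv f vs) (at a) \<i>"
      using has_derivative_linear[OF D] by (simp only: linear_add linear_scale real_scaleR_def)
    finally show ?thesis by simp
  qed
  show "(total_deriv f vs has_derivative (\<lambda>h. Re h * total_deriv f (1 # vs) a + Im h * total_deriv f (\<i> # vs) a)) (at a)"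
    using D unfolding eq[abs_def] .
  show "total_deriv f (v # vs) a = Re v * total_deriv f (1 # vs) a + Im v * total_deriv f (\<i> # vs) a"
    by (subst total_deriv.simps(2)) (rule eq)
qed

declare total_deriv.simps(2) [simp del]

lemma continuous_on_total_deriv:
  assumes "smooth_on_disk f"
  shows "continuous_on unit_disk (total_deriv f vs)"
  using has_derivative_continuous[OF has_derivative_total_deriv(1)[OF assms]]
  by (intro continuous_at_imp_continuous_on) auto

text \<open>The integrands of \<^const>\<open>disk_int\<close> as functions of the angle, closed under differentiation with
  bounds uniform in the parameters \<open>v\<close> and \<open>s\<close>.\<close>

inductive angular :: "(complex \<Rightarrow> real) \<Rightarrow> (complex \<times> real \<Rightarrow> real \<Rightarrow> real) \<Rightarrow> bool" for f where
  angular_deriv: "angular f (\<lambda>q \<theta>. total_deriv f vs (disk_point (fst q) (snd q, \<theta>)))"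
| angular_const: "(\<And>q. cmod (fst q) = 1 \<Longrightarrow> \<bar>snd q\<bar> \<le> 1 \<Longrightarrow> \<bar>c q\<bar> \<le> 1) \<Longrightarrow> angular f (\<lambda>q \<theta>. c q)"
| angular_cos: "angular f (\<lambda>q. cos)"
| angular_sin: "angular f (\<lambda>q. sin)"
| angular_add: "angular f g \<Longrightarrow> angular f h \<Longrightarrow> angular f (\<lambda>q \<theta>. g q \<theta> + h q \<theta>)"
| angular_mult: "angular f g \<Longrightarrow> angular f h \<Longrightarrow> angular f (\<lambda>q \<theta>. g q \<theta> * h q \<theta>)"

lemma angular_bounded:
  assumes "smooth_on_disk f" "angular f g"
  shows "\<exists>B. \<forall>q \<theta>. cmod (fst q) = 1 \<longrightarrow> \<bar>snd q\<bar> \<le> 1 \<longrightarrow> \<bar>g q \<theta>\<bar> \<le> B"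
  using assms(2)
proof (induction rule: angular.induct)
  case (angular_deriv vs)
  have "bounded (total_deriv f vs ` unit_disk)"
    using continuous_on_total_deriv[OF assms(1)] by (intro compact_imp_bounded compact_continuous_image) auto
  then obtain B where "\<forall>x\<in>unit_disk. \<bar>total_deriv f vs x\<bar> \<le> B" by (auto simp: bounded_iff)
  then show ?case using norm_disk_point_le by (intro exI[of _ B]) auto
next
  case (angular_add g h)
  then obtain A B where AB: "\<forall>q \<theta>. cmod (fst q) = 1 \<longrightarrow> \<bar>snd q\<bar> \<le> 1 \<longrightarrow> \<bar>g q \<theta>\<bar> \<le> A"
    "\<forall>q \<theta>. cmod (fst q) = 1 \<longrightarrow> \<bar>snd q\<bar> \<le> 1 \<longrightarrow> \<bar>h q \<theta>\<bar> \<le> B" by blast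
  show ?case
  proof (intro exI[of _ "A + B"] allI impI)
    fix q :: "complex \<times> real" and \<theta> assume q: "cmod (fst q) = 1" "\<bar>snd q\<bar> \<le> 1"
    show "\<bar>g q \<theta> + h q \<theta>\<bar> \<le> A + B"
      by (intro order_trans[OF abs_triangle_ineq] add_mono) (use AB q in blast)+
  qed
next
  case (angular_mult g h)
  then obtain A B where AB: "\<forall>q \<theta>. cmod (fst q) = 1 \<longrightarrow> \<bar>snd q\<bar> \<le> 1 \<longrightarrow> \<bar>g q \<theta>\<bar> \<le> A"
    "\<forall>q \<theta>. cmod (fst q) = 1 \<longrightarrow> \<bar>snd q\<bar> \<le> 1 \<longrightarrow> \<bar>h q \<theta>\<bar> \<le> B" by blast
  show ?case
  proof (intro exI[of _ "A * B"] allI impI)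
    fix q :: "complex \<times> real" and \<theta> assume q: "cmod (fst q) = 1" "\<bar>snd q\<bar> \<le> 1"
    then have "\<bar>g q \<theta>\<bar> \<le> A" "\<bar>h q \<theta>\<bar> \<le> B" using AB by blast+
    then show "\<bar>g q \<theta> * h q \<theta>\<bar> \<le> A * B"
      unfolding abs_mult by (intro mult_mono) auto
  qed
qed (auto intro: exI[of _ 1])

lemma angular_periodic: "angular f g \<Longrightarrow> g q (- pi) = g q pi"
  by (induction rule: angular.induct) (auto simp: disk_point_def)

lemma angular_has_derivative:
  assumes "smooth_on_disk f" "angular f g"
  shows "\<exists>g'. angular f g' \<and> (\<forall>q \<theta>. cmod (fst q) = 1 \<longrightarrow> \<bar>snd q\<bar> \<le> 1 \<longrightarrow> (g q has_field_derivative g' q \<theta>) (at \<theta>))"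
  using assms(2)
proof (induction rule: angular.induct)
  case (angular_deriv vs)
  \<comment> \<open>X and Y are the real and imaginary parts of the \<theta>-derivative of
    \<open>disk_point\<close>. Their coefficients are bounded by 1, as \<open>angular_const\<close>
    demands.\<close>
  define X where "X = (\<lambda>q :: complex \<times> real. \<lambda>\<theta>. (- Re (fst q)) * sin \<theta> + (- Im (fst q)) * (snd q * cos \<theta>))"
  define Y where "Y = (\<lambda>q :: complex \<times> real. \<lambda>\<theta>. (- Im (fst q)) * sin \<theta> + Re (fst q) * (snd q * cos \<theta>))"
  define g' where "g' = (\<lambda>q \<theta>. X q \<theta> * total_deriv f (1 # vs) (disk_point (fst q) (snd q, \<theta>))
      + Y q \<theta> * total_deriv f (\<i> # vs) (disk_point (fst q) (snd q, \<theta>)))"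
  have "angular f g'"
    unfolding g'_def X_def Y_def
    using abs_Re_le_cmod abs_Im_le_cmod by (intro angular.intros) (auto, metis+)
  moreover have "((\<lambda>\<theta>. total_deriv f vs (disk_point (fst q) (snd q, \<theta>))) has_field_derivative g' q \<theta>) (at \<theta>)"
    if "cmod (fst q) = 1" "\<bar>snd q\<bar> \<le> 1" for q \<theta>
  proof -
    have mem: "disk_point (fst q) (snd q, \<theta>) \<in> unit_disk" using norm_disk_point_le[OF that(2,1)] by simp
    have "((\<lambda>\<theta>. disk_point (fst q) (snd q, \<theta>)) has_vector_derivative fst q * Complex (- sin \<theta>) (snd q * cos \<theta>)) (at \<theta>)"
      unfolding disk_point_def Complex_eq fst_conv snd_conv
      by (auto intro!: derivative_eq_intros simp: has_vector_derivative_def scaleR_conv_of_real algebra_simps)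
    then have "((\<lambda>\<theta>. disk_point (fst q) (snd q, \<theta>)) has_derivative (\<lambda>t. t *\<^sub>R (fst q * Complex (- sin \<theta>) (snd q * cos \<theta>)))) (at \<theta>)"
      by (simp add: has_vector_derivative_def)
    from has_derivative_compose[OF this has_derivative_total_deriv(1)[OF assms(1) mem, of vs]]
    show ?thesis
      unfolding has_field_derivative_def g'_def X_def Y_def
      by (rule has_derivative_eq_rhs) (auto simp: fun_eq_iff algebra_simps)
  qed
  ultimately show ?case by blast
next
  case (angular_const c)
  show ?case by (intro exI[of _ "\<lambda>q \<theta>. 0"] conjI angular.angular_const) auto
next
  case angular_cos
  have "angular f (\<lambda>q \<theta>. (- 1) * sin \<theta>)" by (intro angular.intros) auto
  then show ?case by (intro exI[of _ "\<lambda>q \<theta>. (- 1) * sin \<theta>"]) (auto intro!: derivative_eq_intros)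
next
  case angular_sin
  then show ?case using angular.angular_cos by (intro exI[of _ "\<lambda>q. cos"]) (auto intro!: derivative_eq_intros)
next
  case (angular_add g h)
  then obtain g' h' where "angular f g'" "angular f h'"
    "\<forall>q \<theta>. cmod (fst q) = 1 \<longrightarrow> \<bar>snd q\<bar> \<le> 1 \<longrightarrow> (g q has_field_derivative g' q \<theta>) (at \<theta>)"
    "\<forall>q \<theta>. cmod (fst q) = 1 \<longrightarrow> \<bar>snd q\<bar> \<le> 1 \<longrightarrow> (h q has_field_derivative h' q \<theta>) (at \<theta>)" by blast
  then show ?case
    by (intro exI[of _ "\<lambda>q \<theta>. g' q \<theta> + h' q \<theta>"] conjI angular.angular_add allI impI DERIV_add) auto
next
  case (angular_mult g h)
  then obtain g' h' where *: "angular f g'" "angular f h'"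
    "\<forall>q \<theta>. cmod (fst q) = 1 \<longrightarrow> \<bar>snd q\<bar> \<le> 1 \<longrightarrow> (g q has_field_derivative g' q \<theta>) (at \<theta>)"
    "\<forall>q \<theta>. cmod (fst q) = 1 \<longrightarrow> \<bar>snd q\<bar> \<le> 1 \<longrightarrow> (h q has_field_derivative h' q \<theta>) (at \<theta>)" by blast
  show ?case
  proof (intro exI[of _ "\<lambda>q \<theta>. g' q \<theta> * h q \<theta> + h' q \<theta> * g q \<theta>"] conjI allI impI)
    show "angular f (\<lambda>q \<theta>. g' q \<theta> * h q \<theta> + h' q \<theta> * g q \<theta>)"
      using * angular_mult by (intro angular.angular_add angular.angular_mult) auto
  qed (use * in \<open>auto intro!: DERIV_mult\<close>)
qed

lemma angular_continuous:
  assumes "smooth_on_disk f" "angular f g" "cmod (fst q) = 1" "\<bar>snd q\<bar> \<le> 1"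
  shows "continuous_on A (g q)"
  using angular_has_derivative[OF assms(1,2)] assms(3,4)
  by (meson DERIV_isCont continuous_at_imp_continuous_on)

text \<open>Integration by parts gains 1 / n, and periodicity cancels the boundary terms. The
  induction ranges over all angular functions because the derivative is again one; the uniform
  bounds of the class make C independent of v and s.\<close>

lemma angular_fourier_decay:
  assumes f: "smooth_on_disk f" and g: "angular f g"
  shows "\<exists>C. \<forall>q n. cmod (fst q) = 1 \<longrightarrow> \<bar>snd q\<bar> \<le> 1 \<longrightarrow> 0 < n \<longrightarrow>
     cmod (integral {- pi..pi} (\<lambda>\<theta>. of_real (g q \<theta>) * cis (real n * \<theta>))) \<le> C / real n ^ M"
  using g
proof (induction M arbitrary: g)
  case 0
  then obtain B where B: "\<And>q \<theta>. cmod (fst q) = 1 \<Longrightarrow> \<bar>snd q\<bar> \<le> 1 \<Longrightarrow> \<bar>g q \<theta>\<bar> \<le> B"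
    using angular_bounded[OF f] by blast
  show ?case
  proof (intro exI[of _ "B * (2 * pi)"] allI impI)
    fix q :: "complex \<times> real" and n :: nat assume q: "cmod (fst q) = 1" "\<bar>snd q\<bar> \<le> 1"
    have "cmod (integral {- pi..pi} (\<lambda>\<theta>. of_real (g q \<theta>) * cis (real n * \<theta>))) \<le> B * (pi - - pi)"
    proof (rule integral_bound)
      show "continuous_on {- pi..pi} (\<lambda>\<theta>. complex_of_real (g q \<theta>) * cis (real n * \<theta>))"
        using angular_continuous[OF f 0 q] unfolding cis_conv_exp by (intro continuous_intros) auto
    qed (use B[OF q] in \<open>auto simp: norm_mult\<close>)
    then show "cmod (integral {- pi..pi} (\<lambda>\<theta>. of_real (g q \<theta>) * cis (real n * \<theta>))) \<le> B * (2 * pi) / real n ^ 0"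
      by simp
  qed
next
  case (Suc M)
  obtain g' where g': "angular f g'"
    "\<And>q \<theta>. cmod (fst q) = 1 \<Longrightarrow> \<bar>snd q\<bar> \<le> 1 \<Longrightarrow> (g q has_field_derivative g' q \<theta>) (at \<theta>)"
    using angular_has_derivative[OF f Suc.prems] by blast
  obtain C where C: "\<And>q n. cmod (fst q) = 1 \<Longrightarrow> \<bar>snd q\<bar> \<le> 1 \<Longrightarrow> 0 < n \<Longrightarrow>
     cmod (integral {- pi..pi} (\<lambda>\<theta>. of_real (g' q \<theta>) * cis (real n * \<theta>))) \<le> C / real n ^ M"
    using Suc.IH[OF g'(1)] by blast
  show ?case
  proof (intro exI[of _ C] allI impI)
    fix q :: "complex \<times> real" and n :: nat assume q: "cmod (fst q) = 1" "\<bar>snd q\<bar> \<le> 1" and n: "0 < n"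
    let ?A = "\<lambda>\<theta>. of_real (g' q \<theta>) * cis (real n * \<theta>)"
    let ?B = "\<lambda>\<theta>. of_real (g q \<theta>) * cis (real n * \<theta>)"
    have cont: "?A integrable_on {- pi..pi}" "?B integrable_on {- pi..pi}"
      using angular_continuous[OF f Suc.prems q] angular_continuous[OF f g'(1) q]
      unfolding cis_conv_exp by (auto intro!: integrable_continuous_real continuous_intros)
    have "((\<lambda>\<theta>. ?A \<theta> + \<i> * of_nat n * ?B \<theta>) has_integral (?B pi - ?B (- pi))) {- pi..pi}"
    proof (rule fundamental_theorem_of_calculus)
      fix \<theta>
      have "(?B has_vector_derivative (?A \<theta> + \<i> * of_nat n * ?B \<theta>)) (at \<theta>)"
      proof -
        have "(g q has_vector_derivative g' q \<theta>) (at \<theta>)"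
          using g'(2)[OF q] by (simp add: has_real_derivative_iff_has_vector_derivative)
        then have 1: "((\<lambda>\<theta>. complex_of_real (g q \<theta>)) has_vector_derivative of_real (g' q \<theta>)) (at \<theta>)"
          by (rule bounded_linear.has_vector_derivative[OF bounded_linear_of_real])
        have 2: "((\<lambda>\<theta>. cis (real n * \<theta>)) has_vector_derivative (\<i> * of_nat n * cis (real n * \<theta>))) (at \<theta>)"
        proof -
          have "((\<lambda>\<theta>. \<i> * of_real (real n * \<theta>)) has_vector_derivative \<i> * of_nat n) (at \<theta>)"
            by (auto intro!: derivative_eq_intros simp: has_vector_derivative_def scaleR_conv_of_real algebra_simps)
          from field_vector_diff_chain_at[OF this DERIV_exp]
          show ?thesis by (simp add: cis_conv_exp comp_def)
        qed
        show ?thesis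
          using has_vector_derivative_mult[OF 1 2] by (simp add: algebra_simps)
      qed
      then show "(?B has_vector_derivative (?A \<theta> + \<i> * of_nat n * ?B \<theta>)) (at \<theta> within {- pi..pi})"
        by (rule has_vector_derivative_at_within)
    qed simp
    moreover have "?B pi - ?B (- pi) = 0"
      using angular_periodic[OF Suc.prems, of q] by (simp add: complex_eq_iff)
    ultimately have "integral {- pi..pi} (\<lambda>\<theta>. ?A \<theta> + \<i> * of_nat n * ?B \<theta>) = 0"
      by (simp add: integral_unique)
    moreover have "integral {- pi..pi} (\<lambda>\<theta>. ?A \<theta> + \<i> * of_nat n * ?B \<theta>)
        = integral {- pi..pi} ?A + integral {- pi..pi} (\<lambda>\<theta>. \<i> * of_nat n * ?B \<theta>)"
      using cont by (intro integral_add integrable_on_mult_right)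
    ultimately have "integral {- pi..pi} ?A = - (\<i> * of_nat n * integral {- pi..pi} ?B)"
      by (simp add: eq_neg_iff_add_eq_0)
    then have "real n * cmod (integral {- pi..pi} ?B) = cmod (integral {- pi..pi} ?A)"
      by (simp add: norm_mult)
    also have "\<dots> \<le> C / real n ^ M" by (rule C[OF q n])
    finally show "cmod (integral {- pi..pi} ?B) \<le> C / real n ^ Suc M"
      using n by (simp add: field_simps)
  qed
qed

text \<open>Rotated to the direction of the ridge, U_k combines with one factor sin \<theta> of the
  weight to sin((k + 1) \<theta>). The other factor stays with f, and the integral over \<theta>
  becomes a Fourier coefficient of an angular function for each s.\<close>

lemma ridge_coeff_decay:
  assumes f: "smooth_on_disk f"
  shows "\<exists>C. \<forall>k j. \<bar>ridge_coeff f k j\<bar> \<le> C / real (Suc k) ^ M"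
proof -
  have ang: "angular f (\<lambda>q \<theta>. total_deriv f [] (disk_point (fst q) (snd q, \<theta>)) * sin \<theta>)"
    by (intro angular.intros)
  obtain C where C: "\<And>q n. cmod (fst q) = 1 \<Longrightarrow> \<bar>snd q\<bar> \<le> 1 \<Longrightarrow> 0 < n \<Longrightarrow>
     cmod (integral {- pi..pi} (\<lambda>\<theta>. of_real (f (disk_point (fst q) (snd q, \<theta>)) * sin \<theta>) * cis (real n * \<theta>))) \<le> C / real n ^ M"
    using angular_fourier_decay[OF f ang, of M] by auto
  have fc: "continuous_on unit_disk f" using continuous_on_total_deriv[OF f, of "[]"] by simp
  show ?thesis
  proof (intro exI[of _ "C / pi"] allI)
    fix k j
    let ?v = "ridge_dir k j" and ?n = "Suc k"
    let ?U = "\<lambda>x. poly (chebU k) (?v \<bullet> x)"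
    define F where "F = (\<lambda>s \<theta>. f (disk_point ?v (s, \<theta>)) * sin \<theta> * sin (real ?n * \<theta>))"
    have vv: "?v \<bullet> disk_point ?v (s, \<theta>) = cos \<theta>" for s \<theta>
    proof -
      have "?v \<bullet> (?v * z) = Re z" for z
        using unit_mult_cnj(2)[of ?v] unfolding inner_eq_Re_cnj_mult by (simp flip: mult.assoc)
      then show ?thesis by (simp add: disk_point_def)
    qed
    have cont: "continuous_on param_box (\<lambda>(s, \<theta>). F s \<theta>)"
    proof -
      have "continuous_on param_box (\<lambda>p. f (disk_point ?v p) * sin (snd p) * sin (real ?n * snd p))"
        by (intro continuous_intros continuous_on_compose2[OF fc] continuous_on_disk_point)
           (auto intro: disk_point_in_disk)
      then show ?thesis by (simp add: F_def split_beta)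
    qed
    have "disk_int 1 (\<lambda>x. f x * ?U x) = disk_int ?v (\<lambda>x. f x * ?U x)"
      using fc by (intro disk_int_rotate[symmetric] continuous_on_mult continuous_on_ridge) auto
    also have "\<dots> = integral param_box (\<lambda>(s, \<theta>). F s \<theta>)"
      unfolding disk_int_def
    proof (intro integral_cong)
      fix p :: "real \<times> real"
      obtain s \<theta> where p: "p = (s, \<theta>)" by force
      show "f (disk_point ?v p) * ?U (disk_point ?v p) * (sin (snd p))\<^sup>2 = (case p of (s, \<theta>) \<Rightarrow> F s \<theta>)"
        unfolding p F_def vv prod.case snd_conv sin_poly_chebU[symmetric] power2_eq_square by (simp only: ac_simps)
    qed
    also have "\<dots> = integral (cbox (- 1) 1) (\<lambda>s. integral (cbox (- pi) pi) (F s))"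
      using integral_prod_continuous[OF cont] by simp
    finally have eq: "disk_int 1 (\<lambda>x. f x * ?U x) = integral {- 1..1} (\<lambda>s. integral {- pi..pi} (F s))" by simp
    have "norm (integral {- 1..1} (\<lambda>s. integral {- pi..pi} (F s))) \<le> C / real ?n ^ M * (1 - - 1)"
    proof (rule integral_bound)
      show "continuous_on {- 1..1} (\<lambda>s. integral {- pi..pi} (F s))"
        using integral_continuous_on_param[of "{- 1..1}" "- pi" pi F] cont by (simp add: cbox_Pair_eq)
      fix s :: real assume s: "s \<in> {- 1..1}"
      let ?G = "\<lambda>\<theta>. of_real (f (disk_point ?v (s, \<theta>)) * sin \<theta>) * cis (real ?n * \<theta>)"
      have int: "?G integrable_on {- pi..pi}"
      proof -
        have c: "continuous_on {- pi..pi} (\<lambda>\<theta>. f (disk_point ?v (s, \<theta>)) * sin \<theta>)"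
          using angular_continuous[OF f ang, of "(?v, s)"] s by (simp add: abs_le_iff)
        show ?thesis
          unfolding cis_conv_exp
          by (intro integrable_continuous_real continuous_on_mult[OF continuous_on_of_real[OF c]] continuous_intros)
      qed
      have "integral {- pi..pi} (F s) = integral {- pi..pi} (Im \<circ> ?G)"
        by (intro integral_cong) (simp add: F_def)
      also have "\<dots> = Im (integral {- pi..pi} ?G)"
        by (rule integral_linear[OF int bounded_linear_Im])
      also have "\<bar>\<dots>\<bar> \<le> cmod (integral {- pi..pi} ?G)" by (rule abs_Im_le_cmod)
      also have "\<dots> \<le> C / real ?n ^ M" using C[of "(?v, s)" ?n] s by (simp add: abs_le_iff)
      finally show "norm (integral {- pi..pi} (F s)) \<le> C / real ?n ^ M" by simp
    qed simp
    then show "\<bar>ridge_coeff f k j\<bar> \<le> C / pi / real (Suc k) ^ M"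
      unfolding ridge_coeff_def eq by (simp add: field_simps)
  qed
qed

section \<open>Convergence\<close>

text \<open>Weights and polynomials are parameters so that f, its derivatives and the terms of the
  series are treated alike: a derivative in direction h multiplies the weight by <u, h> and
  differentiates the polynomial.\<close>

definition ridge_layer :: "(nat \<Rightarrow> nat \<Rightarrow> real) \<Rightarrow> (nat \<Rightarrow> nat \<Rightarrow> real poly) \<Rightarrow> nat \<Rightarrow> complex \<Rightarrow> real" where
  "ridge_layer w p k x = (\<Sum>j\<le>k. w k j * poly (p k j) (ridge_dir k j \<bullet> x))"

abbreviation ridge_series :: "(nat \<Rightarrow> nat \<Rightarrow> real) \<Rightarrow> (nat \<Rightarrow> nat \<Rightarrow> real poly) \<Rightarrow> complex \<Rightarrow> real" where
  "ridge_series w p x \<equiv> \<Sum>k. ridge_layer w p k x"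

text \<open>The exponent 3 leaves a summable inverse square after adding the k + 1 ridges of a
  layer.\<close>

definition ridge_bounded ::
    "real \<Rightarrow> (nat \<Rightarrow> nat \<Rightarrow> real) \<Rightarrow> (nat \<Rightarrow> nat \<Rightarrow> real poly) \<Rightarrow> bool" where
  "ridge_bounded R w p \<longleftrightarrow>
     (\<exists>C. \<forall>k j t. \<bar>t\<bar> \<le> R \<longrightarrow> \<bar>w k j\<bar> * \<bar>poly (p k j) t\<bar> \<le> C / real (Suc k) ^ 3)"

lemma abs_inner_ridge_dir_le: "\<bar>ridge_dir k j \<bullet> x\<bar> \<le> cmod x"
  using Cauchy_Schwarz_ineq2[of "ridge_dir k j" x] by simp

lemma abs_ridge_layer_le:
  assumes "\<And>j. j \<le> k \<Longrightarrow> \<bar>w k j\<bar> * \<bar>poly (p k j) (ridge_dir k j \<bullet> x)\<bar> \<le> C / real (Suc k) ^ 3"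
  shows "\<bar>ridge_layer w p k x\<bar> \<le> C / (real (Suc k))\<^sup>2"
proof -
  have "\<bar>ridge_layer w p k x\<bar> \<le> (\<Sum>j\<le>k. C / real (Suc k) ^ 3)"
    unfolding ridge_layer_def using assms by (intro order_trans[OF sum_abs] sum_mono) (auto simp: abs_mult)
  also have "\<dots> = C / (real (Suc k))\<^sup>2"
  proof -
    have "n * (C / n ^ 3) = C / n\<^sup>2" if "0 < n" for n
      using that by (simp add: power2_eq_square power3_eq_cube)
    from this[of "real (Suc k)"] show ?thesis by (simp only: sum_constant card_atMost of_nat_0_less_iff zero_less_Suc)
  qed
  finally show ?thesis .
qed

lemma ridge_bounded_layer:
  assumes "ridge_bounded R w p"
  obtains C where "\<And>k x. cmod x \<le> R \<Longrightarrow> \<bar>ridge_layer w p k x\<bar> \<le> C / (real (Suc k))\<^sup>2"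
proof -
  obtain C where "\<And>k j t. \<bar>t\<bar> \<le> R \<Longrightarrow> \<bar>w k j\<bar> * \<bar>poly (p k j) t\<bar> \<le> C / real (Suc k) ^ 3"
    using assms unfolding ridge_bounded_def by blast
  then show ?thesis
    using abs_inner_ridge_dir_le order_trans by (intro that[of C] abs_ridge_layer_le) blast
qed

lemma ridge_bounded_summable:
  assumes "ridge_bounded R w p" "cmod x \<le> R"
  shows "summable (\<lambda>k. ridge_layer w p k x)"
proof -
  obtain C where C: "\<And>k x. cmod x \<le> R \<Longrightarrow> \<bar>ridge_layer w p k x\<bar> \<le> C / (real (Suc k))\<^sup>2"
    using ridge_bounded_layer[OF assms(1)] by blast
  show ?thesis
    by (rule summable_comparison_test'[OF summable_inverse_Suc_square[of C], of 0]) (use C assms(2) in auto)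
qed

lemma continuous_on_ridge_series:
  assumes "ridge_bounded R w p"
  shows "continuous_on (cball 0 R) (ridge_series w p)"
proof -
  obtain C where C: "\<And>k x. cmod x \<le> R \<Longrightarrow> \<bar>ridge_layer w p k x\<bar> \<le> C / (real (Suc k))\<^sup>2"
    using ridge_bounded_layer[OF assms] by blast
  have "uniform_limit (cball 0 R) (\<lambda>n x. \<Sum>k<n. ridge_layer w p k x) (ridge_series w p) sequentially"
    by (rule Weierstrass_m_test[OF _ summable_inverse_Suc_square[of C]]) (use C in auto)
  then show ?thesis
    by (rule uniform_limit_theorem[rotated])
       (auto intro!: always_eventually continuous_intros simp: ridge_layer_def)
qed

lemma suminf_tail_bound:
  fixes a M :: "nat \<Rightarrow> real"
  assumes "\<And>k. \<bar>a k\<bar> \<le> M k" "summable M"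
  shows "\<bar>(\<Sum>k<n. a k) - suminf a\<bar> \<le> (\<Sum>k. M (k + n))"
proof -
  have a: "summable a" by (rule summable_comparison_test'[OF assms(2), of 0]) (use assms(1) in auto)
  have M': "summable (\<lambda>k. M (k + n))" using assms(2) by (rule summable_ignore_initial_segment)
  have "suminf a = (\<Sum>k. a (k + n)) + (\<Sum>k<n. a k)" by (rule suminf_split_initial_segment[OF a])
  moreover have "norm (\<Sum>k. a (k + n)) \<le> (\<Sum>k. M (k + n))"
    by (rule norm_suminf_le[OF _ M']) (use assms(1) in auto)
  ultimately show ?thesis by simp
qed

text \<open>Termwise differentiation by uniform convergence of the differentiated layers. The radius
  is 1 for the expansion of f and 2 for the terms of the series.\<close>

lemma ridge_series_has_derivative:
  assumes p: "ridge_bounded R w p" and p': "ridge_bounded R w (\<lambda>k j. pderiv (p k j))"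
    and x: "x \<in> ball 0 R"
  shows "(ridge_series w p has_derivative
    (\<lambda>h. ridge_series (\<lambda>k j. w k j * (ridge_dir k j \<bullet> h)) (\<lambda>k j. pderiv (p k j)) x)) (at x)"
proof -
  define D where "D = (\<lambda>k x h. ridge_layer (\<lambda>k j. w k j * (ridge_dir k j \<bullet> h)) (\<lambda>k j. pderiv (p k j)) k x)"
  obtain C where C: "\<And>k j t. \<bar>t\<bar> \<le> R \<Longrightarrow> \<bar>w k j\<bar> * \<bar>poly (pderiv (p k j)) t\<bar> \<le> C / real (Suc k) ^ 3"
    using p' unfolding ridge_bounded_def by blast
  have D: "\<bar>D k x h\<bar> \<le> (C / (real (Suc k))\<^sup>2) * norm h" if "x \<in> ball 0 R" for k x h
  proof -
    have "\<bar>w k j * (ridge_dir k j \<bullet> h)\<bar> * \<bar>poly (pderiv (p k j)) (ridge_dir k j \<bullet> x)\<bar> \<le> (C * norm h) / real (Suc k) ^ 3" for j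
    proof -
      have "\<bar>ridge_dir k j \<bullet> x\<bar> \<le> R" using abs_inner_ridge_dir_le[of k j x] that by simp
      then have "(\<bar>w k j\<bar> * \<bar>poly (pderiv (p k j)) (ridge_dir k j \<bullet> x)\<bar>) * \<bar>ridge_dir k j \<bullet> h\<bar>
          \<le> (C / real (Suc k) ^ 3) * norm h"
        using C[of "ridge_dir k j \<bullet> x" k j] abs_inner_ridge_dir_le[of k j h]
        by (intro mult_mono) (auto intro: order_trans[rotated])
      then show ?thesis by (simp add: abs_mult mult_ac)
    qed
    then have "\<bar>D k x h\<bar> \<le> C * norm h / (real (Suc k))\<^sup>2" unfolding D_def by (rule abs_ridge_layer_le)
    then show ?thesis by simp
  qed
  have "\<exists>g. \<forall>x\<in>ball 0 R. (\<lambda>k. ridge_layer w p k x) sums g x \<and> (g has_derivative (\<lambda>h. \<Sum>k. D k x h)) (at x within ball 0 R)"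
  proof (rule has_derivative_series[where f' = D])
    show "(ridge_layer w p k has_derivative D k x) (at x within ball 0 R)" for k x
    proof -
      have "((\<lambda>x. poly (p k j) (ridge_dir k j \<bullet> x)) has_derivative
          (\<lambda>h. (ridge_dir k j \<bullet> h) * poly (pderiv (p k j)) (ridge_dir k j \<bullet> x))) (at x within ball 0 R)" for j
      proof -
        have "((\<lambda>x. ridge_dir k j \<bullet> x) has_derivative (\<lambda>h. ridge_dir k j \<bullet> h)) (at x within ball 0 R)"
          by (auto intro!: derivative_eq_intros)
        from has_derivative_compose[OF this, of "poly (p k j)" "\<lambda>h. h * poly (pderiv (p k j)) (ridge_dir k j \<bullet> x)"]
        show ?thesis using poly_DERIV[of "p k j" "ridge_dir k j \<bullet> x"]
          by (simp add: has_field_derivative_def mult.commute[of _ "poly _ _"])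
      qed
      then show ?thesis
        unfolding ridge_layer_def[abs_def] D_def
        by (auto intro!: has_derivative_eq_rhs[OF has_derivative_sum[OF has_derivative_mult_right]] simp: mult_ac)
    qed
    show "\<forall>\<^sub>F n in sequentially. \<forall>x\<in>ball 0 R. \<forall>h. norm ((\<Sum>k<n. D k x h) - (\<Sum>k. D k x h)) \<le> \<epsilon> * norm h"
      if eps: "0 < \<epsilon>" for \<epsilon>
    proof -
      obtain N where N: "\<And>n. N \<le> n \<Longrightarrow> norm (\<Sum>k. C / (real (Suc (k + n)))\<^sup>2) < \<epsilon>"
        using suminf_exist_split[OF eps summable_inverse_Suc_square[of C]] by blast
      have "norm ((\<Sum>k<n. D k x h) - (\<Sum>k. D k x h)) \<le> \<epsilon> * norm h" if "N \<le> n" "x \<in> ball 0 R" for n x h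
      proof -
        have "norm ((\<Sum>k<n. D k x h) - (\<Sum>k. D k x h)) \<le> (\<Sum>k. (C / (real (Suc (k + n)))\<^sup>2) * norm h)"
          unfolding real_norm_def
          by (rule suminf_tail_bound[OF D[OF that(2)] summable_mult2[OF summable_inverse_Suc_square]])
        also have "\<dots> = (\<Sum>k. C / (real (Suc (k + n)))\<^sup>2) * norm h"
          by (rule suminf_mult2[symmetric, OF summable_ignore_initial_segment[OF summable_inverse_Suc_square]])
        also have "\<dots> \<le> \<epsilon> * norm h" using N[OF that(1)] by (intro mult_right_mono) auto
        finally show ?thesis .
      qed
      then show ?thesis by (intro eventually_sequentiallyI[of N]) blast
    qed
    show "0 \<in> ball 0 R" using x by (auto intro: le_less_trans[OF norm_ge_zero])
    then have "0 \<le> R" by simp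
    then show "(\<lambda>k. ridge_layer w p k 0) sums ridge_series w p 0"
      using ridge_bounded_summable[OF p, of 0] by (simp add: summable_sums)
  qed simp
  then obtain g where g: "\<And>x. x \<in> ball 0 R \<Longrightarrow> (\<lambda>k. ridge_layer w p k x) sums g x"
    "\<And>x. x \<in> ball 0 R \<Longrightarrow> (g has_derivative (\<lambda>h. \<Sum>k. D k x h)) (at x within ball 0 R)" by blast
  have "(g has_derivative (\<lambda>h. \<Sum>k. D k x h)) (at x)"
    using g(2)[OF x] x by (simp add: at_within_open[OF x open_ball])
  moreover have "g y = ridge_series w p y" if "y \<in> ball 0 R" for y using g(1)[OF that] by (simp add: sums_iff)
  ultimately have "(ridge_series w p has_derivative (\<lambda>h. \<Sum>k. D k x h)) (at x)"
    by (rule has_derivative_transform_within_open[OF _ open_ball x])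
  then show ?thesis by (simp only: D_def)
qed

section \<open>Iterated partial derivatives\<close>

lemma partial_eqI:
  assumes S: "open S" "x \<in> S" "\<And>y. y \<in> S \<Longrightarrow> g y = H y" and H: "(H has_derivative H') (at x)"
  shows "partial1 g x = H' 1" "partial2 g x = H' \<i>"
proof -
  have g: "(g has_derivative H') (at x)"
    using has_derivative_transform_within_open[OF H S(1,2)] S(3) by metis
  have lin: "linear H'" by (rule has_derivative_linear[OF H])
  have "((\<lambda>s. Complex s (Im x)) has_derivative (\<lambda>s. s *\<^sub>R 1)) (at (Re x))"
    unfolding Complex_eq by (auto intro!: derivative_eq_intros simp: scaleR_conv_of_real)
  from has_derivative_compose[OF this, of g H'] g
  have "((\<lambda>s. g (Complex s (Im x))) has_derivative (\<lambda>s. s * H' 1)) (at (Re x))"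
    using lin by (simp add: linear_scale del: scaleR_right_distrib)
  then show "partial1 g x = H' 1" unfolding partial1_def
    by (intro DERIV_imp_deriv) (simp add: has_field_derivative_def mult_commute_abs)
  have "((\<lambda>s. Complex (Re x) s) has_derivative (\<lambda>s. s *\<^sub>R \<i>)) (at (Im x))"
    unfolding Complex_eq by (auto intro!: derivative_eq_intros simp: scaleR_conv_of_real mult.commute)
  from has_derivative_compose[OF this, of g H'] g
  have "((\<lambda>s. g (Complex (Re x) s)) has_derivative (\<lambda>s. s * H' \<i>)) (at (Im x))"
    using lin by (simp add: linear_scale)
  then show "partial2 g x = H' \<i>" unfolding partial2_def
    by (intro DERIV_imp_deriv) (simp add: has_field_derivative_def mult_commute_abs)
qed

text \<open>\<open>deriv\<close> looks at a neighbourhood, so the formula for each partial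
  derivative must hold on an open set before the next one is taken. The second variable is
  differentiated first, whence its rule is stated for m = 0.\<close>

lemma partial_multi_eqI:
  assumes S: "open S" and h: "\<And>x. x \<in> S \<Longrightarrow> h x = G 0 0 x"
    and 1: "\<And>m n x. x \<in> S \<Longrightarrow> \<exists>D. (G m n has_derivative D) (at x) \<and> D 1 = G (Suc m) n x"
    and 2: "\<And>n x. x \<in> S \<Longrightarrow> \<exists>D. (G 0 n has_derivative D) (at x) \<and> D \<i> = G 0 (Suc n) x"
    and x: "x \<in> S"
  shows "partial_multi (m, n) h x = G m n x"
proof -
  have b: "\<forall>x\<in>S. (partial2 ^^ n) h x = G 0 n x"
  proof (induction n)
    case (Suc n)
    show ?case
    proof
      fix x assume "x \<in> S"
      with 2[of x n] partial_eqI(2)[OF S this, of "(partial2 ^^ n) h" "G 0 n"] Suc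
      show "(partial2 ^^ Suc n) h x = G 0 (Suc n) x" by auto
    qed
  qed (use h in simp)
  have "\<forall>x\<in>S. (partial1 ^^ m) ((partial2 ^^ n) h) x = G m n x"
  proof (induction m)
    case (Suc m)
    show ?case
    proof
      fix x assume "x \<in> S"
      with 1[of x m n] partial_eqI(1)[OF S this, of "(partial1 ^^ m) ((partial2 ^^ n) h)" "G m n"] Suc
      show "(partial1 ^^ Suc m) ((partial2 ^^ n) h) x = G (Suc m) n x" by auto
    qed
  qed (use b in simp)
  then show ?thesis using x by (simp add: partial_multi_def)
qed

text \<open>Points of the circle are interior to the set on which f is smooth, so the partial
  derivatives are read off from f there; the ridge expansion is available on the closed disk
  only.\<close>

lemma partial_multi_smooth:
  assumes "smooth_near_disk f" "x \<in> unit_disk"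
  shows "partial_multi (m, n) f x = total_deriv f (replicate m 1 @ replicate n \<i>) x"
proof -
  obtain U where U: "open U" "unit_disk \<subseteq> U" "\<And>vs a. a \<in> U \<Longrightarrow> total_deriv f vs differentiable (at a)"
    using assms(1) unfolding smooth_near_disk_def by blast
  have "\<exists>D. (total_deriv f vs has_derivative D) (at a) \<and> D v = total_deriv f (v # vs) a" if "a \<in> U" for vs v a
    using U(3)[OF that, of vs] by (auto simp: frechet_derivative_works total_deriv.simps(2))
  then show ?thesis
    using U assms(2)
    by (intro partial_multi_eqI[where S = U and G = "\<lambda>m n. total_deriv f (replicate m 1 @ replicate n \<i>)"]) auto
qed

lemma poly_chebU_deriv_le:
  assumes "\<bar>t\<bar> \<le> 1"
  shows "\<bar>poly ((pderiv ^^ n) (chebU k)) t\<bar> \<le> real (Suc k) ^ (2 * n + 1)"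
proof -
  have "\<bar>poly ((pderiv ^^ n) (chebU k)) t\<bar> \<le> (real k + 1) * real k ^ (2 * n)"
    by (intro abs_poly_le_cheb_bounded[OF cheb_bounded_pderiv_funpow[OF cheb_bounded_chebU]] assms)
  also have "\<dots> \<le> real (Suc k) * real (Suc k) ^ (2 * n)"
    by (intro mult_mono power_mono) auto
  finally show ?thesis by simp
qed

text \<open>Decay of order n + 3 absorbs growth of order n, whatever n is.\<close>

lemma ridge_bounded_coeff:
  assumes f: "smooth_on_disk f"
    and p: "\<And>k j t. \<bar>t\<bar> \<le> R \<Longrightarrow> \<bar>w k j\<bar> * \<bar>poly (p k j) t\<bar> \<le> A * real (Suc k) ^ n"
  shows "ridge_bounded R (\<lambda>k j. ridge_coeff f k j * w k j) p"
proof -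
  obtain C where C: "\<And>k j. \<bar>ridge_coeff f k j\<bar> \<le> C / real (Suc k) ^ (n + 3)"
    using ridge_coeff_decay[OF f] by blast
  have "0 \<le> C" using C[of 0 0] by (simp add: order_trans[OF abs_ge_zero])
  have "\<bar>ridge_coeff f k j * w k j\<bar> * \<bar>poly (p k j) t\<bar> \<le> (C * A) / real (Suc k) ^ 3" if "\<bar>t\<bar> \<le> R" for k j t
  proof -
    have "\<bar>ridge_coeff f k j\<bar> * (\<bar>w k j\<bar> * \<bar>poly (p k j) t\<bar>) \<le> (C / real (Suc k) ^ (n + 3)) * (A * real (Suc k) ^ n)"
      using \<open>0 \<le> C\<close> by (intro mult_mono C p that) auto
    then show ?thesis by (simp add: abs_mult power_add mult.assoc del: of_nat_Suc)
  qed
  then show ?thesis unfolding ridge_bounded_def by blast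
qed

definition dir_prod :: "complex list \<Rightarrow> nat \<Rightarrow> nat \<Rightarrow> real" where
  "dir_prod vs k j = (\<Prod>v\<leftarrow>vs. ridge_dir k j \<bullet> v)"

lemma dir_prod_simps [simp]:
  "dir_prod [] k j = 1" "dir_prod (v # vs) k j = (ridge_dir k j \<bullet> v) * dir_prod vs k j"
  by (simp_all add: dir_prod_def)

lemma abs_dir_prod_le: "\<bar>dir_prod vs k j\<bar> \<le> (\<Prod>v\<leftarrow>vs. cmod v)"
proof (induction vs)
  case (Cons v vs)
  then show ?case using abs_inner_ridge_dir_le[of k j v] by (simp add: abs_mult mult_mono)
qed simp

lemma ridge_bounded_chebU:
  assumes f: "smooth_on_disk f"
  shows "ridge_bounded 1 (\<lambda>k j. ridge_coeff f k j * dir_prod vs k j) (\<lambda>k j. (pderiv ^^ n) (chebU k))"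
proof (rule ridge_bounded_coeff[OF f])
  fix k j and t :: real assume "\<bar>t\<bar> \<le> 1"
  then show "\<bar>dir_prod vs k j\<bar> * \<bar>poly ((pderiv ^^ n) (chebU k)) t\<bar> \<le> (\<Prod>v\<leftarrow>vs. cmod v) * real (Suc k) ^ (2 * n + 1)"
    by (intro mult_mono abs_dir_prod_le poly_chebU_deriv_le prod_list_nonneg) auto
qed

text \<open>Termwise differentiation works in the open disk, and both sides are continuous on the
  closed one. The circle matters because the vertices of the simplices lie on it.\<close>

lemma total_deriv_eq_ridge_series:
  assumes f: "smooth_on_disk f" and y: "y \<in> unit_disk"
  shows "total_deriv f vs y =
    ridge_series (\<lambda>k j. ridge_coeff f k j * dir_prod vs k j) (\<lambda>k j. (pderiv ^^ length vs) (chebU k)) y"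
  using y
proof (induction vs arbitrary: y)
  case Nil
  obtain C where "\<And>k j. \<bar>ridge_coeff f k j\<bar> \<le> C / real (Suc k) ^ 4" using ridge_coeff_decay[OF f] by blast
  then have "(\<lambda>k. \<Sum>j\<le>k. ridge_coeff f k j * poly (chebU k) (ridge_dir k j \<bullet> y)) sums f y"
    using continuous_on_total_deriv[OF f, of "[]"] Nil by (intro ridge_expansion_sums) auto
  then show ?case by (simp add: ridge_layer_def sums_iff)
next
  case (Cons v vs)
  let ?w = "\<lambda>k j. ridge_coeff f k j * dir_prod vs k j" and ?p = "\<lambda>k j. (pderiv ^^ length vs) (chebU k)"
  let ?w' = "\<lambda>k j. ridge_coeff f k j * dir_prod (v # vs) k j" and ?p' = "\<lambda>k j. (pderiv ^^ length (v # vs)) (chebU k)"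
  have b: "ridge_bounded 1 ?w ?p" "ridge_bounded 1 ?w (\<lambda>k j. pderiv (?p k j))" "ridge_bounded 1 ?w' ?p'"
    using ridge_bounded_chebU[OF f, of vs "length vs"] ridge_bounded_chebU[OF f, of vs "Suc (length vs)"]
      ridge_bounded_chebU[OF f, of "v # vs" "length (v # vs)"] by simp_all
  have interior: "total_deriv f (v # vs) x = ridge_series ?w' ?p' x" if x: "x \<in> ball 0 1" for x
  proof -
    have "(total_deriv f vs has_derivative (\<lambda>h. ridge_series (\<lambda>k j. ?w k j * (ridge_dir k j \<bullet> h)) (\<lambda>k j. pderiv (?p k j)) x)) (at x)"
      by (rule has_derivative_transform_within_open[OF ridge_series_has_derivative[OF b(1,2) x] open_ball x])
         (use Cons.IH in auto)
    from frechet_derivative_at[OF this]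
    have "total_deriv f (v # vs) x = ridge_series (\<lambda>k j. ?w k j * (ridge_dir k j \<bullet> v)) (\<lambda>k j. pderiv (?p k j)) x"
      by (simp only: total_deriv.simps(2) fun_eq_iff)
    then show ?thesis by (simp add: mult_ac)
  qed
  have "continuous_on unit_disk (\<lambda>x. total_deriv f (v # vs) x - ridge_series ?w' ?p' x)"
    by (intro continuous_on_diff continuous_on_total_deriv[OF f] continuous_on_ridge_series[OF b(3)])
  then have c: "continuous_on (closure (ball 0 1)) (\<lambda>x. total_deriv f (v # vs) x - ridge_series ?w' ?p' x)" by simp
  have "y \<in> closure (ball 0 1)" using Cons.prems by simp
  moreover have "total_deriv f (v # vs) x - ridge_series ?w' ?p' x = 0" if "x \<in> ball 0 1" for x
    using interior[OF that] by simp
  ultimately have "total_deriv f (v # vs) y - ridge_series ?w' ?p' y = 0"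
    by (rule continuous_constant_on_closure[OF c, rotated])
  then show ?case by simp
qed

lemma simplex_functional_cmult: "simplex_functional e d (\<lambda>y. c * g y) = c * simplex_functional e d g"
  by (simp add: simplex_functional_def set_lebesgue_integral_def mult.left_commute)

definition dir_coeff :: "(nat \<Rightarrow> complex) \<Rightarrow> nat \<Rightarrow> nat \<Rightarrow> nat \<Rightarrow> real" where
  "dir_coeff e d k j = newton_coeff (\<lambda>i. ridge_dir k j \<bullet> e i) k d"

definition dir_poly :: "(nat \<Rightarrow> complex) \<Rightarrow> nat \<Rightarrow> nat \<Rightarrow> nat \<Rightarrow> real poly" where
  "dir_poly e d k j = newton_poly (\<lambda>i. ridge_dir k j \<bullet> e i) d"

lemma simplex_functional_ridge_layer:
  assumes e: "\<And>j. e j \<in> unit_disk"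
  shows "simplex_functional e d (ridge_layer w (\<lambda>k j. (pderiv ^^ d) (chebU k)) k) = (\<Sum>j\<le>k. w k j * dir_coeff e d k j)"
proof -
  \<comment> \<open>Padding with 0 beyond k lets \<open>simplex_functional_sums\<close> treat the
    finite sum.\<close>
  define h where "h = (\<lambda>j y. if j \<le> k then w k j * poly ((pderiv ^^ d) (chebU k)) (ridge_dir k j \<bullet> y) else 0)"
  have h: "continuous_on A (h j)" for A j unfolding h_def by (cases "j \<le> k") (auto intro!: continuous_intros)
  have "\<exists>M. \<forall>y\<in>unit_disk. \<bar>h j y\<bar> \<le> M" for j
  proof -
    have "bounded (h j ` unit_disk)" by (intro compact_imp_bounded compact_continuous_image h) auto
    then show ?thesis by (auto simp: bounded_iff)
  qed
  then obtain M where M: "\<And>j y. y \<in> unit_disk \<Longrightarrow> \<bar>h j y\<bar> \<le> M j" by metis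
  have "(\<lambda>j. simplex_functional e d (h j)) sums simplex_functional e d (ridge_layer w (\<lambda>k j. (pderiv ^^ d) (chebU k)) k)"
  proof (rule simplex_functional_sums[OF e])
    show "continuous_on UNIV (h j)" for j by (rule h)
    show "\<bar>h j y\<bar> \<le> (if j \<in> {..k} then M j else 0)" if "y \<in> unit_disk" for j y
      using M[OF that, of j] by (auto simp: h_def)
    show "summable (\<lambda>j. if j \<in> {..k} then M j else 0)" by (rule summable_If_finite_set) simp
    show "(\<lambda>j. h j y) sums ridge_layer w (\<lambda>k j. (pderiv ^^ d) (chebU k)) k y" for y
    proof -
      have "(\<lambda>j. h j y) sums (\<Sum>j\<le>k. h j y)" by (rule sums_finite) (auto simp: h_def)
      then show ?thesis by (simp add: h_def ridge_layer_def)
    qed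
  qed
  moreover have "simplex_functional e d (h j) = (if j \<in> {..k} then w k j * dir_coeff e d k j else 0)" for j
  proof (cases "j \<le> k")
    case True
    then show ?thesis
      by (simp add: h_def simplex_functional_cmult simplex_functional_ridge simplex_int_chebU dir_coeff_def)
  next
    case False
    then show ?thesis using simplex_functional_cmult[of e d 0 "\<lambda>_. 0"] by (simp add: h_def)
  qed
  ultimately have "(\<lambda>j. if j \<in> {..k} then w k j * dir_coeff e d k j else 0) sums
      simplex_functional e d (ridge_layer w (\<lambda>k j. (pderiv ^^ d) (chebU k)) k)" by simp
  moreover have "(\<lambda>j. if j \<in> {..k} then w k j * dir_coeff e d k j else 0) sums (\<Sum>j\<le>k. w k j * dir_coeff e d k j)"
    by (rule sums_If_finite_set) simp
  ultimately show ?thesis by (rule sums_unique2)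
qed

text \<open>The directions x - e_j contribute the Newton polynomial at <u, x>, and the functional
  turns the d-th derivative of U_k into the divided difference. Only the argument of the functional
  stays in the disk; x is arbitrary, which permits differentiation in x across the circle.\<close>

lemma series_term_eq_ridge_series:
  assumes e: "\<And>j. e j \<in> unit_disk" and f: "smooth_on_disk f"
  shows "series_term e f d x = ridge_series (\<lambda>k j. ridge_coeff f k j * dir_coeff e d k j) (dir_poly e d) x"
proof -
  define vs where "vs = map (\<lambda>j. x - e j) [0..<d]"
  let ?w = "\<lambda>k j. ridge_coeff f k j * dir_prod vs k j" and ?p = "\<lambda>k j. (pderiv ^^ d) (chebU k)"
  have b: "ridge_bounded 1 ?w ?p" by (rule ridge_bounded_chebU[OF f])
  obtain C where C: "\<And>k y. cmod y \<le> 1 \<Longrightarrow> \<bar>ridge_layer ?w ?p k y\<bar> \<le> C / (real (Suc k))\<^sup>2"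
    using ridge_bounded_layer[OF b] by blast
  have "(\<lambda>k. simplex_functional e d (ridge_layer ?w ?p k)) sums simplex_functional e d (total_deriv f vs)"
  proof (rule simplex_functional_sums[OF e _ _ summable_inverse_Suc_square[of C]])
    show "continuous_on UNIV (ridge_layer ?w ?p k)" for k
      unfolding ridge_layer_def by (intro continuous_intros)
    show "(\<lambda>k. ridge_layer ?w ?p k y) sums total_deriv f vs y" if "y \<in> unit_disk" for y
      using ridge_bounded_summable[OF b, of y] that total_deriv_eq_ridge_series[OF f that, of vs]
      by (simp add: vs_def summable_sums)
  qed (use C in auto)
  moreover have "simplex_functional e d (ridge_layer ?w ?p k)
      = ridge_layer (\<lambda>k j. ridge_coeff f k j * dir_coeff e d k j) (dir_poly e d) k x" for k
  proof -
    have "dir_prod vs k j = poly (dir_poly e d k j) (ridge_dir k j \<bullet> x)" for k j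
      unfolding dir_prod_def dir_poly_def poly_newton_poly vs_def map_map
      by (simp add: inner_diff_right atLeast0LessThan flip: prod.distinct_set_conv_list)
    then show ?thesis
      unfolding simplex_functional_ridge_layer[OF e] ridge_layer_def by (simp add: mult_ac)
  qed
  ultimately show ?thesis by (simp add: sums_iff series_term_def vs_def)
qed

text \<open>48 = 3 * 2^4, from k + 2 \<le> 2 (k + 1).\<close>

lemma abs_dir_coeff_le:
  assumes "Leja_sequence e" "e 0 = 1"
  shows "\<bar>dir_coeff e d k j\<bar> \<le> 48 * 2 ^ d * real (Suc k) ^ 4"
proof (cases "d \<le> k")
  case True
  have "\<bar>dir_coeff e d k j\<bar> \<le> 3 * 2 ^ d * (real k + 2) ^ 4"
    unfolding dir_coeff_def using assms True by (intro leja_newton_coeff_le) auto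
  also have "\<dots> \<le> 3 * 2 ^ d * (2 * real (Suc k)) ^ 4"
    by (intro mult_left_mono power_mono) auto
  also have "\<dots> = 48 * 2 ^ d * real (Suc k) ^ 4" by (simp only: power_mult_distrib) simp
  finally show ?thesis .
qed (simp add: dir_coeff_def newton_coeff_eq_0)

lemma cheb_bounded_dir_poly:
  assumes "Leja_sequence e" "e 0 = 1"
  shows "cheb_bounded d ((real d + 1)\<^sup>2 / 2 ^ d * real d ^ (2 * s)) ((pderiv ^^ s) (dir_poly e d k j))"
  unfolding dir_poly_def
  by (intro cheb_bounded_pderiv_funpow cheb_bounded_leja_newton assms) simp

lemma abs_power_inner_le: "\<bar>(ridge_dir k j \<bullet> 1) ^ m * (ridge_dir k j \<bullet> \<i>) ^ n\<bar> \<le> 1"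
proof -
  have "\<bar>ridge_dir k j \<bullet> 1\<bar> ^ m * \<bar>ridge_dir k j \<bullet> \<i>\<bar> ^ n \<le> 1 * 1"
    using abs_inner_ridge_dir_le[of k j 1] abs_inner_ridge_dir_le[of k j \<i>]
    by (intro mult_mono power_le_one) auto
  then show ?thesis by (simp add: abs_mult power_abs)
qed

definition term_weight :: "(nat \<Rightarrow> complex) \<Rightarrow> nat \<Rightarrow> nat \<Rightarrow> nat \<Rightarrow> nat \<Rightarrow> nat \<Rightarrow> real" where
  "term_weight e d m n k j = dir_coeff e d k j * ((ridge_dir k j \<bullet> 1) ^ m * (ridge_dir k j \<bullet> \<i>) ^ n)"

text \<open>Radius 2 places the closed disk inside an open set where the term can be differentiated.
  Factors such as 5^d are harmless because d is fixed here; the estimates needed for the limit are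
  those of \<open>abs_newton_remainder_le\<close>.\<close>

lemma ridge_bounded_term:
  assumes e: "Leja_sequence e" "e 0 = 1" and f: "smooth_on_disk f"
  shows "ridge_bounded 2 (\<lambda>k j. ridge_coeff f k j * term_weight e d m n k j) (\<lambda>k j. (pderiv ^^ s) (dir_poly e d k j))"
proof (rule ridge_bounded_coeff[OF f])
  fix k j and t :: real assume t: "\<bar>t\<bar> \<le> 2"
  define B where "B = (real d + 1)\<^sup>2 / 2 ^ d * real d ^ (2 * s) * 5 ^ d"
  have "\<bar>term_weight e d m n k j\<bar> * \<bar>poly ((pderiv ^^ s) (dir_poly e d k j)) t\<bar> \<le> (48 * 2 ^ d * real (Suc k) ^ 4 * 1) * B"
    unfolding term_weight_def abs_mult[of "dir_coeff e d k j"] B_def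
    by (intro mult_mono abs_dir_coeff_le abs_power_inner_le
        abs_poly_le_cheb_bounded_power[OF cheb_bounded_dir_poly] e t) auto
  then show "\<bar>term_weight e d m n k j\<bar> * \<bar>poly ((pderiv ^^ s) (dir_poly e d k j)) t\<bar> \<le> (48 * 2 ^ d * B) * real (Suc k) ^ 4"
    by (simp only: mult_ac mult_1_left mult_1_right)
qed

lemma partial_multi_partial_sum:
  assumes e: "Leja_sequence e" "e 0 = 1" and f: "smooth_on_disk f" and x: "x \<in> ball 0 2"
  shows "partial_multi (m, n) (\<lambda>x. \<Sum>d\<le>N. series_term e f d x) x =
    (\<Sum>d\<le>N. ridge_series (\<lambda>k j. ridge_coeff f k j * term_weight e d m n k j) (\<lambda>k j. (pderiv ^^ (m + n)) (dir_poly e d k j)) x)"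
proof -
  let ?w = "\<lambda>d m n k j. ridge_coeff f k j * term_weight e d m n k j"
  let ?p = "\<lambda>d s k j. (pderiv ^^ s) (dir_poly e d k j)"
  have ed: "e j \<in> unit_disk" for j using e by (simp add: Leja_sequence_def)
  have deriv: "((\<lambda>x. \<Sum>d\<le>N. ridge_series (?w d m n) (?p d s) x) has_derivative
      (\<lambda>h. \<Sum>d\<le>N. ridge_series (\<lambda>k j. ?w d m n k j * (ridge_dir k j \<bullet> h)) (?p d (Suc s)) x)) (at x)"
    if "x \<in> ball 0 2" for m n s x
    using ridge_series_has_derivative[OF ridge_bounded_term[OF e f] _ that] ridge_bounded_term[OF e f, of _ m n "Suc s"]
    by (intro has_derivative_sum) simp
  have shift: "term_weight e d m n k j * (ridge_dir k j \<bullet> 1) = term_weight e d (Suc m) n k j"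
    "term_weight e d m n k j * (ridge_dir k j \<bullet> \<i>) = term_weight e d m (Suc n) k j" for d m n k j
    by (simp_all add: term_weight_def)
  show ?thesis
  proof (rule partial_multi_eqI[where S = "ball 0 2" and G = "\<lambda>m n x. \<Sum>d\<le>N. ridge_series (?w d m n) (?p d (m + n)) x"])
    show "(\<Sum>d\<le>N. series_term e f d x) = (\<Sum>d\<le>N. ridge_series (?w d 0 0) (?p d (0 + 0)) x)" for x
      by (simp add: series_term_eq_ridge_series[OF ed f] term_weight_def)
    show "\<exists>D. ((\<lambda>x. \<Sum>d\<le>N. ridge_series (?w d m n) (?p d (m + n)) x) has_derivative D) (at x) \<and>
        D 1 = (\<Sum>d\<le>N. ridge_series (?w d (Suc m) n) (?p d (Suc m + n)) x)" if "x \<in> ball 0 2" for m n x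
      by (rule exI, rule conjI, rule deriv[OF that]) (simp only: mult.assoc shift add_Suc add_Suc_right add_0)
    show "\<exists>D. ((\<lambda>x. \<Sum>d\<le>N. ridge_series (?w d 0 n) (?p d (0 + n)) x) has_derivative D) (at x) \<and>
        D \<i> = (\<Sum>d\<le>N. ridge_series (?w d 0 (Suc n)) (?p d (0 + Suc n)) x)" if "x \<in> ball 0 2" for n x
      by (rule exI, rule conjI, rule deriv[OF that]) (simp only: mult.assoc shift add_Suc add_Suc_right add_0)
  qed (use x in auto)
qed

text \<open>The remainder is the tail N < d \<le> k of the Newton expansion, so it is empty for k
  \<le> N and bounded uniformly in N. In each term 2^d cancels; the exponent collects 4 from the
  divided difference, 2 + 2 s from the differentiated Newton polynomial and 1 from the number of
  terms.\<close>

lemma abs_newton_remainder_le: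
  fixes k j s N :: nat and t :: real
  assumes e: "Leja_sequence e" "e 0 = 1" and t: "\<bar>t\<bar> \<le> 1"
  defines "E \<equiv> poly ((pderiv ^^ s) (chebU k)) t - (\<Sum>d\<le>N. dir_coeff e d k j * poly ((pderiv ^^ s) (dir_poly e d k j)) t)"
  shows "\<bar>E\<bar> \<le> 48 * real (Suc k) ^ (7 + 2 * s)" and "k \<le> N \<Longrightarrow> E = 0"
proof -
  define a where "a = (\<lambda>d. dir_coeff e d k j * poly ((pderiv ^^ s) (dir_poly e d k j)) t)"
  have U: "poly ((pderiv ^^ s) (chebU k)) t = (\<Sum>d\<le>k. a d)"
    unfolding a_def dir_coeff_def dir_poly_def
    by (subst chebU_eq_newton[of k "\<lambda>i. ridge_dir k j \<bullet> e i"]) (simp add: higher_pderiv_sum higher_pderiv_smult poly_sum)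
  have a0: "a d = 0" if "k < d" for d using that by (simp add: a_def dir_coeff_def newton_coeff_eq_0)
  have E: "E = (\<Sum>d\<le>k. a d) - (\<Sum>d\<le>N. a d)" by (simp add: E_def U a_def)
  show zero: "E = 0" if "k \<le> N"
  proof -
    have "(\<Sum>d\<le>k. a d) = (\<Sum>d\<le>N. a d)" using that a0 by (intro sum.mono_neutral_left) auto
    then show ?thesis by (simp add: E)
  qed
  have a: "\<bar>a d\<bar> \<le> 48 * real (Suc k) ^ (6 + 2 * s)" if "d \<le> k" for d
  proof -
    have "\<bar>a d\<bar> \<le> (48 * 2 ^ d * real (Suc k) ^ 4) * ((real d + 1)\<^sup>2 / 2 ^ d * real d ^ (2 * s))"
      unfolding a_def abs_mult
      by (intro mult_mono abs_dir_coeff_le abs_poly_le_cheb_bounded[OF cheb_bounded_dir_poly] e t) auto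
    also have "\<dots> = 48 * (real (Suc k) ^ 4 * ((real d + 1)\<^sup>2 * real d ^ (2 * s)))" by simp
    also have "\<dots> \<le> 48 * (real (Suc k) ^ 4 * (real (Suc k) ^ 2 * real (Suc k) ^ (2 * s)))"
      using that by (intro mult_left_mono mult_mono power_mono) auto
    also have "\<dots> = 48 * real (Suc k) ^ (6 + 2 * s)" by (simp only: power_add[symmetric]) simp
    finally show ?thesis .
  qed
  have "\<bar>E\<bar> \<le> (\<Sum>d\<le>k. \<bar>a d\<bar>)"
  proof (cases "k \<le> N")
    case False
    then have "E = (\<Sum>d\<in>{..k} - {..N}. a d)" unfolding E by (simp add: sum_diff)
    also have "\<bar>\<dots>\<bar> \<le> (\<Sum>d\<in>{..k} - {..N}. \<bar>a d\<bar>)" by (rule sum_abs)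
    also have "\<dots> \<le> (\<Sum>d\<le>k. \<bar>a d\<bar>)" by (intro sum_mono2) auto
    finally show ?thesis .
  qed (simp add: zero sum_nonneg)
  also have "\<dots> \<le> (\<Sum>d\<le>k. 48 * real (Suc k) ^ (6 + 2 * s))" using a by (intro sum_mono) auto
  also have "\<dots> = 48 * real (Suc k) ^ (7 + 2 * s)" by (simp add: power_add power_Suc[of _ 6, simplified])
  finally show "\<bar>E\<bar> \<le> 48 * real (Suc k) ^ (7 + 2 * s)" .
qed

text \<open>After exchanging the sums over d and k, layer k of the error carries the Newton
  remainder of U_k. It vanishes for k \<le> N and has a bound independent of N otherwise, so the
  error is dominated by the tail of one summable series in k.\<close>

lemma uniform_limit_partial_multi:
  assumes e: "Leja_sequence e" "e 0 = 1" and f: "smooth_near_disk f"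
  shows "uniform_limit unit_disk (\<lambda>N. partial_multi (m, n) (\<lambda>x. \<Sum>d\<le>N. series_term e f d x)) (partial_multi (m, n) f) sequentially"
proof (rule uniform_limitI)
  fix \<epsilon> :: real assume \<epsilon>: "0 < \<epsilon>"
  have f': "smooth_on_disk f" by (rule smooth_near_disk_imp[OF f])
  define s where "s = m + n"
  define g where "g = (\<lambda>k j. (ridge_dir k j \<bullet> 1) ^ m * (ridge_dir k j \<bullet> \<i>) ^ n)"
  \<comment> \<open>Order 7 + 2 s absorbs the Newton remainder; the additional 3 makes the layers
    summable.\<close>
  obtain C where C: "\<And>k j. \<bar>ridge_coeff f k j\<bar> \<le> C / real (Suc k) ^ (7 + 2 * s + 3)"
    using ridge_coeff_decay[OF f'] by blast
  have "0 \<le> C" using C[of 0 0] by (simp add: order_trans[OF abs_ge_zero])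
  obtain N0 where N0: "\<And>N. N0 \<le> N \<Longrightarrow> norm (\<Sum>k. (C * 48) / (real (Suc (k + N)))\<^sup>2) < \<epsilon>"
    using suminf_exist_split[OF \<epsilon> summable_inverse_Suc_square[of "C * 48"]] by blast
  have "dist (partial_multi (m, n) (\<lambda>x. \<Sum>d\<le>N. series_term e f d x) x) (partial_multi (m, n) f x) < \<epsilon>"
    if N: "N0 \<le> N" and x: "x \<in> unit_disk" for N x
  proof -
    let ?b = "ridge_coeff f"
    define L where "L = ridge_layer (\<lambda>k j. ?b k j * g k j) (\<lambda>k j. (pderiv ^^ s) (chebU k))"
    define T where "T = (\<lambda>d. ridge_layer (\<lambda>k j. ?b k j * term_weight e d m n k j) (\<lambda>k j. (pderiv ^^ s) (dir_poly e d k j)))"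
    define P where "P = (\<lambda>k j. (pderiv ^^ s) (chebU k) - (\<Sum>d\<le>N. smult (dir_coeff e d k j) ((pderiv ^^ s) (dir_poly e d k j))))"
    define R where "R = (\<lambda>k. ridge_layer (\<lambda>k j. ?b k j * g k j) P k x)"
    have vs: "dir_prod (replicate m 1 @ replicate n \<i>) k j = g k j" for k j
      by (simp add: dir_prod_def g_def prod_list_replicate)
    have Pf: "partial_multi (m, n) f x = (\<Sum>k. L k x)"
      unfolding partial_multi_smooth[OF f x] total_deriv_eq_ridge_series[OF f' x] vs L_def s_def by simp
    have PW: "partial_multi (m, n) (\<lambda>x. \<Sum>d\<le>N. series_term e f d x) x = (\<Sum>d\<le>N. \<Sum>k. T d k x)"
      using x by (subst partial_multi_partial_sum[OF e f']) (auto simp: T_def s_def)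
    have sumL: "summable (\<lambda>k. L k x)"
      unfolding L_def using ridge_bounded_chebU[OF f', of "replicate m 1 @ replicate n \<i>" s] x
      by (intro ridge_bounded_summable[where R = 1]) (auto simp: vs)
    have sumT: "summable (\<lambda>k. T d k x)" for d
      unfolding T_def using ridge_bounded_term[OF e f', of d m n s] x
      by (intro ridge_bounded_summable[where R = 2]) auto
    have R: "R k = L k x - (\<Sum>d\<le>N. T d k x)" for k
    proof -
      have "(\<Sum>d\<le>N. T d k x) = (\<Sum>j\<le>k. \<Sum>d\<le>N. ?b k j * term_weight e d m n k j * poly ((pderiv ^^ s) (dir_poly e d k j)) (ridge_dir k j \<bullet> x))"
        unfolding T_def ridge_layer_def by (rule sum.swap)
      then show ?thesis
        by (simp add: R_def L_def P_def ridge_layer_def term_weight_def g_def poly_sum sum_subtractf right_diff_distrib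
            sum_distrib_left mult_ac)
    qed
    have bound: "\<bar>R k\<bar> \<le> (C * 48) / (real (Suc k))\<^sup>2" for k
      unfolding R_def
    proof (rule abs_ridge_layer_le)
      fix j
      have "\<bar>?b k j\<bar> * (\<bar>g k j\<bar> * \<bar>poly (P k j) (ridge_dir k j \<bullet> x)\<bar>)
          \<le> (C / real (Suc k) ^ (7 + 2 * s + 3)) * (1 * (48 * real (Suc k) ^ (7 + 2 * s)))"
      proof (intro mult_mono C)
        show "\<bar>g k j\<bar> \<le> 1" unfolding g_def by (rule abs_power_inner_le)
        have "\<bar>ridge_dir k j \<bullet> x\<bar> \<le> 1" using abs_inner_ridge_dir_le[of k j x] x by simp
        then show "\<bar>poly (P k j) (ridge_dir k j \<bullet> x)\<bar> \<le> 48 * real (Suc k) ^ (7 + 2 * s)"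
          using abs_newton_remainder_le(1)[OF e, where t = "ridge_dir k j \<bullet> x" and s = s and k = k and N = N and j = j] by (simp add: P_def poly_sum)
      qed (use \<open>0 \<le> C\<close> in auto)
      also have "\<dots> = (C * 48) / real (Suc k) ^ 3"
      proof -
        have "(C / z ^ (q + 3)) * (1 * (48 * z ^ q)) = (C * 48) / z ^ 3" if "z \<noteq> 0" for z and q :: nat
          using that by (simp add: power_add)
        from this[of "real (Suc k)" "7 + 2 * s"] show ?thesis by (simp only: of_nat_eq_0_iff nat.distinct simp_thms)
      qed
      finally show "\<bar>?b k j * g k j\<bar> * \<bar>poly (P k j) (ridge_dir k j \<bullet> x)\<bar> \<le> (C * 48) / real (Suc k) ^ 3"
        by (simp only: abs_mult mult.assoc)
    qed
    have "R k = 0" if "k < N" for k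
    proof -
      have "poly (P k j) (ridge_dir k j \<bullet> x) = 0" for j
        using abs_newton_remainder_le(2)[OF e, where t = "ridge_dir k j \<bullet> x" and s = s and k = k and N = N and j = j] abs_inner_ridge_dir_le[of k j x] x that
        by (simp add: P_def poly_sum)
      then show ?thesis by (simp add: R_def ridge_layer_def)
    qed
    then have "(\<Sum>k<N. R k) = 0" by simp
    then have "\<bar>suminf R\<bar> \<le> (\<Sum>k. (C * 48) / (real (Suc (k + N)))\<^sup>2)"
      using suminf_tail_bound[OF bound summable_inverse_Suc_square, of N] by simp
    also have "\<dots> < \<epsilon>" using N0[OF N] by simp
    finally have "\<bar>suminf R\<bar> < \<epsilon>" .
    moreover have "suminf R = partial_multi (m, n) f x - partial_multi (m, n) (\<lambda>x. \<Sum>d\<le>N. series_term e f d x) x"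
      unfolding R Pf PW
      using suminf_diff[OF sumL summable_sum[of "{..N}" "\<lambda>d k. T d k x", OF sumT]] suminf_sum[of "{..N}" "\<lambda>d k. T d k x", OF sumT]
      by simp
    ultimately show ?thesis by (simp add: dist_real_def abs_minus_commute)
  qed
  then show "\<forall>\<^sub>F N in sequentially. \<forall>x\<in>unit_disk.
      dist (partial_multi (m, n) (\<lambda>x. \<Sum>d\<le>N. series_term e f d x) x) (partial_multi (m, n) f x) < \<epsilon>"
    by (intro eventually_sequentiallyI[of N0]) blast
qed

theorem corollary4p4:
  fixes e :: "nat \<Rightarrow> complex" and f :: "complex \<Rightarrow> real"
  assumes "Leja_sequence e" and "e 0 = 1" and "smooth_near_disk f"
  shows "uniform_limit unit_disk (\<lambda>N x. \<Sum>d\<le>N. series_term e f d x) f sequentially \<and>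
         (\<forall>\<beta> :: nat \<times> nat.
           uniform_limit unit_disk
             (\<lambda>N. partial_multi \<beta> (\<lambda>x. \<Sum>d\<le>N. series_term e f d x))
             (partial_multi \<beta> f) sequentially)"
proof -
  have all: "\<forall>\<beta>. uniform_limit unit_disk (\<lambda>N. partial_multi \<beta> (\<lambda>x. \<Sum>d\<le>N. series_term e f d x))
      (partial_multi \<beta> f) sequentially"
    using uniform_limit_partial_multi[OF assms] by auto
  show ?thesis
  proof
    show "uniform_limit unit_disk (\<lambda>N x. \<Sum>d\<le>N. series_term e f d x) f sequentially"
      using all[rule_format, of "(0, 0)"] by (simp add: partial_multi_def)
  qed (rule all)
qed

end
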